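(* Suppose that Assumption A (stated in the context) holds, and let $(\Delta z,\Delta\lambda,\Delta s)$ be the exact primal-dual step at $(z,\lambda,s)$. When the step $(\widehat{\Delta z},\widehat{\Delta\lambda},\widehat{\Delta s})$ is calculated in the finite-precision environment described in the context by using the procedure augmented, where the algorithm used to solve the augmented linear system satisfies the backward-error Condition P stated in the context, we have $$(\Delta z-\widehat{\Delta z},\;U^T(\Delta\lambda_{\mathcal{B}}-\widehat{\Delta\lambda}_{\mathcal{B}}),\;\Delta s-\widehat{\Delta s})=\delta_{\mathbf u},$$ $$V^T(\Delta\lambda_{\mathcal{B}}-\widehat{\Delta\lambda}_{\mathcal{B}})=\delta_{\mathbf u}/\mu,\qquad \Delta\lambda_{\mathcal{N}}-\widehat{\Delta\lambda}_{\mathcal{N}}=\delta_{\mathbf u}.$$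
   Context: (NLP) is $\min_z\phi(z)$ subject to $g(z)\le0$, where $\phi:\mathbb{R}^n\to\mathbb{R}$ and $g:\mathbb{R}^n\to\mathbb{R}^m$ are twice Lipschitz continuously differentiable. $\mathcal{L}(z,\lambda)=\phi(z)+\lambda^Tg(z)$; $\mathcal{L}_z$, $\mathcal{L}_{zz}$ are its gradient and Hessian in $z$. $\nabla g(z)=[\nabla g_1(z),\dots,\nabla g_m(z)]$. KKT conditions: $\mathcal{L}_z(z,\lambda)=0$, $g(z)\le0$, $\lambda\ge0$, $\lambda^Tg(z)=0$. $\mathcal{S}_\lambda$ is the set of $\lambda^*$ such that $(z^*,\lambda^* )$ satisfies the KKT conditions, $\mathcal{S}=\{z^*\}\times\mathcal{S}_\lambda$, $\delta(z,\lambda)$ is the Euclidean distance from $(z,\lambda)$ to $\mathcal{S}$. $\mathcal{B}=\{i:g_i(z^* )=0\}$, $\mathcal{N}=\{1,\dots,m\}\setminus\mathcal{B}$, $\mathcal{B}_+=\{i\in\mathcal{B}:\lambda_i^*>0\text{ for some }\lambda^*\in\mathcal{S}_\lambda\}$. Subscripts $\mathcal{B},\mathcal{N}$ denote subvectors/submatrices; $\nabla g_{\mathcal{B}}(z),\nabla g_{\mathcal{N}}(z)$ have columns $\nabla g_i(z)$, $i\in\mathcal{B}$, resp. $i\in\mathcal{N}$. $S=\mathrm{diag}(s)$, $\Lambda=\mathrm{diag}(\lambda)$, $D_{\mathcal{B}}=\Lambda_{\mathcal{B}}^{-1}S_{\mathcal{B}}$, $D_{\mathcal{N}}=\Lambda_{\mathcal{N}}^{-1}S_{\mathcal{N}}$,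 $e=(1,\dots,1)^T$. SVD: $\nabla g_{\mathcal{B}}(z^* )=\begin{bmatrix}\hat U&\hat V\end{bmatrix}\begin{bmatrix}\Sigma&0\\ 0&0\end{bmatrix}\begin{bmatrix}U^T\\ V^T\end{bmatrix}=\hat U\Sigma U^T$ with $[\hat U\ \hat V]$, $[U\ V]$ orthogonal and $\Sigma$ diagonal with positive diagonal. $\sigma_{\min}$ denotes smallest eigenvalue. Assumption A. (a) $z^*$ is a solution of (NLP), so the KKT conditions hold ($\mathcal{S}_\lambda\neq\emptyset$). MFCQ: there is $\bar y$ with $\nabla g_{\mathcal{B}}(z^* )^T\bar y<0$. Second-order conditions: there is $\xi>0$ with $w^T\mathcal{L}_{zz}(z^*,\lambda^* )w\ge\xi\|w\|^2$ for all $\lambda^*\in\mathcal{S}_\lambda$ and all $w$ with $\nabla g_i(z^* )^Tw=0$ ($i\in\mathcal{B}_+$), $\nabla g_i(z^* )^Tw\le0$ ($i\in\mathcal{B}\setminus\mathcal{B}_+$). SC: some $\lambda^*\in\mathcal{S}_\lambda$ has $\lambda_i^*>0$ for all $i\in\mathcal{B}$. The current iterate $(z,\lambda,s)$ satisfies, with $\mu=\lambda^Ts/m$ and fixed constants $C>0$, $\gamma\in(0,1)$: $\|\mathcal{L}_z(z,\lambda)\|\le C\mu$, $\|g(z)+s\|\le C\mu$, $(\lambda,s)>0$, $\lambda_is_i\ge\gamma\mu$ for all $i$. The vector $t\in\mathbb{R}^m$ satisfies $t=O(\mu^2)$. (b) For a sufficiently large $\beta>0$: $\mathbf u/\mu\ll1$,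 $\mathbf u\ll1$, $\sigma_{\min}(\Sigma)\ge\beta\max(\mu^{1/3},\mathbf u/\mu)$, and $\sigma_{\min}(\hat V^T\mathcal{L}_{zz}(z^*,\lambda^* )\hat V)\ge\beta\max(\mu^{1/3},\mathbf u/\mu)$ for all $\lambda^*\in\mathcal{S}_\lambda$. Exact step: the solution of $$\begin{bmatrix} \mathcal{L}_{zz}(z,\lambda) & \nabla g(z) & 0\\ \nabla g(z)^T & 0 & I\\ 0 & S & \Lambda\end{bmatrix}\begin{bmatrix}\Delta z\\ \Delta\lambda\\ \Delta s\end{bmatrix}=-\begin{bmatrix}\mathcal{L}_z(z,\lambda)\\ g(z)+s\\ S\Lambda e+t\end{bmatrix}.$$ Procedure augmented: given $(z,\lambda,s)$, form and solve the augmented system $$\begin{bmatrix}\mathcal{L}_{zz}(z,\lambda)&\nabla g_{\mathcal{B}}(z)&\nabla g_{\mathcal{N}}(z)\\ \nabla g_{\mathcal{B}}(z)^T&-D_{\mathcal{B}}&0\\ \nabla g_{\mathcal{N}}(z)^T&0&-D_{\mathcal{N}}\end{bmatrix}\begin{bmatrix}\Delta z\\ \Delta\lambda_{\mathcal{B}}\\ \Delta\lambda_{\mathcal{N}}\end{bmatrix}=\begin{bmatrix}-\mathcal{L}_z(z,\lambda)\\ -g_{\mathcal{B}}(z)+\Lambda_{\mathcal{B}}^{-1}t_{\mathcal{B}}\\ -g_{\mathcal{N}}(z)+\Lambda_{\mathcal{N}}^{-1}t_{\mathcal{N}}\end{bmatrix}$$ for $(\Delta z,\Delta\lambda)$, then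 set $\Delta s=-(g(z)+s)-\nabla g(z)^T\Delta z$. Finite-precision environment: $z,\lambda,s,t$ are floating-point vectors. $\mathbf u$ is the unit roundoff: for floating-point numbers $x,y$ and $\mathrm{op}\in\{+,-,\times,/\}$, $fl(x\,\mathrm{op}\,y)=(x\,\mathrm{op}\,y)(1+\epsilon)$ with $|\epsilon|\le\mathbf u$. The computed values of $\mathcal{L}_{zz}(z,\lambda)$, $\mathcal{L}_z(z,\lambda)$, $\nabla g(z)$, $g(z)$ differ from the exact ones by perturbations of size $\delta_{\mathbf u}$. The computed $D_{\mathcal{B}}$, $D_{\mathcal{N}}$ are $D_{\mathcal{B}}+G_{\mathcal{B}}$, $D_{\mathcal{N}}+G_{\mathcal{N}}$ with $G_{\mathcal{B}},G_{\mathcal{N}}$ diagonal, $G_{\mathcal{B}}=\mu\,\delta_{\mathbf u}$, $G_{\mathcal{N}}=\delta_{\mathbf u}/\mu$. The right-hand side is formed from computed quantities in floating-point arithmetic. The final assignment for $\Delta s$ is carried out in floating-point arithmetic using the computed $\widehat{\Delta z}$ and the computed values of $g(z)$, $\nabla g(z)$. Condition P: the solution obtained by applying the algorithm to the (computed) augmented system in floating-point arithmetic is the exact solution of a perturbed system in which the right-hand side is unperturbed and the perturbation $(E_{ij})_{i,j=1,2,3}$ of the coefficient matrix (partitioned into $3\times3$ blocks whose row and column blocks have sizes $n$, $|\mathcal{B}|$, $|\mathcal{N}|$, corresponding to the unknowns $\Delta z$, $\Delta\lambda_{\mathcal{B}}$, $\Delta\lambda_{\mathcal{N}}$ of the augmented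 system) satisfies $E_{11}=\delta_{\mathbf u}/\mu$, $E_{33}=\delta_{\mathbf u}/\mu^2$, $E_{12},E_{21},E_{22}=\delta_{\mathbf u}$, $E_{13},E_{31},E_{23},E_{32}=\delta_{\mathbf u}/\mu$. Conventions: $O(\epsilon)$ means norm at most a constant times $\epsilon$; $\delta_{\mathbf u}$ denotes any quantity of norm at most a constant times $\mathbf u$. Precisely: for fixed problem, $z^*$, $C,\gamma$ and every choice of the constants implicit in the hypotheses, there exist $\epsilon,\eta,\beta_0,K'>0$ depending only on these such that, whenever the hypotheses hold with $\delta(z,\lambda)\le\epsilon$, $\mu\le\epsilon$, $\mathbf u/\mu\le\eta$, $\mathbf u\le\eta$, $\beta\ge\beta_0$, the conclusions hold with all implied constants equal to $K'$. *)

theory Defs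
  imports "HOL-Analysis.Analysis" "HOL-Library.Multiset"
begin

section \<open>The nonlinear program and its first- and second-order conditions\<close>

definition grad :: "(real^'n \<Rightarrow> real) \<Rightarrow> real^'n \<Rightarrow> real^'n" where
  "grad f z = (\<chi> i. frechet_derivative f (at z) (axis i 1))"

definition hess :: "(real^'n \<Rightarrow> real) \<Rightarrow> real^'n \<Rightarrow> real^'n^'n" where
  "hess f z = jacobian (grad f) (at z)"

text \<open>Lipschitz continuity of the second derivative is only required locally.\<close>

definition twice_lipschitz_diff :: "(real^'n \<Rightarrow> real) \<Rightarrow> bool" where
  "twice_lipschitz_diff f \<longleftrightarrow>
     (\<forall>z. f differentiable (at z)) \<and> (\<forall>z. grad f differentiable (at z)) \<and>
     (\<forall>z. \<exists>r>0. \<exists>L. L-lipschitz_on (ball z r) (hess f))"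

definition lagr :: "(real^'n \<Rightarrow> real) \<Rightarrow> (real^'n \<Rightarrow> real^'m) \<Rightarrow> real^'n \<Rightarrow> real^'m \<Rightarrow> real" where
  "lagr \<phi> g z l = \<phi> z + l \<bullet> g z"

definition lagr_z ::
  "(real^'n \<Rightarrow> real) \<Rightarrow> (real^'n \<Rightarrow> real^'m) \<Rightarrow> real^'n \<Rightarrow> real^'m \<Rightarrow> real^'n" where
  "lagr_z \<phi> g z l = grad (\<lambda>y. lagr \<phi> g y l) z"

definition lagr_zz ::
  "(real^'n \<Rightarrow> real) \<Rightarrow> (real^'n \<Rightarrow> real^'m) \<Rightarrow> real^'n \<Rightarrow> real^'m \<Rightarrow> real^'n^'n" where
  "lagr_zz \<phi> g z l = hess (\<lambda>y. lagr \<phi> g y l) z"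

text \<open>The \<open>n \<times> m\<close> matrix whose columns are the constraint gradients.\<close>

definition nabla :: "(real^'n \<Rightarrow> real^'m) \<Rightarrow> real^'n \<Rightarrow> real^'m^'n" where
  "nabla g z = (\<chi> j i. grad (\<lambda>y. g y $ i) z $ j)"

definition kkt ::
  "(real^'n \<Rightarrow> real) \<Rightarrow> (real^'n \<Rightarrow> real^'m) \<Rightarrow> real^'n \<Rightarrow> real^'m \<Rightarrow> bool" where
  "kkt \<phi> g z l \<longleftrightarrow>
     lagr_z \<phi> g z l = 0 \<and> (\<forall>i. g z $ i \<le> 0) \<and> (\<forall>i. 0 \<le> l $ i) \<and> l \<bullet> g z = 0"

definition multipliers ::
  "(real^'n \<Rightarrow> real) \<Rightarrow> (real^'n \<Rightarrow> real^'m) \<Rightarrow> real^'n \<Rightarrow> (real^'m) set" where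
  "multipliers \<phi> g zs = {l. kkt \<phi> g zs l}"

definition active :: "(real^'n \<Rightarrow> real^'m) \<Rightarrow> real^'n \<Rightarrow> 'm set" where
  "active g zs = {i. g zs $ i = 0}"

definition inactive :: "(real^'n \<Rightarrow> real^'m) \<Rightarrow> real^'n \<Rightarrow> 'm set" where
  "inactive g zs = - active g zs"

definition active_pos ::
  "(real^'n \<Rightarrow> real) \<Rightarrow> (real^'n \<Rightarrow> real^'m) \<Rightarrow> real^'n \<Rightarrow> 'm set" where
  "active_pos \<phi> g zs = {i \<in> active g zs. \<exists>l \<in> multipliers \<phi> g zs. l $ i > 0}"

text \<open>The norm on pairs is Euclidean.\<close>

definition delta_dist ::
  "(real^'n \<Rightarrow> real) \<Rightarrow> (real^'n \<Rightarrow> real^'m) \<Rightarrow> real^'n \<Rightarrow> real^'n \<Rightarrow> real^'m \<Rightarrow> real" where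
  "delta_dist \<phi> g zs z l = infdist (z, l) ({zs} \<times> multipliers \<phi> g zs)"

definition local_solution ::
  "(real^'n \<Rightarrow> real) \<Rightarrow> (real^'n \<Rightarrow> real^'m) \<Rightarrow> real^'n \<Rightarrow> bool" where
  "local_solution \<phi> g zs \<longleftrightarrow>
     (\<forall>i. g zs $ i \<le> 0) \<and>
     (\<exists>r>0. \<forall>z \<in> ball zs r. (\<forall>i. g z $ i \<le> 0) \<longrightarrow> \<phi> zs \<le> \<phi> z)"

definition mfcq :: "(real^'n \<Rightarrow> real^'m) \<Rightarrow> real^'n \<Rightarrow> bool" where
  "mfcq g zs \<longleftrightarrow> (\<exists>y. \<forall>i \<in> active g zs. grad (\<lambda>x. g x $ i) zs \<bullet> y < 0)"

definition second_order ::
  "(real^'n \<Rightarrow> real) \<Rightarrow> (real^'n \<Rightarrow> real^'m) \<Rightarrow> real^'n \<Rightarrow> bool" where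
  "second_order \<phi> g zs \<longleftrightarrow>
     (\<exists>\<xi>>0. \<forall>l \<in> multipliers \<phi> g zs. \<forall>w.
        (\<forall>i \<in> active_pos \<phi> g zs. grad (\<lambda>x. g x $ i) zs \<bullet> w = 0) \<and>
        (\<forall>i \<in> active g zs - active_pos \<phi> g zs. grad (\<lambda>x. g x $ i) zs \<bullet> w \<le> 0)
        \<longrightarrow> \<xi> * (norm w)\<^sup>2 \<le> w \<bullet> (lagr_zz \<phi> g zs l *v w))"

definition strict_compl ::
  "(real^'n \<Rightarrow> real) \<Rightarrow> (real^'n \<Rightarrow> real^'m) \<Rightarrow> real^'n \<Rightarrow> bool" where
  "strict_compl \<phi> g zs \<longleftrightarrow> (\<exists>l \<in> multipliers \<phi> g zs. \<forall>i \<in> active g zs. 0 < l $ i)"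

definition regular_solution ::
  "(real^'n \<Rightarrow> real) \<Rightarrow> (real^'n \<Rightarrow> real^'m) \<Rightarrow> real^'n \<Rightarrow> bool" where
  "regular_solution \<phi> g zs \<longleftrightarrow>
     twice_lipschitz_diff \<phi> \<and> (\<forall>i. twice_lipschitz_diff (\<lambda>z. g z $ i)) \<and>
     local_solution \<phi> g zs \<and> multipliers \<phi> g zs \<noteq> {} \<and>
     mfcq g zs \<and> second_order \<phi> g zs \<and> strict_compl \<phi> g zs"


section \<open>The primal-dual iterate and the exact step\<close>

definition dual_gap :: "real^'m \<Rightarrow> real^'m \<Rightarrow> real" where
  "dual_gap l s = (l \<bullet> s) / real CARD('m)"

definition good_iterate ::
  "(real^'n \<Rightarrow> real) \<Rightarrow> (real^'n \<Rightarrow> real^'m) \<Rightarrow> real \<Rightarrow> real \<Rightarrow>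
   real^'n \<Rightarrow> real^'m \<Rightarrow> real^'m \<Rightarrow> bool" where
  "good_iterate \<phi> g C \<gamma> z l s \<longleftrightarrow>
     norm (lagr_z \<phi> g z l) \<le> C * dual_gap l s \<and>
     norm (g z + s) \<le> C * dual_gap l s \<and>
     (\<forall>i. 0 < l $ i \<and> 0 < s $ i) \<and>
     (\<forall>i. \<gamma> * dual_gap l s \<le> l $ i * s $ i)"

definition exact_step ::
  "(real^'n \<Rightarrow> real) \<Rightarrow> (real^'n \<Rightarrow> real^'m) \<Rightarrow> real^'n \<Rightarrow> real^'m \<Rightarrow> real^'m \<Rightarrow> real^'m \<Rightarrow>
   real^'n \<Rightarrow> real^'m \<Rightarrow> real^'m \<Rightarrow> bool" where
  "exact_step \<phi> g z l s t dz dl ds \<longleftrightarrow>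
     lagr_zz \<phi> g z l *v dz + nabla g z *v dl = - lagr_z \<phi> g z l \<and>
     transpose (nabla g z) *v dz + ds = - (g z + s) \<and>
     (\<forall>i. s $ i * dl $ i + l $ i * ds $ i = - (s $ i * l $ i + t $ i))"


section \<open>Matrices over index sets: singular value decomposition and smallest eigenvalue\<close>

text \<open>
  The sizes of the factors of the singular value decomposition depend on the number of
  active constraints and on the rank, and may be zero.  Such matrices are functions of a
  row and a column index, of which only the values on explicit index sets matter.
\<close>

definition orthogonal_on :: "'a set \<Rightarrow> 'b set \<Rightarrow> ('a \<Rightarrow> 'b \<Rightarrow> real) \<Rightarrow> bool" where
  "orthogonal_on I J Q \<longleftrightarrow>
     (\<forall>k\<in>J. \<forall>l\<in>J. (\<Sum>i\<in>I. Q i k * Q i l) = (if k = l then 1 else 0)) \<and>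
     (\<forall>i\<in>I. \<forall>j\<in>I. (\<Sum>k\<in>J. Q i k * Q j k) = (if i = j then 1 else 0))"

text \<open>Side-by-side concatenation of a matrix with \<open>r\<close> columns and a second matrix.\<close>

definition hcat :: "nat \<Rightarrow> ('a \<Rightarrow> nat \<Rightarrow> real) \<Rightarrow> ('a \<Rightarrow> nat \<Rightarrow> real) \<Rightarrow> 'a \<Rightarrow> nat \<Rightarrow> real" where
  "hcat r P Q i k = (if k < r then P i k else Q i (k - r))"

text \<open>
  Singular value decomposition of the submatrix of \<open>A\<close> formed by the columns in \<open>B\<close>:
  \<open>Uh\<close> is \<open>n \<times> r\<close>, \<open>Vh\<close> is \<open>n \<times> (n - r)\<close>, \<open>U\<close> is \<open>|B| \<times> r\<close>, \<open>V\<close> is \<open>|B| \<times> (|B| - r)\<close>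
  and \<open>Sg\<close> is \<open>r \<times> r\<close>; the rows of \<open>U\<close> and \<open>V\<close> are indexed by \<open>B\<close> itself.
\<close>

definition svd_on ::
  "'m set \<Rightarrow> real^'m^'n \<Rightarrow> nat \<Rightarrow> ('n \<Rightarrow> nat \<Rightarrow> real) \<Rightarrow> ('n \<Rightarrow> nat \<Rightarrow> real) \<Rightarrow>
   (nat \<Rightarrow> nat \<Rightarrow> real) \<Rightarrow> ('m \<Rightarrow> nat \<Rightarrow> real) \<Rightarrow> ('m \<Rightarrow> nat \<Rightarrow> real) \<Rightarrow> bool" where
  "svd_on B A r Uh Vh Sg U V \<longleftrightarrow>
     r \<le> CARD('n) \<and> r \<le> card B \<and>
     orthogonal_on UNIV {..<CARD('n)} (hcat r Uh Vh) \<and>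
     orthogonal_on B {..<card B} (hcat r U V) \<and>
     (\<forall>k<r. 0 < Sg k k) \<and> (\<forall>k<r. \<forall>l<r. k \<noteq> l \<longrightarrow> Sg k l = 0) \<and>
     (\<forall>j. \<forall>i\<in>B. A $ j $ i = (\<Sum>k<r. \<Sum>l<r. Uh j k * Sg k l * U i l))"

definition eigenvalue_on :: "'a set \<Rightarrow> ('a \<Rightarrow> 'a \<Rightarrow> real) \<Rightarrow> real \<Rightarrow> bool" where
  "eigenvalue_on I A \<kappa> \<longleftrightarrow>
     (\<exists>x. (\<exists>i\<in>I. x i \<noteq> 0) \<and> (\<forall>i\<in>I. (\<Sum>j\<in>I. A i j * x j) = \<kappa> * x i))"

text \<open>Smallest eigenvalue of a symmetric matrix; infinite for the \<open>0 \<times> 0\<close> matrix.\<close>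

definition sigma_min :: "'a set \<Rightarrow> ('a \<Rightarrow> 'a \<Rightarrow> real) \<Rightarrow> ereal" where
  "sigma_min I A = (INF \<kappa> \<in> {\<kappa>. eigenvalue_on I A \<kappa>}. ereal \<kappa>)"

text \<open>\<open>Vh\<^sup>T H Vh\<close>\<close>

definition congr_mat :: "('n \<Rightarrow> nat \<Rightarrow> real) \<Rightarrow> real^'n^'n \<Rightarrow> nat \<Rightarrow> nat \<Rightarrow> real" where
  "congr_mat Vh H k l = (\<Sum>i\<in>UNIV. \<Sum>j\<in>UNIV. Vh i k * H $ i $ j * Vh j l)"

text \<open>\<open>P\<^sup>T x\<^sub>B\<close>, for a matrix \<open>P\<close> whose rows are indexed by \<open>B\<close>\<close>

definition tmult_on :: "'m set \<Rightarrow> ('m \<Rightarrow> nat \<Rightarrow> real) \<Rightarrow> real^'m \<Rightarrow> nat \<Rightarrow> real" where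
  "tmult_on B P x k = (\<Sum>i\<in>B. P i k * x $ i)"


section \<open>Floating-point arithmetic\<close>

datatype fp_op = Plus | Minus | Times | Divide

fun exact_op :: "fp_op \<Rightarrow> real \<Rightarrow> real \<Rightarrow> real" where
  "exact_op Plus x y = x + y"
| "exact_op Minus x y = x - y"
| "exact_op Times x y = x * y"
| "exact_op Divide x y = x / y"

text \<open>
  \<open>F\<close> is the set of floating-point numbers, \<open>u\<close> the unit roundoff.  Changing a sign is
  exact; overflow and underflow are not modelled.
\<close>

definition fp_arith ::
  "real \<Rightarrow> real set \<Rightarrow> (fp_op \<Rightarrow> real \<Rightarrow> real \<Rightarrow> real) \<Rightarrow> bool" where
  "fp_arith u F fl \<longleftrightarrow>
     0 \<le> u \<and> (\<forall>x\<in>F. - x \<in> F) \<and>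
     (\<forall>op. \<forall>x\<in>F. \<forall>y\<in>F. (op = Divide \<longrightarrow> y \<noteq> 0) \<longrightarrow>
        fl op x y \<in> F \<and> (\<exists>e. \<bar>e\<bar> \<le> u \<and> fl op x y = exact_op op x y * (1 + e)))"

definition fp_vec :: "real set \<Rightarrow> real^'k \<Rightarrow> bool" where
  "fp_vec F x \<longleftrightarrow> (\<forall>i. x $ i \<in> F)"

definition fp_mat :: "real set \<Rightarrow> real^'k^'j \<Rightarrow> bool" where
  "fp_mat F A \<longleftrightarrow> (\<forall>i j. A $ i $ j \<in> F)"

text \<open>\<open>fl_sum fl X w\<close>: \<open>w\<close> results from adding the terms \<open>X\<close> in some order and bracketing.\<close>

inductive fl_sum :: "(fp_op \<Rightarrow> real \<Rightarrow> real \<Rightarrow> real) \<Rightarrow> real multiset \<Rightarrow> real \<Rightarrow> bool"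
  for fl where
  single: "fl_sum fl {#x#} x"
| plus: "fl_sum fl X a \<Longrightarrow> fl_sum fl Y b \<Longrightarrow> fl_sum fl (X + Y) (fl Plus a b)"

definition fl_inner ::
  "(fp_op \<Rightarrow> real \<Rightarrow> real \<Rightarrow> real) \<Rightarrow> real^'k \<Rightarrow> real^'k \<Rightarrow> real \<Rightarrow> bool" where
  "fl_inner fl x y w \<longleftrightarrow>
     fl_sum fl (image_mset (\<lambda>j. fl Times (x $ j) (y $ j)) (mset_set UNIV)) w"


section \<open>The computed step\<close>

text \<open>
  The augmented matrix is indexed by \<open>'n + 'm\<close>, so its active and inactive blocks are the
  index sets \<open>Inr ` B\<close> and \<open>Inr ` N\<close>.
\<close>

definition vcat :: "real^'n \<Rightarrow> real^'m \<Rightarrow> real^('n + 'm)" where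
  "vcat x y = (\<chi> p. case p of Inl i \<Rightarrow> x $ i | Inr k \<Rightarrow> y $ k)"

definition aug_mat :: "real^'n^'n \<Rightarrow> real^'m^'n \<Rightarrow> real^'m \<Rightarrow> real^('n + 'm)^('n + 'm)" where
  "aug_mat H A d = (\<chi> p q.
     (case p of
        Inl i \<Rightarrow> (case q of Inl j \<Rightarrow> H $ i $ j | Inr k \<Rightarrow> A $ i $ k)
      | Inr k \<Rightarrow> (case q of Inl j \<Rightarrow> A $ j $ k | Inr k' \<Rightarrow> if k = k' then - d $ k else 0)))"

text \<open>Frobenius norm of a block\<close>

definition block_norm :: "real^'k^'j \<Rightarrow> 'j set \<Rightarrow> 'k set \<Rightarrow> real" where
  "block_norm E I J = L2_set (\<lambda>(p, q). E $ p $ q) (I \<times> J)"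

definition condition_P ::
  "real \<Rightarrow> real \<Rightarrow> real \<Rightarrow> 'm set \<Rightarrow> 'm set \<Rightarrow> real^('n::finite + 'm::finite)^('n + 'm) \<Rightarrow> real^('n + 'm) \<Rightarrow>
   real^('n + 'm) \<Rightarrow> bool" where
  "condition_P K u \<mu> B N M b x \<longleftrightarrow>
     (\<exists>E. (M + E) *v x = b \<and>
        (let I1 = range Inl; I2 = Inr ` B; I3 = Inr ` N in
         block_norm E I1 I1 \<le> K * (u / \<mu>) \<and>
         block_norm E I3 I3 \<le> K * (u / \<mu>\<^sup>2) \<and>
         block_norm E I1 I2 \<le> K * u \<and> block_norm E I2 I1 \<le> K * u \<and> block_norm E I2 I2 \<le> K * u \<and>
         block_norm E I1 I3 \<le> K * (u / \<mu>) \<and> block_norm E I3 I1 \<le> K * (u / \<mu>) \<and>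
         block_norm E I2 I3 \<le> K * (u / \<mu>) \<and> block_norm E I3 I2 \<le> K * (u / \<mu>)))"

text \<open>
  \<open>H\<close>, \<open>Lz\<close>, \<open>A\<close>, \<open>gh\<close> are the computed Hessian and gradient of the Lagrangian, constraint
  gradients and constraint values; \<open>d\<close> is the diagonal of the computed \<open>\<Lambda>\<^sup>-\<^sup>1 S\<close>.
  The single constant \<open>K\<close> bounds all implied constants.
\<close>

definition computed_step ::
  "(real^'n \<Rightarrow> real) \<Rightarrow> (real^'n \<Rightarrow> real^'m) \<Rightarrow> real^'n \<Rightarrow> real \<Rightarrow>
   real \<Rightarrow> real set \<Rightarrow> (fp_op \<Rightarrow> real \<Rightarrow> real \<Rightarrow> real) \<Rightarrow>
   real^'n \<Rightarrow> real^'m \<Rightarrow> real^'m \<Rightarrow> real^'m \<Rightarrow> real^'n \<Rightarrow> real^'m \<Rightarrow> real^'m \<Rightarrow> bool" where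
  "computed_step \<phi> g zs K u F fl z l s t dz dl ds \<longleftrightarrow>
     fp_vec F z \<and> fp_vec F l \<and> fp_vec F s \<and> fp_vec F t \<and>
     fp_vec F dz \<and> fp_vec F dl \<and> fp_vec F ds \<and>
     (\<exists>H Lz A gh d.
        fp_mat F H \<and> norm (H - lagr_zz \<phi> g z l) \<le> K * u \<and>
        fp_vec F Lz \<and> norm (Lz - lagr_z \<phi> g z l) \<le> K * u \<and>
        fp_mat F A \<and> norm (A - nabla g z) \<le> K * u \<and>
        fp_vec F gh \<and> norm (gh - g z) \<le> K * u \<and>
        fp_vec F d \<and>
        L2_set (\<lambda>i. d $ i - s $ i / l $ i) (active g zs) \<le> K * (dual_gap l s * u) \<and>
        L2_set (\<lambda>i. d $ i - s $ i / l $ i) (inactive g zs) \<le> K * (u / dual_gap l s) \<and>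
        condition_P K u (dual_gap l s) (active g zs) (inactive g zs)
          (aug_mat H A d)
          (vcat (- Lz) (\<chi> i. fl Plus (- gh $ i) (fl Divide (t $ i) (l $ i))))
          (vcat dz dl) \<and>
        (\<forall>i. \<exists>w. fl_inner fl (column i A) dz w \<and>
           ds $ i = fl Minus (- fl Plus (gh $ i) (s $ i)) w))"

end

theory Submission
  imports Defs
begin

text \<open>
  Strict complementarity and the second-order condition make the Hessian of the Lagrangian
  coercive on the null space of the active constraint gradients at the solution, uniformly over
  the multipliers.  Hence the iterate lies within \<open>O(\<mu>)\<close> of the solution, the active
  entries of \<open>\<Lambda>\<^sup>-\<^sup>1 S\<close> are of exact order \<open>\<mu>\<close> and the inactive ones of order at least
  \<open>1 / \<mu>\<close>.  An energy estimate for the augmented system, followed by a projection onto that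
  null space, then bounds a solution \<open>(x, y)\<close> in the weighted norm
  \<open>\<parallel>x\<parallel> + \<mu> \<parallel>y\<^sub>B\<parallel> + \<parallel>y\<^sub>N\<parallel>\<close>, together with the range component of \<open>y\<^sub>B\<close>, by
  \<open>\<parallel>f\<parallel> + \<parallel>h\<^sub>B\<parallel> + \<mu> \<parallel>h\<^sub>N\<parallel>\<close> for the right-hand side \<open>(f, h)\<close>.  In this norm the exact step
  has size \<open>O(\<mu>)\<close>.  The computed step solves the exact system up to a residual of size
  \<open>u + (u / \<mu>)\<close> times its own weighted norm, and since \<open>u / \<mu>\<close> is small the part of this
  coming from the error itself can be absorbed.
\<close>

section \<open>The augmented system\<close>

text \<open>The weight \<open>\<mu>\<close> on the active duals is forced. Along the kernel of the
  active gradients only the diagonal block, of order \<open>\<mu>\<close>, determines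
  \<open>y\<^sub>B\<close>, so data of size \<open>Q\<close> fix that part only up to
  \<open>Q / \<mu>\<close>. The stationarity row fixes the image of \<open>y\<^sub>B\<close> under
  the active gradients, hence its range component, without this loss. This is the source of
  \<open>u / \<mu>\<close> for the \<open>V\<close> component and of \<open>u\<close> for the
  \<open>U\<close> component. The obstacle is the primal part: pairing the system with its own
  solution balances \<open>Q * Y\<close> against \<open>\<mu> * Y\<^sup>2\<close>, which alone gives
  only \<open>Q / sqrt \<mu>\<close> for \<open>x\<close>. Projecting the stationarity row removes
  \<open>y\<^sub>B\<close> up to a term of order \<open>\<mu> * Y\<close> and restores the order
  \<open>Q\<close>. The inactive data carry the weight \<open>\<mu>\<close> because the inactive
  duals are obtained by dividing by entries of order at least \<open>1 / \<mu>\<close>. So inactive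
  right-hand sides that are merely bounded still allow an exact step of size O(\<mu>), and in the
  error estimate the exact step contributes \<open>u / \<mu>\<close> times O(\<mu>), that is
  O(u).\<close>

declare transpose_matrix_vector [simp del]

section \<open>Norms of matrix-vector products, subvectors and column submatrices\<close>

lemma norm_matrix_vector_le:
  fixes A :: "real^'k^'j"
  shows "norm (A *v x) \<le> norm A * norm x"
proof -
  have "norm (A *v x) = L2_set (\<lambda>i. \<bar>A $ i \<bullet> x\<bar>) UNIV"
    by (simp add: norm_vec_def matrix_vector_mul_component)
  also have "\<dots> \<le> L2_set (\<lambda>i. norm (A $ i) * norm x) UNIV"
    by (intro L2_set_mono) (auto simp: Cauchy_Schwarz_ineq2)
  also have "\<dots> = norm A * norm x"
    by (simp add: L2_set_left_distrib[symmetric] norm_vec_def[of A])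
  finally show ?thesis .
qed

lemma inner_transpose_vector:
  fixes A :: "real^'k^'j"
  shows "(transpose A *v x) \<bullet> y = x \<bullet> (A *v y)"
  by (metis dot_lmul_matrix transpose_matrix_vector)

lemma norm_transpose_vector_le:
  fixes A :: "real^'k^'j"
  shows "norm (transpose A *v x) \<le> norm A * norm x"
proof -
  let ?y = "transpose A *v x"
  have "norm ?y * norm ?y = x \<bullet> (A *v ?y)"
    by (metis inner_transpose_vector power2_eq_square power2_norm_eq_inner)
  also have "\<dots> \<le> norm x * (norm A * norm ?y)"
    by (meson mult_left_mono norm_cauchy_schwarz norm_ge_zero norm_matrix_vector_le order_trans)
  finally have "norm ?y * norm ?y \<le> (norm A * norm x) * norm ?y"
    by (simp add: mult_ac)
  then show ?thesis
    by (cases "norm ?y = 0") (auto simp: mult_le_cancel_right)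
qed

text \<open>Subvectors are padded with zeros, so that active and inactive parts live in the space of
  the whole vector and can be added; the Euclidean norm is still that of the subvector. Column
  submatrices are encoded in the same way by \<open>cols\<close>.\<close>

definition restr :: "'m set \<Rightarrow> real^'m \<Rightarrow> real^'m" where
  "restr I y = (\<chi> i. if i \<in> I then y $ i else 0)"

lemma restr_nth [simp]: "restr I y $ i = (if i \<in> I then y $ i else 0)"
  by (simp add: restr_def)

lemma restr_idem [simp]: "restr I (restr I y) = restr I y"
  by (simp add: vec_eq_iff)

lemma restr_UNIV [simp]: "restr UNIV y = y"
  by (simp add: vec_eq_iff)

lemma restr_diff: "restr I (x - y) = restr I x - restr I y"
  and restr_split: "restr I y + restr (- I) y = y"
  by (auto simp: vec_eq_iff)

lemma norm_restr_L2: "norm (restr I (y::real^'m)) = L2_set (\<lambda>i. y $ i) I"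
proof -
  have "(\<Sum>i\<in>UNIV. (if i \<in> I then y $ i else 0)\<^sup>2) = (\<Sum>i\<in>I. (y $ i)\<^sup>2)"
    by (subst sum.mono_neutral_cong_right[of UNIV I]) auto
  then show ?thesis
    by (simp add: norm_vec_def L2_set_def)
qed

lemma abs_nth_le_restr: "i \<in> I \<Longrightarrow> \<bar>y $ i\<bar> \<le> norm (restr I (y::real^'m))"
  using component_le_norm_cart[of "restr I y" i] by simp

lemma norm_restr_mono:
  fixes y w :: "real^'m"
  assumes "0 \<le> k" "\<And>i. i \<in> I \<Longrightarrow> \<bar>y $ i\<bar> \<le> k * \<bar>w $ i\<bar>"
  shows "norm (restr I y) \<le> k * norm (restr I w)"
proof -
  have "norm (restr I y) = L2_set (\<lambda>i. \<bar>y $ i\<bar>) I"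
    by (simp add: norm_restr_L2 L2_set_def)
  also have "\<dots> \<le> L2_set (\<lambda>i. k * \<bar>w $ i\<bar>) I"
    using assms by (intro L2_set_mono) auto
  also have "\<dots> = k * norm (restr I w)"
    using assms(1) by (simp add: L2_set_right_distrib[symmetric] norm_restr_L2)
      (simp add: L2_set_def)
  finally show ?thesis .
qed

lemma norm_restr_le: "norm (restr I y) \<le> norm (y::real^'m)"
proof -
  have "restr UNIV y = y" "restr UNIV (restr I y) = restr I y" by (simp_all add: vec_eq_iff)
  then show ?thesis using norm_restr_mono[of 1 UNIV "restr I y" y] by simp
qed

lemma norm_restr_bound:
  fixes y :: "real^'m"
  assumes "0 \<le> k" "\<And>i. i \<in> I \<Longrightarrow> \<bar>y $ i\<bar> \<le> k"
  shows "norm (restr I y) \<le> real CARD('m) * k"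
proof -
  have "norm (restr I y) \<le> (\<Sum>i\<in>UNIV. \<bar>restr I y $ i\<bar>)"
    by (rule norm_le_l1_cart)
  also have "\<dots> \<le> (\<Sum>i\<in>(UNIV::'m set). k)"
    using assms by (intro sum_mono) auto
  finally show ?thesis by simp
qed

definition cols :: "'m set \<Rightarrow> real^'m^'n \<Rightarrow> real^'m^'n" where
  "cols I A = (\<chi> j. restr I (A $ j))"

lemma cols_mult: "cols I A *v y = A *v restr I y"
  by (auto simp: vec_eq_iff matrix_vector_mult_def cols_def intro!: sum.cong)

lemma cols_restr: "cols I A *v restr I y = cols I A *v y"
  by (auto simp: vec_eq_iff matrix_vector_mult_def cols_def intro!: sum.cong)

lemma transpose_cols_mult: "transpose (cols I A) *v x = restr I (transpose A *v x)"
  by (auto simp: vec_eq_iff matrix_vector_mult_def cols_def transpose_def)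

text \<open>\<open>X\<close>, \<open>Y\<close> and \<open>Q\<close> stand for the norms of the
  primal part, of the active dual part and of the data. Young's inequality absorbs the mixed terms
  of the energy inequality and bounds \<open>\<mu> * Y\<close> by a multiple of \<open>Q\<close>; by
  itself it would leave \<open>X\<close> of order \<open>Q / sqrt \<mu>\<close>. The second
  inequality, which will come from the projection, then bounds \<open>X\<close>.\<close>

lemma weighted_energy_bound:
  fixes \<xi> c M :: real
  assumes "0 < \<xi>" "0 < c" "1 \<le> M"
  shows "\<exists>K>0. \<exists>\<epsilon>>0. \<forall>\<mu> X Y Q. 0 < \<mu> \<longrightarrow> \<mu> \<le> \<epsilon> \<longrightarrow> 0 \<le> X \<longrightarrow> 0 \<le> Y \<longrightarrow> 0 \<le> Q \<longrightarrow>
     \<xi> * X\<^sup>2 + c * \<mu> * Y\<^sup>2 \<le> M * (Q * X + Q * Y + \<mu> * X * Y + \<mu> * X\<^sup>2) \<longrightarrow>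
     X \<le> M * (Q + \<mu> * Y + \<mu> * X) \<longrightarrow> X \<le> K * Q \<and> \<mu> * Y \<le> K * Q"
proof -
  \<comment> \<open>The last three entries absorb, in turn, the terms
    \<open>\<mu> * X\<^sup>2\<close> and \<open>\<mu> * X * Y\<close> of the energy inequality and
    the term \<open>\<mu> * X\<close> of the second inequality.\<close>
  define \<epsilon> where "\<epsilon> = Min {1, \<xi> / (4 * M), c * \<xi> / (4 * M\<^sup>2), 1 / (2 * M)}"
  define K1 where "K1 = 1 + 2 * M\<^sup>2 / (c * \<xi>) + 2 * M\<^sup>2 / c\<^sup>2"
  define K where "K = K1 + 2 * M * (1 + K1)"
  have M0: "0 < M" using assms by simp
  have eps: "\<epsilon> > 0" using assms by (simp add: \<epsilon>_def)
  have K1: "1 \<le> K1" using assms by (simp add: K1_def)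
  have K: "K > 0" "K1 \<le> K" "2 * M * (1 + K1) \<le> K" using K1 M0 by (auto simp: K_def add_pos_pos)
  have "X \<le> K * Q \<and> \<mu> * Y \<le> K * Q"
    if mu: "0 < \<mu>" "\<mu> \<le> \<epsilon>" and nn: "0 \<le> X" "0 \<le> Y" "0 \<le> Q"
      and h1: "\<xi> * X\<^sup>2 + c * \<mu> * Y\<^sup>2 \<le> M * (Q * X + Q * Y + \<mu> * X * Y + \<mu> * X\<^sup>2)"
      and h2: "X \<le> M * (Q + \<mu> * Y + \<mu> * X)" for \<mu> X Y Q
  proof -
    have m: "\<mu> \<le> 1" "M * \<mu> \<le> \<xi> / 4" "M\<^sup>2 * \<mu> \<le> \<xi> * (c / 4)" "M * \<mu> \<le> 1 / 2"
      using mu(2) M0 by (auto simp: \<epsilon>_def field_simps)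
    have a1: "M * (Q * X) \<le> \<xi> / 4 * X\<^sup>2 + M\<^sup>2 * Q\<^sup>2 / \<xi>"
    proof -
      have "0 \<le> (\<xi> / 2 * X - M * Q)\<^sup>2" by simp
      then have "\<xi> * (M * (Q * X)) \<le> \<xi> * (\<xi> / 4 * X\<^sup>2 + M\<^sup>2 * Q\<^sup>2 / \<xi>)"
        using assms by (simp add: power2_eq_square algebra_simps)
      then show ?thesis using assms by simp
    qed
    have a2: "M * (Q * Y) \<le> c / 4 * \<mu> * Y\<^sup>2 + M\<^sup>2 * Q\<^sup>2 / (c * \<mu>)"
    proof -
      have "0 \<le> (c * \<mu> / 2 * Y - M * Q)\<^sup>2" by simp
      then have "(c * \<mu>) * (M * (Q * Y)) \<le> (c * \<mu>) * (c / 4 * \<mu> * Y\<^sup>2 + M\<^sup>2 * Q\<^sup>2 / (c * \<mu>))"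
        using assms mu by (simp add: power2_eq_square algebra_simps)
      then show ?thesis using assms mu by (simp add: mult_le_cancel_left)
    qed
    have a3: "M * (\<mu> * X * Y) \<le> \<xi> / 4 * X\<^sup>2 + c / 4 * \<mu> * Y\<^sup>2"
    proof -
      have "0 \<le> (\<xi> / 2 * X - M * \<mu> * Y)\<^sup>2" by simp
      then have "\<xi> * (M * (\<mu> * X * Y)) \<le> \<xi> * (\<xi> / 4 * X\<^sup>2) + (M\<^sup>2 * \<mu>) * (\<mu> * Y\<^sup>2)"
        by (simp add: power2_eq_square algebra_simps)
      also have "(M\<^sup>2 * \<mu>) * (\<mu> * Y\<^sup>2) \<le> (\<xi> * (c / 4)) * (\<mu> * Y\<^sup>2)"
        using m mu by (intro mult_right_mono) auto
      finally have "\<xi> * (M * (\<mu> * X * Y)) \<le> \<xi> * (\<xi> / 4 * X\<^sup>2 + c / 4 * \<mu> * Y\<^sup>2)"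
        by (simp add: algebra_simps)
      then show ?thesis using assms by simp
    qed
    have a4: "M * (\<mu> * X\<^sup>2) \<le> \<xi> / 4 * X\<^sup>2"
      using mult_right_mono[OF m(2), of "X\<^sup>2"] by (simp add: mult_ac)
    \<comment> \<open>Three quarters of \<open>\<xi> * X\<^sup>2\<close> and one half of
      \<open>c * \<mu> * Y\<^sup>2\<close> have been spent on absorption.\<close>
    have "c / 2 * \<mu> * Y\<^sup>2 + \<xi> / 4 * X\<^sup>2 \<le> M\<^sup>2 * Q\<^sup>2 / \<xi> + M\<^sup>2 * Q\<^sup>2 / (c * \<mu>)"
      using h1 a1 a2 a3 a4 by (simp add: algebra_simps)
    moreover have "0 \<le> \<xi> / 4 * X\<^sup>2" using assms by simp
    ultimately have "c / 2 * \<mu> * Y\<^sup>2 \<le> M\<^sup>2 * Q\<^sup>2 / \<xi> + M\<^sup>2 * Q\<^sup>2 / (c * \<mu>)" by linarith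
    \<comment> \<open>The factor turns the left side into \<open>(\<mu> * Y)\<^sup>2\<close> and
      cancels the singular \<open>1 / \<mu>\<close> on the right.\<close>
    then have "(2 * \<mu> / c) * (c / 2 * \<mu> * Y\<^sup>2) \<le> (2 * \<mu> / c) * (M\<^sup>2 * Q\<^sup>2 / \<xi> + M\<^sup>2 * Q\<^sup>2 / (c * \<mu>))"
      using assms mu by (intro mult_left_mono) auto
    also have "\<dots> = (2 * M\<^sup>2 / (c * \<xi>) * Q\<^sup>2) * \<mu> + 2 * M\<^sup>2 / c\<^sup>2 * Q\<^sup>2"
      using assms mu by (simp add: field_simps power2_eq_square)
    also have "\<dots> \<le> (2 * M\<^sup>2 / (c * \<xi>) * Q\<^sup>2) * 1 + 2 * M\<^sup>2 / c\<^sup>2 * Q\<^sup>2"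
      using assms m mu by (intro add_mono mult_left_mono) auto
    also have "\<dots> \<le> K1 * Q\<^sup>2" by (simp add: K1_def algebra_simps)
    also have "\<dots> \<le> K1\<^sup>2 * Q\<^sup>2" using K1 by (intro mult_right_mono) (auto simp: power2_eq_square)
    finally have "(\<mu> * Y)\<^sup>2 \<le> (K1 * Q)\<^sup>2"
      using assms by (simp add: power2_eq_square mult_ac)
    then have Y: "\<mu> * Y \<le> K1 * Q"
      using K1 nn by (auto intro: power2_le_imp_le)
    have "X \<le> M * (Q + K1 * Q) + (M * \<mu>) * X"
    proof -
      have "M * (Q + \<mu> * Y + \<mu> * X) \<le> M * (Q + K1 * Q + \<mu> * X)"
        using Y M0 by (intro mult_left_mono) auto
      then show ?thesis using h2 by (simp add: algebra_simps)
    qed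
    also have "\<dots> \<le> M * (Q + K1 * Q) + 1 / 2 * X"
      using m nn by (intro add_mono mult_right_mono order_refl) auto
    finally have "X \<le> 2 * M * (1 + K1) * Q" by (simp add: algebra_simps)
    also have "\<dots> \<le> K * Q" using K nn by (intro mult_right_mono) auto
    finally have "X \<le> K * Q" .
    moreover have "\<mu> * Y \<le> K * Q"
      using Y mult_right_mono[OF K(2) nn(3)] by linarith
    ultimately show ?thesis by blast
  qed
  then show ?thesis using eps K by blast
qed

text \<open>The transpose is injective on the range of \<open>A\<close>, since a vanishing
  \<open>transpose A *v (A *v y)\<close> forces \<open>norm (A *v y)\<close> to vanish; in finite
  dimension injectivity gives a lower bound. The constant depends on \<open>A\<close> alone and
  plays the part of the smallest positive singular value.\<close>

lemma transpose_bounded_below_on_range: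
  fixes A :: "real^'m^'n"
  shows "\<exists>c>0. \<forall>y. c * norm (A *v y) \<le> norm (transpose A *v (A *v y))"
proof -
  have "\<exists>e>0. \<forall>x\<in>range ((*v) A). e * norm x \<le> norm (transpose A *v x)"
  proof (rule injective_imp_isometric)
    have "subspace (range ((*v) A))"
      by (intro linear_subspace_image) auto
    then show "closed (range ((*v) A))" "subspace (range ((*v) A))"
      by (auto intro: closed_subspace)
    show "bounded_linear ((*v) (transpose A))" by simp
    show "\<forall>x\<in>range ((*v) A). transpose A *v x = 0 \<longrightarrow> x = 0"
      by clarify (metis inner_eq_zero_iff inner_transpose_vector inner_zero_left)
  qed
  then show ?thesis by (auto simp: mult_ac)
qed

text \<open>The range is the orthogonal complement of the kernel of the transpose. The range part is
  given in the form \<open>A *v y\<close>, to which \<open>transpose_bounded_below_on_range\<close>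
  applies.\<close>

lemma range_kernel_decomposition:
  fixes A :: "real^'m^'n"
  obtains y w where "x = A *v y + w" "transpose A *v w = 0" "(A *v y) \<bullet> w = 0"
proof -
  have sub: "subspace (range ((*v) A))"
    by (intro linear_subspace_image) auto
  obtain r w where r: "r \<in> span (range ((*v) A))" "\<And>q. q \<in> span (range ((*v) A)) \<Longrightarrow> orthogonal w q"
    and x: "x = r + w"
    using orthogonal_subspace_decomp_exists[of "range ((*v) A)" x] by metis
  have sp: "span (range ((*v) A)) = range ((*v) A)"
    using sub by (rule span_eq_iff[THEN iffD2])
  obtain y where y: "r = A *v y" using r(1) unfolding sp by blast
  have ort: "(A *v q) \<bullet> w = 0" for q
    using r(2)[of "A *v q"] unfolding sp by (simp add: orthogonal_def inner_commute)
  have "transpose A *v w = 0"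
    by (metis inner_commute inner_eq_zero_iff inner_transpose_vector ort)
  then show ?thesis using that x y ort by blast
qed

text \<open>\<open>A\<^sub>1\<close> will be the gradient matrix at the solution and
  \<open>A\<close> the one at the iterate. Coercivity is asked for on the null space of the active
  columns of \<open>A\<^sub>1\<close>, a fixed subspace, so that the constants do not vary with the
  iterate; the drift of order \<open>\<mu>\<close> from \<open>A\<^sub>1\<close> to \<open>A\<close>
  is treated as a perturbation.\<close>

definition block_coercive ::
  "real \<Rightarrow> real \<Rightarrow> real \<Rightarrow> 'm set \<Rightarrow> real^'m^'n \<Rightarrow> real \<Rightarrow> real^'n^'n \<Rightarrow> real^'m^'n \<Rightarrow> real^'m \<Rightarrow> bool" where
  "block_coercive \<xi> c M B A\<^sub>1 \<mu> H A d \<longleftrightarrow>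
     norm H \<le> M \<and> norm A \<le> M \<and> norm (A - A\<^sub>1) \<le> M * \<mu> \<and>
     (\<forall>w. transpose (cols B A\<^sub>1) *v w = 0 \<longrightarrow> \<xi> * (norm w)\<^sup>2 \<le> w \<bullet> (H *v w)) \<and>
     (\<forall>i\<in>B. c * \<mu> \<le> d $ i \<and> d $ i \<le> M * \<mu>) \<and> (\<forall>i\<in>-B. c / \<mu> \<le> d $ i)"

text \<open>The inactive duals are eliminated through their large diagonal entries. Pairing what
  remains with \<open>x\<close> and inserting the active rows leaves the quadratic form of
  \<open>H\<close> plus the sum of \<open>d $ i * (y $ i)\<^sup>2\<close> over \<open>B\<close>. The
  quadratic form can fail to be coercive only through the range component of \<open>x\<close>, and
  the active rows control that component.\<close>

lemma block_solution_bound: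
  fixes A\<^sub>1 :: "real^'m^'n" and B :: "'m set"
  assumes \<xi>: "0 < \<xi>" and c: "0 < c" and M: "1 \<le> M"
  shows "\<exists>K>0. \<exists>\<epsilon>>0. \<forall>\<mu> H A d x y f h.
    0 < \<mu> \<longrightarrow> \<mu> \<le> \<epsilon> \<longrightarrow> block_coercive \<xi> c M B A\<^sub>1 \<mu> H A d \<longrightarrow>
    H *v x + A *v y = f \<longrightarrow> (\<forall>i. (transpose A *v x) $ i - d $ i * y $ i = h $ i) \<longrightarrow>
    norm x + \<mu> * norm (restr B y) + norm (restr (-B) y) + norm (cols B A\<^sub>1 *v y)
      \<le> K * (norm f + norm (restr B h) + \<mu> * norm (restr (-B) h))"
proof -
  define A\<^sub>0 where "A\<^sub>0 = cols B A\<^sub>1"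
  obtain c0 where c0: "c0 > 0" "\<And>y. c0 * norm (A\<^sub>0 *v y) \<le> norm (transpose A\<^sub>0 *v (A\<^sub>0 *v y))"
    using transpose_bounded_below_on_range[of A\<^sub>0] by blast
  define k1 where "k1 = M / c + 1 / c"
  define k2 where "k2 = 1 + M * k1"
  define k3 where "k3 = M / c0"
  define k4 where "k4 = (3 * M + \<xi>) * k3"
  define k5 where "k5 = k2 + k4 + 1"
  define k6 where "k6 = (k2 + M + M * k3) / \<xi> + k3"
  have M0: "0 < M" using M by simp
  have pos: "0 < k1" "0 < k2" "0 < k3" "0 < k4" "0 < k5" "0 < k6"
    using \<xi> c c0 M0 by (simp_all add: k1_def k2_def k3_def k4_def k5_def k6_def add_pos_pos)
  have k5: "1 \<le> k5" using pos by (simp add: k5_def)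
  obtain K \<epsilon> where K: "K > 0" and \<epsilon>: "\<epsilon> > 0" and core:
    "\<And>\<mu> X Y Q. 0 < \<mu> \<Longrightarrow> \<mu> \<le> \<epsilon> \<Longrightarrow> 0 \<le> X \<Longrightarrow> 0 \<le> Y \<Longrightarrow> 0 \<le> Q \<Longrightarrow>
     \<xi> * X\<^sup>2 + c * \<mu> * Y\<^sup>2 \<le> (k5 + k6) * (Q * X + Q * Y + \<mu> * X * Y + \<mu> * X\<^sup>2) \<Longrightarrow>
     X \<le> (k5 + k6) * (Q + \<mu> * Y + \<mu> * X) \<Longrightarrow> X \<le> K * Q \<and> \<mu> * Y \<le> K * Q"
    using weighted_energy_bound[OF \<xi> c, of "k5 + k6"] k5 pos by (auto simp: add_increasing2)
  define K' where "K' = K + K + k1 * (K + 1) + (k2 * (K + 1) + 2 * M * K)"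
  have K': "0 < K'" using K pos M0 by (simp add: K'_def add_pos_pos)
  have main: "norm x + \<mu> * norm (restr B y) + norm (restr (-B) y) + norm (A\<^sub>0 *v y)
      \<le> K' * (norm f + norm (restr B h) + \<mu> * norm (restr (-B) h))"
    if mu: "0 < \<mu>" "\<mu> \<le> min \<epsilon> 1" and bc: "block_coercive \<xi> c M B A\<^sub>1 \<mu> H A d"
      and eq1: "H *v x + A *v y = f" and eq2: "\<And>i. (transpose A *v x) $ i - d $ i * y $ i = h $ i"
    for \<mu> H A d x y f h
  proof -
    define yB yN where "yB = restr B y" and "yN = restr (-B) y"
    define X Y Z where "X = norm x" and "Y = norm yB" and "Z = norm yN"
    define Q where "Q = norm f + norm (restr B h) + \<mu> * norm (restr (-B) h)"
    have nn: "0 \<le> X" "0 \<le> Y" "0 \<le> Z" "0 \<le> Q" using mu by (simp_all add: X_def Y_def Z_def Q_def)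
    have H: "norm H \<le> M" and A: "norm A \<le> M" and A1: "norm (A - A\<^sub>1) \<le> M * \<mu>"
      and coer: "\<And>w. transpose A\<^sub>0 *v w = 0 \<Longrightarrow> \<xi> * (norm w)\<^sup>2 \<le> w \<bullet> (H *v w)"
      and dB: "\<And>i. i \<in> B \<Longrightarrow> c * \<mu> \<le> d $ i \<and> d $ i \<le> M * \<mu>" and dN: "\<And>i. i \<notin> B \<Longrightarrow> c / \<mu> \<le> d $ i"
      using bc by (auto simp: block_coercive_def A\<^sub>0_def)
    have Hv: "norm (H *v v) \<le> M * norm v" for v
      using norm_matrix_vector_le[of H v] mult_right_mono[OF H, of "norm v"] by simp
    have Av: "norm (A *v v) \<le> M * norm v" for v
      using norm_matrix_vector_le[of A v] mult_right_mono[OF A, of "norm v"] by simp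
    have ATv: "norm (transpose A *v v) \<le> M * norm v" for v
      using norm_transpose_vector_le[of A v] mult_right_mono[OF A, of "norm v"] by simp
    have fQ: "norm f \<le> Q" "norm (restr B h) \<le> Q" "\<mu> * norm (restr (-B) h) \<le> Q"
      using mu by (simp_all add: Q_def)
    \<comment> \<open>Off \<open>B\<close> the entry \<open>d $ i\<close> is at least
      \<open>c / \<mu>\<close>, so solving row \<open>i\<close> for \<open>y $ i\<close> gains a
      factor \<open>\<mu>\<close>.\<close>
    have Z: "Z \<le> k1 * (\<mu> * X + Q)"
    proof -
      have "Z \<le> (\<mu> / c) * norm (restr (-B) (transpose A *v x - h))"
        unfolding Z_def yN_def
      proof (rule norm_restr_mono)
        fix i assume "i \<in> -B"
        then have d: "c / \<mu> \<le> d $ i" using dN by auto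
        have cm: "0 < c / \<mu>" using c mu by simp
        have "(c / \<mu>) * \<bar>y $ i\<bar> \<le> d $ i * \<bar>y $ i\<bar>" using d by (intro mult_right_mono) auto
        also have "\<dots> = \<bar>d $ i * y $ i\<bar>" using d cm by (simp add: abs_mult)
        also have "d $ i * y $ i = (transpose A *v x - h) $ i" using eq2[of i] by simp
        finally show "\<bar>y $ i\<bar> \<le> (\<mu> / c) * \<bar>(transpose A *v x - h) $ i\<bar>"
          using c mu by (simp add: field_simps)
      qed (use c mu in auto)
      also have "\<dots> \<le> (\<mu> / c) * (M * X + norm (restr (-B) h))"
      proof -
        have "norm (restr (-B) (transpose A *v x - h)) \<le> norm (restr (-B) (transpose A *v x)) + norm (restr (-B) h)"
          unfolding restr_diff by (rule norm_triangle_ineq4)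
        also have "\<dots> \<le> M * X + norm (restr (-B) h)"
          using norm_restr_le[of "-B" "transpose A *v x"] ATv[of x] by (simp add: X_def)
        finally show ?thesis using c mu by (intro mult_left_mono) auto
      qed
      also have "\<dots> = (M / c) * (\<mu> * X) + (1 / c) * (\<mu> * norm (restr (-B) h))"
        by (simp add: algebra_simps)
      also have "\<dots> \<le> (M / c) * (\<mu> * X + Q) + (1 / c) * (\<mu> * X + Q)"
        using fQ nn mu c M0 by (intro add_mono mult_left_mono) (auto intro: add_increasing)
      finally show ?thesis by (simp add: k1_def algebra_simps)
    qed
    \<comment> \<open>With the inactive duals moved to the right, only the active block remains
      coupled to \<open>x\<close>.\<close>
    define f' where "f' = f - A *v yN"
    have F: "norm f' \<le> k2 * (\<mu> * X + Q)"
    proof -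
      have "norm f' \<le> norm f + M * Z"
        unfolding f'_def using norm_triangle_ineq4[of f "A *v yN"] Av[of yN] by (simp add: Z_def)
      also have "\<dots> \<le> (\<mu> * X + Q) + M * (k1 * (\<mu> * X + Q))"
        using fQ nn mu M0 Z by (intro add_mono mult_left_mono) (auto simp: add_increasing)
      finally show ?thesis by (simp add: k2_def algebra_simps)
    qed
    \<comment> \<open>\<open>E\<close> is the drift of the active columns. Its norm is at most
      \<open>M * \<mu>\<close>, so it turns \<open>Y\<close> into the weighted quantity
      \<open>\<mu> * Y\<close>.\<close>
    define E where "E = cols B (A - A\<^sub>1)"
    have Ev: "norm (E *v v) \<le> M * \<mu> * norm v" for v
    proof -
      have "norm (E *v v) \<le> norm (A - A\<^sub>1) * norm (restr B v)"
        unfolding E_def cols_mult by (rule norm_matrix_vector_le)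
      also have "\<dots> \<le> (M * \<mu>) * norm v"
        using A1 norm_restr_le[of B v] M0 mu by (intro mult_mono) auto
      finally show ?thesis .
    qed
    have ETv: "norm (transpose E *v v) \<le> M * \<mu> * norm v" for v
    proof -
      have "norm (transpose E *v v) \<le> norm (transpose (A - A\<^sub>1) *v v)"
        unfolding E_def transpose_cols_mult by (rule norm_restr_le)
      also have "\<dots> \<le> norm (A - A\<^sub>1) * norm v" by (rule norm_transpose_vector_le)
      also have "\<dots> \<le> (M * \<mu>) * norm v" using A1 by (intro mult_right_mono) auto
      finally show ?thesis .
    qed
    have AyB: "A *v yB = A\<^sub>0 *v yB + E *v yB"
      by (simp add: A\<^sub>0_def E_def cols_mult matrix_vector_mult_diff_rdistrib yB_def)
    have ATx: "restr B (transpose A *v x) = transpose A\<^sub>0 *v x + transpose E *v x"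
      unfolding A\<^sub>0_def E_def transpose_cols_mult
      by (simp add: transpose_def restr_def vec_eq_iff matrix_vector_mult_def sum.distrib[symmetric] algebra_simps)
    have eq1': "H *v x + A *v yB = f'"
    proof -
      have "A *v y = A *v yB + A *v yN"
        unfolding yB_def yN_def by (metis restr_split matrix_vector_right_distrib)
      then show ?thesis using eq1 by (simp add: f'_def algebra_simps)
    qed
    \<comment> \<open>In the active rows both unknown contributions, the diagonal term and the
      drift, carry a factor \<open>\<mu>\<close>.\<close>
    have A0x: "norm (transpose A\<^sub>0 *v x) \<le> M * (Q + \<mu> * Y + \<mu> * X)"
    proof -
      define D where "D = (\<chi> i. d $ i * y $ i)"
      have "restr B (transpose A *v x) = restr B h + restr B D"
        using eq2 by (simp add: vec_eq_iff D_def algebra_simps)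
      then have "transpose A\<^sub>0 *v x = restr B h + restr B D - transpose E *v x"
        using ATx by (simp add: algebra_simps)
      then have "norm (transpose A\<^sub>0 *v x) \<le> norm (restr B h) + norm (restr B D) + norm (transpose E *v x)"
        using norm_triangle_ineq4[of "restr B h + restr B D" "transpose E *v x"]
          norm_triangle_ineq[of "restr B h" "restr B D"] by simp
      moreover have "norm (restr B D) \<le> M * \<mu> * Y"
        unfolding Y_def yB_def
      proof (rule norm_restr_mono)
        fix i assume "i \<in> B"
        have "0 \<le> c * \<mu>" using c mu by simp
        then have "\<bar>d $ i\<bar> \<le> M * \<mu>" using dB[OF \<open>i \<in> B\<close>] by linarith
        then show "\<bar>D $ i\<bar> \<le> M * \<mu> * \<bar>y $ i\<bar>"
          by (simp add: D_def abs_mult mult_right_mono)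
      qed (use M0 mu in auto)
      moreover have "norm (restr B h) \<le> M * Q"
        using fQ(2) mult_right_mono[OF M nn(4)] by linarith
      ultimately show ?thesis using ETv[of x] by (simp add: X_def algebra_simps)
    qed
    obtain q w where x: "x = A\<^sub>0 *v q + w" and w: "transpose A\<^sub>0 *v w = 0" and ort: "(A\<^sub>0 *v q) \<bullet> w = 0"
      by (rule range_kernel_decomposition)
    define r where "r = A\<^sub>0 *v q"
    define S where "S = Q + \<mu> * Y + \<mu> * X"
    have S0: "0 \<le> S" using nn mu by (simp add: S_def)
    have r: "norm r \<le> k3 * S"
    proof -
      have "transpose A\<^sub>0 *v x = transpose A\<^sub>0 *v r"
        by (simp only: x w r_def matrix_vector_right_distrib add_0_right)
      then have "c0 * norm r \<le> M * S" using c0(2)[of q] A0x by (simp add: r_def S_def)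
      then show ?thesis using c0 by (simp add: k3_def field_simps)
    qed
    have xr: "x = w + r" by (simp only: x r_def add.commute)
    have "orthogonal w r" using ort by (metis r_def orthogonal_def inner_commute)
    then have pyth: "X\<^sup>2 = (norm w)\<^sup>2 + (norm r)\<^sup>2"
      unfolding X_def xr by (rule norm_add_Pythagorean)
    have wX: "norm w \<le> X" and rX: "norm r \<le> X"
      using pyth nn by (auto intro: power2_le_imp_le[of _ X])
    have cross: "\<bar>a \<bullet> (H *v b)\<bar> \<le> M * norm a * norm b" for a b
    proof -
      have "\<bar>a \<bullet> (H *v b)\<bar> \<le> norm a * norm (H *v b)" by (rule Cauchy_Schwarz_ineq2)
      also have "\<dots> \<le> norm a * (M * norm b)" using Hv by (intro mult_left_mono) auto
      finally show ?thesis by (simp add: mult_ac)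
    qed
    \<comment> \<open>After splitting \<open>x = w + r\<close>, every term that involves
      \<open>r\<close> is charged to \<open>norm r * X\<close>; the summand \<open>\<xi>\<close> of
      the constant completes \<open>(norm w)\<^sup>2\<close> to \<open>X\<^sup>2\<close>.\<close>
    have energy: "\<xi> * X\<^sup>2 \<le> x \<bullet> (H *v x) + (3 * M + \<xi>) * (norm r * X)"
    proof -
      have "x \<bullet> (H *v x) = w \<bullet> (H *v w) + w \<bullet> (H *v r) + r \<bullet> (H *v x)"
        unfolding xr by (simp add: matrix_vector_right_distrib inner_add_left inner_add_right)
      moreover have "\<bar>w \<bullet> (H *v r)\<bar> \<le> M * (norm r * X)"
      proof -
        have "M * norm w * norm r \<le> M * X * norm r"
          using wX M0 by (intro mult_right_mono mult_left_mono) auto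
        then show ?thesis using cross[of w r] by (simp add: mult_ac)
      qed
      moreover have "\<bar>r \<bullet> (H *v x)\<bar> \<le> M * (norm r * X)"
        using cross[of r x] by (simp add: X_def mult_ac)
      moreover have "\<xi> * (norm r)\<^sup>2 \<le> \<xi> * (norm r * X)"
        using \<xi> rX by (intro mult_left_mono) (auto simp: power2_eq_square mult_left_mono)
      moreover have "0 \<le> M * (norm r * X)" using M0 nn by simp
      ultimately show ?thesis using coer[OF w] unfolding pyth by (simp add: algebra_simps)
    qed
    have h1: "\<xi> * X\<^sup>2 + c * \<mu> * Y\<^sup>2 \<le> (k5 + k6) * (Q * X + Q * Y + \<mu> * X * Y + \<mu> * X\<^sup>2)"
    proof -
      have "x \<bullet> (A *v yB) = (transpose A *v x) \<bullet> yB"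
        by (rule inner_transpose_vector[symmetric])
      also have "\<dots> = (\<Sum>i\<in>UNIV. restr B h $ i * yB $ i + (if i \<in> B then d $ i * (y $ i)\<^sup>2 else 0))"
        unfolding inner_vec_def using eq2
        by (intro sum.cong) (auto simp: yB_def power2_eq_square algebra_simps)
      also have "\<dots> = restr B h \<bullet> yB + (\<Sum>i\<in>UNIV. if i \<in> B then d $ i * (y $ i)\<^sup>2 else 0)"
        by (simp add: sum.distrib inner_vec_def)
      finally have e: "x \<bullet> (A *v yB) = restr B h \<bullet> yB + (\<Sum>i\<in>UNIV. if i \<in> B then d $ i * (y $ i)\<^sup>2 else 0)" .
      have "c * \<mu> * Y\<^sup>2 = (\<Sum>i\<in>UNIV. c * \<mu> * (yB $ i)\<^sup>2)"
        unfolding Y_def power2_norm_eq_inner by (simp add: inner_vec_def sum_distrib_left power2_eq_square)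
      also have "\<dots> \<le> (\<Sum>i\<in>UNIV. if i \<in> B then d $ i * (y $ i)\<^sup>2 else 0)"
        using dB by (intro sum_mono) (auto simp: yB_def mult_right_mono)
      finally have cY: "c * \<mu> * Y\<^sup>2 \<le> (\<Sum>i\<in>UNIV. if i \<in> B then d $ i * (y $ i)\<^sup>2 else 0)" .
      have "x \<bullet> (H *v x) + c * \<mu> * Y\<^sup>2 \<le> x \<bullet> f' - restr B h \<bullet> yB"
      proof -
        have "x \<bullet> f' = x \<bullet> (H *v x) + x \<bullet> (A *v yB)" by (simp add: inner_add_right flip: eq1')
        then show ?thesis using e cY by linarith
      qed
      also have "\<dots> \<le> X * norm f' + norm (restr B h) * Y"
        using norm_cauchy_schwarz[of x f'] Cauchy_Schwarz_ineq2[of "restr B h" yB]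
        by (simp add: X_def Y_def)
      also have "\<dots> \<le> X * (k2 * (\<mu> * X + Q)) + Q * Y"
        using F fQ nn by (intro add_mono mult_left_mono mult_right_mono) auto
      finally have "\<xi> * X\<^sup>2 + c * \<mu> * Y\<^sup>2 \<le> X * (k2 * (\<mu> * X + Q)) + Q * Y + (3 * M + \<xi>) * (norm r * X)"
        using energy by linarith
      also have "\<dots> \<le> X * (k2 * (\<mu> * X + Q)) + Q * Y + (3 * M + \<xi>) * (k3 * S * X)"
        using r nn M0 \<xi> by (intro add_left_mono mult_left_mono mult_right_mono) auto
      also have "\<dots> = k2 * (Q * X + \<mu> * X\<^sup>2) + Q * Y + k4 * (Q * X + \<mu> * X * Y + \<mu> * X\<^sup>2)"
        by (simp add: k4_def S_def power2_eq_square algebra_simps)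
      also have "\<dots> \<le> k5 * (Q * X + Q * Y + \<mu> * X * Y + \<mu> * X\<^sup>2)"
      proof -
        define s1 s2 s3 s4 where "s1 = Q * X" and "s2 = Q * Y" and "s3 = \<mu> * X * Y" and "s4 = \<mu> * X\<^sup>2"
        have "0 \<le> s1" "0 \<le> s2" "0 \<le> s3" "0 \<le> s4"
          using nn mu by (simp_all add: s1_def s2_def s3_def s4_def)
        then have "0 \<le> k2 * s2" "0 \<le> k2 * s3" "0 \<le> k4 * s2" "0 \<le> s1" "0 \<le> s3" "0 \<le> s4"
          using pos by simp_all
        then show ?thesis
          unfolding s1_def[symmetric] s2_def[symmetric] s3_def[symmetric] s4_def[symmetric] k5_def
          by (simp add: algebra_simps)
      qed
      also have "\<dots> \<le> (k5 + k6) * (Q * X + Q * Y + \<mu> * X * Y + \<mu> * X\<^sup>2)"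
        using nn mu pos by (intro mult_right_mono) auto
      finally show ?thesis .
    qed
    \<comment> \<open>Pairing with \<open>w\<close> instead of \<open>x\<close> annihilates
      \<open>A\<^sub>0 *v yB\<close>; of the active duals only the drift term of order
      \<open>\<mu> * Y\<close> survives.\<close>
    have h2: "X \<le> (k5 + k6) * (Q + \<mu> * Y + \<mu> * X)"
    proof -
      have "w \<bullet> (A\<^sub>0 *v yB) = 0"
        using w by (metis inner_transpose_vector inner_zero_left)
      then have "w \<bullet> (H *v w) = w \<bullet> (f' - E *v yB - H *v r)"
      proof -
        have "f' = H *v w + H *v r + A\<^sub>0 *v yB + E *v yB"
          using eq1' AyB xr by (simp add: matrix_vector_right_distrib algebra_simps)
        then show ?thesis using \<open>w \<bullet> (A\<^sub>0 *v yB) = 0\<close> by (simp add: inner_diff_right inner_add_right)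
      qed
      also have "\<dots> \<le> norm w * norm (f' - E *v yB - H *v r)" by (rule norm_cauchy_schwarz)
      finally have "norm w * (\<xi> * norm w) \<le> norm w * norm (f' - E *v yB - H *v r)"
        using coer[OF w] by (simp add: power2_eq_square mult_ac)
      then have "\<xi> * norm w \<le> norm (f' - E *v yB - H *v r)"
        by (cases "norm w = 0") (auto simp: mult_le_cancel_left)
      also have "\<dots> \<le> norm f' + M * \<mu> * Y + M * norm r"
        using norm_triangle_ineq4[of "f' - E *v yB" "H *v r"] norm_triangle_ineq4[of f' "E *v yB"]
          Ev[of yB] Hv[of r] by (simp add: Y_def)
      also have "\<dots> \<le> k2 * S + M * S + M * (k3 * S)"
      proof -
        have "k2 * (\<mu> * X + Q) \<le> k2 * S"
          using pos nn mu by (intro mult_left_mono) (auto simp: S_def)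
        then have "norm f' \<le> k2 * S" using F by simp
        moreover have "M * (\<mu> * Y) \<le> M * S" using M0 nn mu by (intro mult_left_mono) (auto simp: S_def)
        moreover have "M * norm r \<le> M * (k3 * S)" using r M0 by (intro mult_left_mono) auto
        ultimately show ?thesis by (simp add: mult.assoc)
      qed
      finally have "norm w \<le> (k2 + M + M * k3) / \<xi> * S"
        using \<xi> by (simp add: field_simps)
      then have "norm w + norm r \<le> k6 * S" using r by (simp add: k6_def algebra_simps)
      then have "X \<le> k6 * S" unfolding X_def xr using norm_triangle_ineq[of w r] by simp
      also have "\<dots> \<le> (k5 + k6) * S" using S0 pos by (intro mult_right_mono) auto
      finally show ?thesis by (simp add: S_def)
    qed
    have XY: "X \<le> K * Q" "\<mu> * Y \<le> K * Q"
      using core[OF mu(1) _ nn(1,2,4) h1 h2] mu by auto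
    have muX: "\<mu> * X \<le> K * Q" using XY(1) mult_right_mono[of \<mu> 1 X] mu nn by simp
    have "k1 * (\<mu> * X + Q) \<le> k1 * (K * Q + Q)" using muX pos by (intro mult_left_mono) auto
    then have Z': "Z \<le> k1 * (K + 1) * Q" using Z by (simp add: algebra_simps)
    \<comment> \<open>The stationarity row now bounds the image of the active duals directly,
      without division by \<open>\<mu>\<close>.\<close>
    have "norm (A\<^sub>0 *v y) \<le> (k2 * (K + 1) + 2 * M * K) * Q"
    proof -
      have "A\<^sub>0 *v y = A\<^sub>0 *v yB" by (simp add: A\<^sub>0_def yB_def cols_restr)
      also have "\<dots> = f' - H *v x - E *v yB" using eq1' AyB by (simp add: algebra_simps)
      finally have "norm (A\<^sub>0 *v y) \<le> norm f' + M * X + M * (\<mu> * Y)"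
        using norm_triangle_ineq4[of "f' - H *v x" "E *v yB"] norm_triangle_ineq4[of f' "H *v x"]
          Ev[of yB] Hv[of x] by (simp add: Y_def X_def mult.assoc)
      also have "\<dots> \<le> k2 * (K * Q + Q) + M * (K * Q) + M * (K * Q)"
      proof -
        have "k2 * (\<mu> * X + Q) \<le> k2 * (K * Q + Q)" using muX pos by (intro mult_left_mono) auto
        then show ?thesis using F XY M0 by (intro add_mono mult_left_mono) auto
      qed
      finally show ?thesis by (simp add: algebra_simps)
    qed
    then have "X + \<mu> * Y + Z + norm (A\<^sub>0 *v y) \<le> K' * Q"
      using XY Z' by (simp add: K'_def algebra_simps)
    then show ?thesis by (simp add: X_def Y_def Z_def Q_def yB_def yN_def)
  qed
  show ?thesis
    unfolding A\<^sub>0_def[symmetric]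
    using K' \<epsilon> main by (intro exI[of _ K'] conjI exI[of _ "min \<epsilon> 1"]) auto
qed

section \<open>Expansions of the problem functions\<close>

lemma has_derivative_grad:
  fixes f :: "real^'n \<Rightarrow> real"
  assumes "f differentiable (at z)"
  shows "(f has_derivative (\<lambda>v. grad f z \<bullet> v)) (at z)"
proof -
  let ?D = "frechet_derivative f (at z)"
  have D: "(f has_derivative ?D) (at z)" using assms by (simp add: frechet_derivative_works)
  then have lin: "linear ?D" by (rule has_derivative_linear)
  have "?D v = grad f z \<bullet> v" for v
  proof -
    have "?D v = ?D (\<Sum>i\<in>UNIV. v $ i *\<^sub>R axis i 1)"
      using basis_expansion[of v] by (simp add: scalar_mult_eq_scaleR)
    also have "\<dots> = (\<Sum>i\<in>UNIV. v $ i * ?D (axis i 1))"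
      using lin by (simp add: linear_sum linear_scale)
    finally show ?thesis by (simp add: grad_def inner_vec_def mult.commute)
  qed
  then have "?D = (\<lambda>v. grad f z \<bullet> v)" by auto
  then show ?thesis using D by simp
qed

lemma grad_eqI:
  fixes f :: "real^'n \<Rightarrow> real"
  assumes "(f has_derivative (\<lambda>v. a \<bullet> v)) (at z)"
  shows "grad f z = a"
  by (simp add: grad_def vec_eq_iff inner_axis flip: frechet_derivative_at[OF assms])

lemma has_derivative_grad_hess:
  fixes f :: "real^'n \<Rightarrow> real"
  assumes "grad f differentiable (at z)"
  shows "(grad f has_derivative (\<lambda>v. hess f z *v v)) (at z)"
  using assms jacobian_works unfolding hess_def by blast

lemma hess_eqI:
  fixes f :: "real^'n \<Rightarrow> real"
  assumes "(grad f has_derivative (\<lambda>v. H *v v)) (at z)"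
  shows "hess f z = H"
  by (simp add: hess_def jacobian_def flip: frechet_derivative_at[OF assms])

lemma sum_scaleR_matrix_vector:
  fixes A :: "'a \<Rightarrow> real^'k^'j"
  shows "(\<Sum>i\<in>I. c i *\<^sub>R A i) *v v = (\<Sum>i\<in>I. c i *\<^sub>R (A i *v v))"
  by (induction I rule: infinite_finite_induct)
     (auto simp: matrix_vector_mult_add_rdistrib scaleR_matrix_vector_assoc)

lemma lagr_z_eq:
  fixes g :: "real^'n \<Rightarrow> real^'m"
  assumes "\<And>z. \<phi> differentiable (at z)" "\<And>i z. (\<lambda>y. g y $ i) differentiable (at z)"
  shows "lagr_z \<phi> g z l = grad \<phi> z + (\<Sum>i\<in>UNIV. l $ i *\<^sub>R grad (\<lambda>y. g y $ i) z)"
  unfolding lagr_z_def lagr_def inner_vec_def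
proof (rule grad_eqI)
  have "((\<lambda>y. \<phi> y + (\<Sum>i\<in>UNIV. l $ i * g y $ i)) has_derivative
      (\<lambda>v. grad \<phi> z \<bullet> v + (\<Sum>i\<in>UNIV. l $ i * (grad (\<lambda>y. g y $ i) z \<bullet> v)))) (at z)"
    by (intro has_derivative_add has_derivative_sum has_derivative_mult_right has_derivative_grad assms)
  then show "((\<lambda>y. \<phi> y + (\<Sum>i\<in>UNIV. l $ i \<bullet> g y $ i)) has_derivative
      (\<lambda>v. (grad \<phi> z + (\<Sum>i\<in>UNIV. l $ i *\<^sub>R grad (\<lambda>y. g y $ i) z)) \<bullet> v)) (at z)"
    by (simp add: inner_add_left inner_sum_left)
qed

lemma lagr_zz_eq:
  fixes g :: "real^'n \<Rightarrow> real^'m"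
  assumes "\<And>z. \<phi> differentiable (at z)" "\<And>i z. (\<lambda>y. g y $ i) differentiable (at z)"
    and "grad \<phi> differentiable (at z)" "\<And>i. grad (\<lambda>y. g y $ i) differentiable (at z)"
  shows "lagr_zz \<phi> g z l = hess \<phi> z + (\<Sum>i\<in>UNIV. l $ i *\<^sub>R hess (\<lambda>y. g y $ i) z)"
  unfolding lagr_zz_def
proof (rule hess_eqI)
  have "grad (\<lambda>y. lagr \<phi> g y l) = (\<lambda>z. grad \<phi> z + (\<Sum>i\<in>UNIV. l $ i *\<^sub>R grad (\<lambda>y. g y $ i) z))"
    using lagr_z_eq[OF assms(1,2)] by (simp add: lagr_z_def fun_eq_iff)
  moreover have "((\<lambda>z. grad \<phi> z + (\<Sum>i\<in>UNIV. l $ i *\<^sub>R grad (\<lambda>y. g y $ i) z)) has_derivative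
     (\<lambda>v. (hess \<phi> z + (\<Sum>i\<in>UNIV. l $ i *\<^sub>R hess (\<lambda>y. g y $ i) z)) *v v)) (at z)"
    unfolding matrix_vector_mult_add_rdistrib sum_scaleR_matrix_vector
    by (intro has_derivative_add has_derivative_sum has_derivative_scaleR_right has_derivative_grad_hess assms)
  ultimately show "(grad (\<lambda>y. lagr \<phi> g y l) has_derivative
     (\<lambda>v. (hess \<phi> z + (\<Sum>i\<in>UNIV. l $ i *\<^sub>R hess (\<lambda>y. g y $ i) z)) *v v)) (at z)"
    by simp
qed

lemma transpose_nabla_mult: "(transpose (nabla g z) *v x) $ i = grad (\<lambda>y. g y $ i) z \<bullet> x"
  by (simp add: matrix_vector_mult_def nabla_def transpose_def inner_vec_def)

text \<open>The two constants have different roles: \<open>M\<close> is tied to \<open>f\<close> and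
  \<open>a\<close>, while \<open>\<kappa>\<close> bounds what becomes arbitrarily small as
  \<open>z\<close> approaches \<open>a\<close>.\<close>

definition expansion_bounds :: "(real^'n \<Rightarrow> real) \<Rightarrow> real^'n \<Rightarrow> real \<Rightarrow> real \<Rightarrow> real^'n \<Rightarrow> bool" where
  "expansion_bounds f a M \<kappa> z \<longleftrightarrow>
     norm (grad f z - grad f a) \<le> M * norm (z - a) \<and>
     norm (grad f z - grad f a - hess f a *v (z - a)) \<le> \<kappa> * norm (z - a) \<and>
     \<bar>f z - f a - grad f a \<bullet> (z - a)\<bar> \<le> M * (norm (z - a))\<^sup>2 \<and>
     norm (hess f z - hess f a) \<le> \<kappa> \<and> norm (hess f a) \<le> M \<and> norm (grad f a) \<le> M"

lemma expansion_bounds_mono: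
  assumes "expansion_bounds f a M \<kappa> z" "M \<le> M'" "\<kappa> \<le> \<kappa>'"
  shows "expansion_bounds f a M' \<kappa>' z"
  using assms unfolding expansion_bounds_def
  by (meson mult_right_mono norm_ge_zero order_trans zero_le_power)

text \<open>The two bounds on the gradient increment use only the derivative of
  \<open>grad f\<close> at \<open>a\<close>. The quadratic remainder comes from the mean value
  inequality, and the Hessian bound from local Lipschitz continuity, which merely shrinks the
  neighbourhood.\<close>

lemma eventually_expansion_bounds:
  fixes f :: "real^'n \<Rightarrow> real"
  assumes "twice_lipschitz_diff f"
  shows "\<exists>M. \<forall>\<kappa>>0. eventually (expansion_bounds f a M \<kappa>) (nhds a)"
proof -
  have d1: "\<And>z. f differentiable (at z)" and d2: "\<And>z. grad f differentiable (at z)"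
    using assms by (auto simp: twice_lipschitz_diff_def)
  obtain \<rho> L where \<rho>: "\<rho> > 0" and L: "L-lipschitz_on (ball a \<rho>) (hess f)"
    using assms unfolding twice_lipschitz_diff_def by metis
  have L0: "L \<ge> 0" using L by (rule lipschitz_on_nonneg)
  \<comment> \<open>The summand 1 is the remainder of the derivative of \<open>grad f\<close> at
    tolerance 1; added to the norm of the Hessian it bounds the gradient increment.\<close>
  define M where "M = norm (hess f a) + 1 + norm (grad f a)"
  have der: "\<forall>e>0. \<exists>d>0. \<forall>y. norm (y - a) < d \<longrightarrow> norm (grad f y - grad f a - hess f a *v (y - a)) \<le> e * norm (y - a)"
    using has_derivative_grad_hess[OF d2, of a] unfolding has_derivative_at_alt by blast
  obtain d0 where d0: "d0 > 0" "\<And>y. norm (y - a) < d0 \<Longrightarrow> norm (grad f y - grad f a - hess f a *v (y - a)) \<le> 1 * norm (y - a)"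
    using der zero_less_one by blast
  have gl: "norm (grad f y - grad f a) \<le> M * norm (y - a)" if "norm (y - a) < d0" for y
  proof -
    have "norm (grad f y - grad f a) \<le> norm (grad f y - grad f a - hess f a *v (y - a)) + norm (hess f a *v (y - a))"
      by (metis diff_add_cancel norm_triangle_ineq)
    also have "\<dots> \<le> 1 * norm (y - a) + norm (hess f a) * norm (y - a)"
      using d0(2)[OF that] norm_matrix_vector_le by (intro add_mono) auto
    also have "\<dots> \<le> M * norm (y - a)"
      unfolding M_def by (simp add: algebra_simps)
    finally show ?thesis .
  qed
  have quad: "\<bar>f z - f a - grad f a \<bullet> (z - a)\<bar> \<le> M * (norm (z - a))\<^sup>2" if z: "norm (z - a) < d0" for z
  proof -
    \<comment> \<open>Without its linear part at \<open>a\<close> the function has gradient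
      \<open>grad f y - grad f a\<close>, of norm at most \<open>M * norm (z - a)\<close> throughout
      the ball.\<close>
    define h where "h = (\<lambda>y. f y - grad f a \<bullet> y)"
    have "norm (h z - h a) \<le> (M * norm (z - a)) * norm (z - a)"
    proof (rule differentiable_bound[where S = "cball a (norm (z - a))" and f' = "\<lambda>y v. (grad f y - grad f a) \<bullet> v"])
      fix y assume y: "y \<in> cball a (norm (z - a))"
      show "(h has_derivative (\<lambda>v. (grad f y - grad f a) \<bullet> v)) (at y within cball a (norm (z - a)))"
        unfolding h_def inner_diff_left
        by (intro has_derivative_diff has_derivative_at_withinI[OF has_derivative_grad[OF d1]]
            has_derivative_inner_right has_derivative_ident)
      have "norm (y - a) \<le> norm (z - a)" using y by (simp add: dist_norm norm_minus_commute)
      then have "norm (grad f y - grad f a) \<le> M * norm (z - a)"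
        using gl[of y] z by (smt (verit) M_def mult_left_mono norm_ge_zero)
      then show "onorm (\<lambda>v. (grad f y - grad f a) \<bullet> v) \<le> M * norm (z - a)"
        by (intro onorm_le) (simp add: order_trans[OF Cauchy_Schwarz_ineq2 mult_right_mono])
    qed (auto simp: dist_norm norm_minus_commute)
    moreover have "h z - h a = f z - f a - grad f a \<bullet> (z - a)"
      by (simp add: h_def inner_diff_right)
    ultimately show ?thesis by (simp add: power2_eq_square mult.assoc)
  qed
  have "eventually (expansion_bounds f a M \<kappa>) (nhds a)" if \<kappa>: "\<kappa> > 0" for \<kappa>
  proof -
    obtain d where d: "d > 0" "\<And>y. norm (y - a) < d \<Longrightarrow> norm (grad f y - grad f a - hess f a *v (y - a)) \<le> \<kappa> * norm (y - a)"
      using der \<kappa> by blast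
    define R where "R = Min {d0, d, \<rho>, \<kappa> / (L + 1)}"
    have R: "R > 0" using d0 d \<rho> \<kappa> L0 by (simp add: R_def)
    have "expansion_bounds f a M \<kappa> z" if "dist z a < R" for z
    proof -
      have z: "norm (z - a) < d0" "norm (z - a) < d" "norm (z - a) < \<rho>" "norm (z - a) < \<kappa> / (L + 1)"
        using that by (auto simp: R_def dist_norm)
      have "norm (hess f z - hess f a) \<le> L * norm (z - a)"
        using lipschitz_onD[OF L, of z a] z \<rho> by (simp add: dist_norm norm_minus_commute)
      also have "\<dots> \<le> (L + 1) * norm (z - a)" by (simp add: mult_right_mono)
      also have "\<dots> \<le> \<kappa>" using z(4) L0 by (simp add: field_simps)
      finally show ?thesis
        unfolding expansion_bounds_def using gl[OF z(1)] quad[OF z(1)] d(2)[OF z(2)] by (auto simp: M_def)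
    qed
    then show ?thesis unfolding eventually_nhds_metric using R by blast
  qed
  then show ?thesis by blast
qed

text \<open>One \<open>M\<close> serves the objective and all constraints, and it is fixed before
  \<open>\<kappa>\<close>, because the thresholds later imposed on \<open>\<kappa>\<close> are
  computed from \<open>M\<close>.\<close>

lemma eventually_expansion_bounds_all:
  fixes g :: "real^'n \<Rightarrow> real^'m"
  assumes "twice_lipschitz_diff \<phi>" "\<And>i. twice_lipschitz_diff (\<lambda>z. g z $ i)"
  shows "\<exists>M\<ge>1. \<forall>\<kappa>>0. \<exists>r>0. \<forall>z. norm (z - a) \<le> r \<longrightarrow>
     expansion_bounds \<phi> a M \<kappa> z \<and> (\<forall>i. expansion_bounds (\<lambda>z. g z $ i) a M \<kappa> z)"
proof -
  obtain M0 where M0: "\<forall>\<kappa>>0. eventually (expansion_bounds \<phi> a M0 \<kappa>) (nhds a)"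
    using eventually_expansion_bounds[OF assms(1)] ..
  have "\<forall>i. \<exists>M. \<forall>\<kappa>>0. eventually (expansion_bounds (\<lambda>z. g z $ i) a M \<kappa>) (nhds a)"
    by (intro allI eventually_expansion_bounds assms)
  from choice[OF this] obtain Mg
    where Mg: "\<forall>i. \<forall>\<kappa>>0. eventually (expansion_bounds (\<lambda>z. g z $ i) a (Mg i) \<kappa>) (nhds a)" ..
  define M where "M = 1 + \<bar>M0\<bar> + (\<Sum>i\<in>UNIV. \<bar>Mg i\<bar>)"
  have "0 \<le> (\<Sum>i\<in>UNIV. \<bar>Mg i\<bar>)" by (intro sum_nonneg) auto
  then have M: "1 \<le> M" "M0 \<le> M" unfolding M_def by linarith+
  have Mi: "Mg i \<le> M" for i
    using member_le_sum[of i UNIV "\<lambda>i. \<bar>Mg i\<bar>"] by (auto simp: M_def)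
  have "\<exists>r>0. \<forall>z. norm (z - a) \<le> r \<longrightarrow>
     expansion_bounds \<phi> a M \<kappa> z \<and> (\<forall>i. expansion_bounds (\<lambda>z. g z $ i) a M \<kappa> z)" if "\<kappa> > 0" for \<kappa>
  proof -
    have "eventually (\<lambda>z. expansion_bounds \<phi> a M \<kappa> z \<and> (\<forall>i. expansion_bounds (\<lambda>z. g z $ i) a M \<kappa> z)) (nhds a)"
    proof (intro eventually_conj eventually_all_finite)
      show "eventually (expansion_bounds \<phi> a M \<kappa>) (nhds a)"
        using M0[rule_format, OF that] by (rule eventually_mono) (rule expansion_bounds_mono[OF _ M(2) order_refl])
      show "eventually (expansion_bounds (\<lambda>z. g z $ i) a M \<kappa>) (nhds a)" for i
        using Mg[rule_format, OF that] by (rule eventually_mono) (rule expansion_bounds_mono[OF _ Mi order_refl])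
    qed
    then show ?thesis
      unfolding eventually_nhds_metric_le by (auto simp: dist_norm)
  qed
  then show ?thesis using M by blast
qed

section \<open>Estimates at the iterate\<close>

lemma multipliersD:
  assumes "l \<in> multipliers \<phi> g zs"
  shows "lagr_z \<phi> g zs l = 0" "0 \<le> l $ i" "g zs $ i \<le> 0" "l \<bullet> g zs = 0"
    "i \<notin> active g zs \<Longrightarrow> l $ i = 0"
proof -
  have k: "kkt \<phi> g zs l" using assms by (simp add: multipliers_def)
  then show "lagr_z \<phi> g zs l = 0" "0 \<le> l $ i" "g zs $ i \<le> 0" and z: "l \<bullet> g zs = 0"
    by (auto simp: kkt_def)
  assume i: "i \<notin> active g zs"
  have "(\<Sum>i\<in>UNIV. - (l $ i * g zs $ i)) = 0"
    using z by (simp add: inner_vec_def sum_negf)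
  moreover have "0 \<le> - (l $ i * g zs $ i)" for i
    using k by (auto simp: kkt_def mult_nonneg_nonpos)
  ultimately have "\<forall>i\<in>UNIV. - (l $ i * g zs $ i) = 0"
    by (subst (asm) sum_nonneg_eq_0_iff) auto
  then have "l $ i * g zs $ i = 0" by (metis UNIV_I neg_equal_0_iff_equal)
  then show "l $ i = 0" using i by (simp add: active_def)
qed

lemma regular_differentiable:
  assumes "regular_solution \<phi> g zs"
  shows "\<And>z. \<phi> differentiable (at z)" "\<And>i z. (\<lambda>y. g y $ i) differentiable (at z)"
    "\<And>z. grad \<phi> differentiable (at z)" "\<And>i z. grad (\<lambda>y. g y $ i) differentiable (at z)"
  using assms by (auto simp: regular_solution_def twice_lipschitz_diff_def)

lemma regular_lagr_z:
  assumes "regular_solution \<phi> g zs"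
  shows "lagr_z \<phi> g z l = grad \<phi> z + (\<Sum>i\<in>UNIV. l $ i *\<^sub>R grad (\<lambda>y. g y $ i) z)"
  using regular_differentiable[OF assms] by (intro lagr_z_eq)

lemma regular_lagr_zz:
  assumes "regular_solution \<phi> g zs"
  shows "lagr_zz \<phi> g z l = hess \<phi> z + (\<Sum>i\<in>UNIV. l $ i *\<^sub>R hess (\<lambda>y. g y $ i) z)"
  using regular_differentiable[OF assms] by (intro lagr_zz_eq)

text \<open>Stationarity is paired with the MFCQ direction. Active multipliers then enter with
  coefficients bounded below by a positive number, inactive ones vanish, and the sum is a fixed
  number.\<close>

lemma multipliers_bounded:
  fixes g :: "real^'n \<Rightarrow> real^'m"
  assumes reg: "regular_solution \<phi> g zs"
  shows "\<exists>\<Lambda>\<ge>1. \<forall>l\<in>multipliers \<phi> g zs. norm l \<le> \<Lambda>"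
proof -
  obtain y where y: "\<And>i. i \<in> active g zs \<Longrightarrow> grad (\<lambda>x. g x $ i) zs \<bullet> y < 0"
    using reg by (auto simp: regular_solution_def mfcq_def)
  define a where "a i = - (grad (\<lambda>x. g x $ i) zs \<bullet> y)" for i
  \<comment> \<open>The inserted 1 makes the minimum meaningful when no constraint is
    active.\<close>
  define \<kappa> where "\<kappa> = Min (insert 1 (a ` active g zs))"
  have \<kappa>: "0 < \<kappa>" using y by (auto simp: \<kappa>_def a_def)
  have \<kappa>a: "\<kappa> \<le> a i" if "i \<in> active g zs" for i using that by (auto simp: \<kappa>_def)
  have "norm l \<le> \<bar>grad \<phi> zs \<bullet> y\<bar> / \<kappa>" if l: "l \<in> multipliers \<phi> g zs" for l
  proof -
    have "(grad \<phi> zs + (\<Sum>i\<in>UNIV. l $ i *\<^sub>R grad (\<lambda>y. g y $ i) zs)) \<bullet> y = 0"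
      using multipliersD(1)[OF l] by (simp add: regular_lagr_z[OF reg])
    then have "(\<Sum>i\<in>UNIV. l $ i * a i) = grad \<phi> zs \<bullet> y"
      by (simp add: inner_add_left inner_sum_left a_def sum_negf)
    moreover have "(\<Sum>i\<in>UNIV. l $ i * \<kappa>) \<le> (\<Sum>i\<in>UNIV. l $ i * a i)"
    proof (intro sum_mono)
      fix i show "l $ i * \<kappa> \<le> l $ i * a i"
        using multipliersD(2)[OF l, of i] multipliersD(5)[OF l, of i] \<kappa>a[of i]
        by (cases "i \<in> active g zs") (auto intro: mult_left_mono)
    qed
    moreover have "norm l \<le> (\<Sum>i\<in>UNIV. l $ i)"
      using norm_le_l1_cart[of l] multipliersD(2)[OF l] by simp
    then have "norm l * \<kappa> \<le> (\<Sum>i\<in>UNIV. l $ i * \<kappa>)"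
      using \<kappa> by (simp add: mult_right_mono flip: sum_distrib_right)
    ultimately have "norm l * \<kappa> \<le> \<bar>grad \<phi> zs \<bullet> y\<bar>" by linarith
    then show ?thesis using \<kappa> by (simp add: field_simps)
  qed
  then show ?thesis
    by (intro exI[of _ "max 1 (\<bar>grad \<phi> zs \<bullet> y\<bar> / \<kappa>)"]) (auto simp: le_max_iff_disj)
qed

text \<open>Strict complementarity turns the critical cone into the null space of the active gradients.\<close>

lemma regular_coercive:
  fixes g :: "real^'n \<Rightarrow> real^'m"
  assumes reg: "regular_solution \<phi> g zs"
  shows "\<exists>\<xi>>0. \<forall>l\<in>multipliers \<phi> g zs. \<forall>w.
    transpose (cols (active g zs) (nabla g zs)) *v w = 0 \<longrightarrow>
    \<xi> * (norm w)\<^sup>2 \<le> w \<bullet> (lagr_zz \<phi> g zs l *v w)"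
proof -
  have "active_pos \<phi> g zs = active g zs"
    using reg by (auto simp: regular_solution_def strict_compl_def active_pos_def)
  moreover have "grad (\<lambda>x. g x $ i) zs \<bullet> w = 0"
    if "transpose (cols (active g zs) (nabla g zs)) *v w = 0" "i \<in> active g zs" for i w
  proof -
    have "(transpose (cols (active g zs) (nabla g zs)) *v w) $ i = 0" using that(1) by simp
    then show ?thesis using that(2) by (simp add: transpose_cols_mult transpose_nabla_mult)
  qed
  moreover obtain \<xi> where "\<xi> > 0" "\<And>l w. l \<in> multipliers \<phi> g zs \<Longrightarrow>
      (\<forall>i \<in> active_pos \<phi> g zs. grad (\<lambda>x. g x $ i) zs \<bullet> w = 0) \<and>
        (\<forall>i \<in> active g zs - active_pos \<phi> g zs. grad (\<lambda>x. g x $ i) zs \<bullet> w \<le> 0) \<Longrightarrow>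
      \<xi> * (norm w)\<^sup>2 \<le> w \<bullet> (lagr_zz \<phi> g zs l *v w)"
    using reg unfolding regular_solution_def second_order_def by meson
  ultimately show ?thesis
    by (intro exI[of _ \<xi>]) auto
qed

lemma near_solution:
  fixes g :: "real^'n \<Rightarrow> real^'m"
  assumes reg: "regular_solution \<phi> g zs"
  shows "\<exists>M\<ge>1. \<forall>\<kappa>>0. \<exists>\<epsilon>>0. \<forall>z l. delta_dist \<phi> g zs z l \<le> \<epsilon> \<longrightarrow>
    norm (z - zs) \<le> \<kappa> \<and> (\<exists>ls\<in>multipliers \<phi> g zs. norm (l - ls) \<le> \<kappa>) \<and>
    expansion_bounds \<phi> zs M \<kappa> z \<and> (\<forall>i. expansion_bounds (\<lambda>y. g y $ i) zs M \<kappa> z)"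
proof -
  have "twice_lipschitz_diff \<phi>" "\<And>i. twice_lipschitz_diff (\<lambda>z. g z $ i)" and ne: "multipliers \<phi> g zs \<noteq> {}"
    using reg by (auto simp: regular_solution_def)
  from eventually_expansion_bounds_all[where a = zs, OF this(1,2)]
  obtain M where M: "M \<ge> 1" and ex: "\<forall>\<kappa>>0. \<exists>r>0. \<forall>z. norm (z - zs) \<le> r \<longrightarrow>
     expansion_bounds \<phi> zs M \<kappa> z \<and> (\<forall>i. expansion_bounds (\<lambda>z. g z $ i) zs M \<kappa> z)"
    by blast
  have "\<exists>\<epsilon>>0. \<forall>z l. delta_dist \<phi> g zs z l \<le> \<epsilon> \<longrightarrow>
    norm (z - zs) \<le> \<kappa> \<and> (\<exists>ls\<in>multipliers \<phi> g zs. norm (l - ls) \<le> \<kappa>) \<and>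
    expansion_bounds \<phi> zs M \<kappa> z \<and> (\<forall>i. expansion_bounds (\<lambda>y. g y $ i) zs M \<kappa> z)"
    if \<kappa>: "\<kappa> > 0" for \<kappa>
  proof -
    obtain r where r: "r > 0" "\<forall>z. norm (z - zs) \<le> r \<longrightarrow>
     expansion_bounds \<phi> zs M \<kappa> z \<and> (\<forall>i. expansion_bounds (\<lambda>z. g z $ i) zs M \<kappa> z)"
      using ex \<kappa> by blast
    \<comment> \<open>No minimiser of the distance is needed: the halving leaves room for a point of
      the solution set at distance below \<open>2 * \<epsilon>\<close>.\<close>
    define \<epsilon> where "\<epsilon> = min \<kappa> r / 2"
    have \<epsilon>: "\<epsilon> > 0" using r \<kappa> by (simp add: \<epsilon>_def)
    have "norm (z - zs) \<le> min \<kappa> r \<and> (\<exists>ls\<in>multipliers \<phi> g zs. norm (l - ls) \<le> \<kappa>)"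
      if "delta_dist \<phi> g zs z l \<le> \<epsilon>" for z l
    proof -
      have "infdist (z, l) ({zs} \<times> multipliers \<phi> g zs) < 2 * \<epsilon>"
        using that \<epsilon> by (simp add: delta_dist_def)
      moreover have "{zs} \<times> multipliers \<phi> g zs \<noteq> {}" using ne by auto
      ultimately obtain q where q: "q \<in> {zs} \<times> multipliers \<phi> g zs" and dq: "dist (z, l) q < 2 * \<epsilon>"
        unfolding infdist_notempty[OF \<open>{zs} \<times> multipliers \<phi> g zs \<noteq> {}\<close>]
        by (subst (asm) cINF_less_iff) auto
      obtain ls where ls: "ls \<in> multipliers \<phi> g zs" "q = (zs, ls)" using q by auto
      have "dist z zs \<le> dist (z, l) q" "dist l ls \<le> dist (z, l) q"
        using dist_fst_le[of "(z,l)" q] dist_snd_le[of "(z,l)" q] ls by simp_all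
      then show ?thesis using dq ls by (auto simp: \<epsilon>_def dist_norm intro!: bexI[of _ ls])
    qed
    then show ?thesis using \<epsilon> r(2) by (intro exI[of _ \<epsilon>]) auto
  qed
  then show ?thesis using M by blast
qed

text \<open>One margin serves both kinds of index. The factor 2 lets an inactive constraint rise by
  \<open>\<sigma>\<close> when \<open>z\<close> moves away from \<open>zs\<close> and still stay
  below \<open>- \<sigma>\<close>.\<close>

lemma strict_complementarity_gap:
  fixes g :: "real^'n \<Rightarrow> real^'m"
  assumes reg: "regular_solution \<phi> g zs"
  obtains lb \<sigma> where "lb \<in> multipliers \<phi> g zs" "0 < \<sigma>" "\<And>i. i \<in> active g zs \<Longrightarrow> \<sigma> \<le> lb $ i"
    "\<And>i. i \<notin> active g zs \<Longrightarrow> g zs $ i \<le> - (2 * \<sigma>)"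
proof -
  obtain lb where lb: "lb \<in> multipliers \<phi> g zs" "\<And>i. i \<in> active g zs \<Longrightarrow> 0 < lb $ i"
    using reg by (auto simp: regular_solution_def strict_compl_def)
  define h where "h i = (if i \<in> active g zs then lb $ i else - (g zs $ i) / 2)" for i
  have h: "0 < h i" for i
    using lb multipliersD(3)[OF lb(1), of i] by (auto simp: h_def active_def less_le)
  define \<sigma> where "\<sigma> = Min (range h)"
  have "0 < \<sigma>" using h by (auto simp: \<sigma>_def)
  moreover have \<sigma>: "\<sigma> \<le> h i" for i by (simp add: \<sigma>_def)
  moreover have "i \<in> active g zs \<Longrightarrow> \<sigma> \<le> lb $ i" for i using \<sigma>[of i] by (simp add: h_def)
  moreover have "i \<notin> active g zs \<Longrightarrow> g zs $ i \<le> - (2 * \<sigma>)" for i using \<sigma>[of i] by (simp add: h_def)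
  ultimately show ?thesis using that lb by blast
qed

section \<open>Position of the iterate relative to the solution\<close>

lemma norm_matrix_le_entries:
  fixes A :: "real^'k^'j"
  assumes "\<And>i j. \<bar>A $ i $ j\<bar> \<le> b"
  shows "norm A \<le> real CARD('j) * real CARD('k) * b"
proof -
  have "norm A \<le> (\<Sum>i\<in>UNIV. norm (A $ i))"
    by (simp add: norm_vec_def L2_set_le_sum)
  also have "\<dots> \<le> (\<Sum>i\<in>(UNIV::'j set). \<Sum>j\<in>(UNIV::'k set). b)"
    using assms by (intro sum_mono order_trans[OF norm_le_l1_cart]) auto
  finally show ?thesis by simp
qed

lemma good_iterate_pos:
  assumes "good_iterate \<phi> g C \<gamma> z l s"
  shows "0 < dual_gap l s" "0 < l $ i" "0 < s $ i"
    "l $ i * s $ i \<le> real CARD('m::finite) * dual_gap l (s::real^'m)"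
proof -
  have p: "0 < l $ i \<and> 0 < s $ i" for i using assms by (simp add: good_iterate_def)
  have "0 < l \<bullet> s" unfolding inner_vec_def using p by (intro sum_pos) auto
  then show "0 < dual_gap l s" by (simp add: dual_gap_def)
  show "0 < l $ i" "0 < s $ i" using p by auto
  have "l $ i * s $ i \<le> l \<bullet> s"
    unfolding inner_vec_def inner_real_def using p
    by (intro member_le_sum[of i UNIV "\<lambda>i. l $ i * s $ i"]) (auto simp: less_imp_le)
  then show "l $ i * s $ i \<le> real CARD('m) * dual_gap l s" by (simp add: dual_gap_def)
qed

lemma norm_sum_scaleR_le:
  fixes x :: "'m::finite \<Rightarrow> 'a::real_normed_vector"
  assumes "\<And>i. \<bar>a i\<bar> * norm (x i) \<le> b"
  shows "norm (\<Sum>i\<in>UNIV. a i *\<^sub>R x i) \<le> real CARD('m) * b"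
  using sum_norm_bound[of UNIV "\<lambda>i. a i *\<^sub>R x i" b] assms by simp

text \<open>
  Testing the gradient of the Lagrangian with \<open>z - zs\<close> against a strictly complementary
  multiplier bounds the active slacks by \<open>\<mu> + \<parallel>z - zs\<parallel>\<^sup>2\<close>; testing it with the component of
  \<open>z - zs\<close> in the null space of the active gradients, against the multiplier nearest to \<open>l\<close>,
  then bounds \<open>z - zs\<close> by \<open>\<mu>\<close>.
\<close>

lemma iterate_distance:
  fixes g :: "real^'n \<Rightarrow> real^'m"
  assumes reg: "regular_solution \<phi> g zs" and C: "0 < C" and M: "1 \<le> M"
  shows "\<exists>k\<ge>1. \<exists>\<sigma>>0. \<exists>\<kappa>>0. \<forall>z l s ls. good_iterate \<phi> g C \<gamma> z l s \<longrightarrow> norm (z - zs) \<le> \<kappa> \<longrightarrow>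
    ls \<in> multipliers \<phi> g zs \<longrightarrow> norm (l - ls) \<le> \<kappa> \<longrightarrow> expansion_bounds \<phi> zs M \<kappa> z \<longrightarrow>
    (\<forall>i. expansion_bounds (\<lambda>y. g y $ i) zs M \<kappa> z) \<longrightarrow> dual_gap l s \<le> \<kappa> \<longrightarrow>
    norm (z - zs) \<le> k * dual_gap l s \<and> (\<forall>i\<in>active g zs. s $ i \<le> k * dual_gap l s) \<and>
    (\<forall>i. i \<notin> active g zs \<longrightarrow> \<sigma> \<le> s $ i \<and> l $ i \<le> k * dual_gap l s)"
proof -
  define B where "B = active g zs"
  define m where "m = real CARD('m)"
  define A\<^sub>0 where "A\<^sub>0 = cols B (nabla g zs)"
  obtain lb \<sigma> where lb: "lb \<in> multipliers \<phi> g zs" and \<sigma>: "0 < \<sigma>" and lb\<sigma>: "\<And>i. i \<in> B \<Longrightarrow> \<sigma> \<le> lb $ i"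
    and g\<sigma>: "\<And>i. i \<notin> B \<Longrightarrow> g zs $ i \<le> - (2 * \<sigma>)"
    using strict_complementarity_gap[OF reg] unfolding B_def by metis
  obtain \<Lambda> where \<Lambda>: "1 \<le> \<Lambda>" "\<And>l. l \<in> multipliers \<phi> g zs \<Longrightarrow> norm l \<le> \<Lambda>"
    using multipliers_bounded[OF reg] by blast
  obtain \<xi> where \<xi>: "\<xi> > 0" "\<And>l w. l \<in> multipliers \<phi> g zs \<Longrightarrow> transpose A\<^sub>0 *v w = 0 \<Longrightarrow>
      \<xi> * (norm w)\<^sup>2 \<le> w \<bullet> (lagr_zz \<phi> g zs l *v w)"
    using regular_coercive[OF reg] unfolding A\<^sub>0_def B_def by blast
  obtain c0 where c0: "c0 > 0" "\<And>y. c0 * norm (A\<^sub>0 *v y) \<le> norm (transpose A\<^sub>0 *v (A\<^sub>0 *v y))"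
    using transpose_bounded_below_on_range[of A\<^sub>0] by blast
  define k1 where "k1 = 1 + m * \<Lambda>"
  define k2 where "k2 = 2 * \<Lambda> + 1"
  define k3 where "k3 = C + m + m * (k2 * (C + 2 * M)) + k1 * M + k1"
  define k4 where "k4 = k3 / \<sigma>"
  define k5 where "k5 = k4 + C + M"
  define k6 where "k6 = m * k5 / c0"
  define k7 where "k7 = 2 * m / \<sigma>"
  define k8 where "k8 = C + k1 * M + k1 + m * (M + 2 * M * k7)"
  define k9 where "k9 = k8 / \<xi> + (k8 / \<xi> + 1) * k6"
  define k10 where "k10 = 2 * k9"
  define k where "k = 1 + k10 + k4 * (1 + k10) + k7"
  \<comment> \<open>The two middle entries keep the inactive slacks above
    \<open>\<sigma> / 2\<close>; the last one makes \<open>k9 * \<kappa>\<close> small enough to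
    absorb the distance \<open>d\<close> at the end.\<close>
  define \<kappa> where "\<kappa> = Min {1, \<sigma> / (2 * M), \<sigma> / (2 * C), 1 / (4 * k9)}"
  have m: "1 \<le> m" by (simp add: m_def)
  have m0: "0 < m" and M0: "0 < M" and L0: "0 < \<Lambda>" using m M \<Lambda> by auto
  have p: "0 < k1" "0 < k2" using m0 L0 by (simp_all add: k1_def k2_def add_pos_pos)
  then have p3: "0 < k3" using C m0 M0 by (simp add: k3_def add_pos_pos)
  then have p4: "0 < k4" using \<sigma> by (simp add: k4_def)
  then have p5: "0 < k5" using C M0 by (simp add: k5_def)
  then have p6: "0 < k6" using m0 c0 by (simp add: k6_def)
  have p7: "0 < k7" using m0 \<sigma> by (simp add: k7_def)
  then have p8: "0 < k8" using C p m0 M0 by (simp add: k8_def add_pos_pos)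
  then have p9: "0 < k9" using \<xi> p6 by (simp add: k9_def add_pos_pos)
  then have p10: "0 < k10" by (simp add: k10_def)
  have kk: "1 \<le> k" "k10 \<le> k" "k4 * (1 + k10) \<le> k" "k7 \<le> k"
    using p4 p7 p10 by (simp_all add: k_def add_increasing add_increasing2)
  have \<kappa>0: "0 < \<kappa>" using \<sigma> M0 C p9 by (simp add: \<kappa>_def)
  have \<kappa>: "\<kappa> \<le> 1" "\<kappa> \<le> \<sigma> / (2 * M)" "\<kappa> \<le> \<sigma> / (2 * C)" "\<kappa> \<le> 1 / (4 * k9)"
    by (simp_all add: \<kappa>_def)
  have main: "norm (z - zs) \<le> k * dual_gap l s \<and> (\<forall>i\<in>B. s $ i \<le> k * dual_gap l s) \<and>
    (\<forall>i. i \<notin> B \<longrightarrow> \<sigma> / 2 \<le> s $ i \<and> l $ i \<le> k * dual_gap l s)"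
    if gi: "good_iterate \<phi> g C \<gamma> z l s" and d\<kappa>: "norm (z - zs) \<le> \<kappa>" and ls: "ls \<in> multipliers \<phi> g zs"
      and l\<kappa>: "norm (l - ls) \<le> \<kappa>" and ex\<phi>: "expansion_bounds \<phi> zs M \<kappa> z"
      and exg: "\<And>i. expansion_bounds (\<lambda>y. g y $ i) zs M \<kappa> z" and mu\<kappa>: "dual_gap l s \<le> \<kappa>"
    for z l s ls
  proof -
    define \<mu> where "\<mu> = dual_gap l s"
    define v where "v = z - zs"
    define d where "d = norm v"
    have mu: "0 < \<mu>" "\<mu> \<le> 1" "\<mu> \<le> \<kappa>" using good_iterate_pos(1)[OF gi] mu\<kappa> \<kappa> by (auto simp: \<mu>_def)
    have lpos: "0 < l $ i" and spos: "0 < s $ i" and lsm: "l $ i * s $ i \<le> m * \<mu>" for i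
      using good_iterate_pos[OF gi] by (auto simp: \<mu>_def m_def)
    have d: "0 \<le> d" "d \<le> \<kappa>" "d \<le> 1" using d\<kappa> \<kappa> by (auto simp: d_def v_def)
    have d2: "d\<^sup>2 \<le> \<kappa> * d" "d\<^sup>2 \<le> d"
      using d by (auto simp: power2_eq_square mult_left_le_one_le mult_right_mono)
    have Lz: "norm (lagr_z \<phi> g z l) \<le> C * \<mu>" and gs: "norm (g z + s) \<le> C * \<mu>"
      using gi by (auto simp: good_iterate_def \<mu>_def)
    have gsi: "\<bar>g z $ i + s $ i\<bar> \<le> C * \<mu>" for i
      using component_le_norm_cart[of "g z + s" i] gs by simp
    have lsb: "\<bar>l' $ i\<bar> \<le> \<Lambda>" if "l' \<in> multipliers \<phi> g zs" for l' i
      using component_le_norm_cart[of l' i] \<Lambda>(2)[OF that] by simp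
    have pi: "\<bar>(l - ls) $ i\<bar> \<le> \<kappa>" for i using component_le_norm_cart[of "l - ls" i] l\<kappa> by simp
    note e\<phi> = ex\<phi>[unfolded expansion_bounds_def, folded v_def d_def]
    note eg = exg[unfolded expansion_bounds_def, folded v_def d_def]
    let ?G = "\<lambda>i. grad (\<lambda>y. g y $ i)"
    let ?H = "\<lambda>i. hess (\<lambda>y. g y $ i)"

    \<comment> \<open>Inactive constraints stay negative near \<open>zs\<close>, so their slacks
      stay away from zero, and the bound \<open>m * \<mu>\<close> on the products makes their
      multipliers O(\<mu>).\<close>
    have sN: "\<sigma> / 2 \<le> s $ i" and lN: "l $ i \<le> k7 * \<mu>" if i: "i \<notin> B" for i
    proof -
      have "\<bar>?G i zs \<bullet> v\<bar> \<le> M * d"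
        using Cauchy_Schwarz_ineq2[of "?G i zs" v] eg[of i] mult_right_mono[of "norm (?G i zs)" M d] d
        by (auto simp: d_def)
      moreover have "M * d\<^sup>2 \<le> M * d" using d2 M0 by simp
      moreover have "M * d \<le> \<sigma> / 2"
        using mult_left_mono[OF order_trans[OF d(2) \<kappa>(2)], of M] M0 by simp
      ultimately have "g z $ i \<le> - \<sigma>" using eg[of i] g\<sigma>[OF i] by linarith
      moreover have "C * \<mu> \<le> \<sigma> / 2"
        using mult_left_mono[OF order_trans[OF mu(3) \<kappa>(3)], of C] C by simp
      ultimately show s: "\<sigma> / 2 \<le> s $ i" using gsi[of i] by linarith
      have "l $ i * (\<sigma> / 2) \<le> m * \<mu>"
        using lsm[of i] mult_left_mono[OF s less_imp_le[OF lpos[of i]]] by linarith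
      then show "l $ i \<le> k7 * \<mu>" using \<sigma> by (simp add: k7_def field_simps)
    qed

    \<comment> \<open>\<open>R l'\<close> is the remainder in linearising the gradient of the
      Lagrangian at \<open>zs\<close> with multiplier \<open>l'\<close>. The resulting expansion
      holds for every KKT multiplier; it is used with \<open>lb\<close> for the slacks and with
      \<open>ls\<close> for the kernel component of \<open>v\<close>.\<close>
    define R where "R l' = (grad \<phi> z - grad \<phi> zs - hess \<phi> zs *v v) +
        (\<Sum>i\<in>UNIV. l' $ i *\<^sub>R (?G i z - ?G i zs - ?H i zs *v v))" for l'
    have R: "norm (R l') \<le> k1 * \<kappa> * d" if l': "l' \<in> multipliers \<phi> g zs" for l'
    proof -
      have "norm (\<Sum>i\<in>UNIV. l' $ i *\<^sub>R (?G i z - ?G i zs - ?H i zs *v v)) \<le> m * (\<Lambda> * (\<kappa> * d))"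
        unfolding m_def using lsb[OF l'] eg L0 by (intro norm_sum_scaleR_le mult_mono) auto
      then have "norm (R l') \<le> \<kappa> * d + m * (\<Lambda> * (\<kappa> * d))"
        unfolding R_def using e\<phi> by (intro order_trans[OF norm_triangle_ineq]) auto
      then show ?thesis by (simp add: k1_def algebra_simps)
    qed
    have Lid: "lagr_z \<phi> g z l = lagr_zz \<phi> g zs l' *v v + R l' + (\<Sum>i\<in>UNIV. (l - l') $ i *\<^sub>R ?G i z)"
      if l': "l' \<in> multipliers \<phi> g zs" for l'
    proof -
      have "grad \<phi> zs + (\<Sum>i\<in>UNIV. l' $ i *\<^sub>R ?G i zs) = 0"
        using multipliersD(1)[OF l'] by (simp add: regular_lagr_z[OF reg])
      then have e: "grad \<phi> zs = - (\<Sum>i\<in>UNIV. l' $ i *\<^sub>R ?G i zs)"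
        by (simp add: eq_neg_iff_add_eq_0)
      show ?thesis
        unfolding regular_lagr_z[OF reg] regular_lagr_zz[OF reg] R_def e
        by (simp add: matrix_vector_mult_add_rdistrib sum_scaleR_matrix_vector
            scaleR_diff_right scaleR_diff_left sum_subtractf sum.distrib)
    qed
    have Hzs: "norm (lagr_zz \<phi> g zs l') \<le> k1 * M" if l': "l' \<in> multipliers \<phi> g zs" for l'
    proof -
      have "norm (\<Sum>i\<in>UNIV. l' $ i *\<^sub>R ?H i zs) \<le> m * (\<Lambda> * M)"
        unfolding m_def using lsb[OF l'] eg L0 by (intro norm_sum_scaleR_le mult_mono) auto
      then have "norm (lagr_zz \<phi> g zs l') \<le> M + m * (\<Lambda> * M)"
        unfolding regular_lagr_zz[OF reg] using e\<phi> by (intro order_trans[OF norm_triangle_ineq]) auto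
      then show ?thesis by (simp add: k1_def algebra_simps)
    qed

    have sB: "s $ i \<le> k4 * (\<mu> + d\<^sup>2)" if i: "i \<in> B" for i
    proof -
      define q where "q = l - lb"
      have q: "\<bar>q $ i\<bar> \<le> k2" for i
        using lsb[OF lb, of i] lsb[OF ls, of i] pi[of i] \<kappa> by (simp add: q_def k2_def)
      \<comment> \<open>\<open>e i\<close> is the error of replacing
        \<open>?G i z \<bullet> v\<close> by \<open>- s $ i - g zs $ i\<close>: the constraint
        residual plus a linearisation error.\<close>
      define e where "e i = (g z $ i + s $ i) + (?G i z \<bullet> v - g z $ i + g zs $ i)" for i
      have e: "\<bar>e i\<bar> \<le> C * \<mu> + 2 * M * d\<^sup>2" for i
      proof -
        have "\<bar>(?G i z - ?G i zs) \<bullet> v\<bar> \<le> (M * d) * d"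
          using eg[of i] by (intro order_trans[OF Cauchy_Schwarz_ineq2]) (auto simp: d_def intro: mult_right_mono)
        then have "\<bar>?G i z \<bullet> v - ?G i zs \<bullet> v\<bar> \<le> M * d\<^sup>2"
          by (simp add: inner_diff_left power2_eq_square mult.assoc)
        moreover have "\<bar>g z $ i - g zs $ i - ?G i zs \<bullet> v\<bar> \<le> M * d\<^sup>2" using eg[of i] by simp
        ultimately show ?thesis using gsi[of i] unfolding e_def by linarith
      qed
      have ip: "(\<Sum>i\<in>UNIV. q $ i *\<^sub>R ?G i z) \<bullet> v
          = - (l \<bullet> s) + lb \<bullet> s - l \<bullet> g zs + (\<Sum>i\<in>UNIV. q $ i * e i)"
      proof -
        have "(\<Sum>i\<in>UNIV. q $ i *\<^sub>R ?G i z) \<bullet> v = (\<Sum>i\<in>UNIV. q $ i * (e i - s $ i - g zs $ i))"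
          by (simp add: inner_sum_left e_def)
        also have "\<dots> = (\<Sum>i\<in>UNIV. q $ i * e i) - q \<bullet> s - q \<bullet> g zs"
          by (simp add: inner_vec_def sum_subtractf sum.distrib algebra_simps)
        finally show ?thesis using multipliersD(4)[OF lb] by (simp add: q_def inner_diff_left)
      qed
      have "l $ j * g zs $ j \<le> 0" for j
        using lpos[of j] multipliersD(3)[OF lb, of j] by (simp add: mult_nonneg_nonpos less_imp_le)
      then have lg: "l \<bullet> g zs \<le> 0" unfolding inner_vec_def by (auto intro!: sum_nonpos)
      have qe: "\<bar>\<Sum>i\<in>UNIV. q $ i * e i\<bar> \<le> m * (k2 * (C * \<mu> + 2 * M * d\<^sup>2))"
      proof -
        have "\<bar>q $ i\<bar> * norm (e i) \<le> k2 * (C * \<mu> + 2 * M * d\<^sup>2)" for i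
          using q[of i] e[of i] p by (intro mult_mono) auto
        then show ?thesis using norm_sum_scaleR_le[of "\<lambda>i. q $ i" e] by (simp add: m_def)
      qed
      have ls: "l \<bullet> s = m * \<mu>" by (simp add: \<mu>_def m_def dual_gap_def)
      have vL: "\<bar>lagr_z \<phi> g z l \<bullet> v\<bar> \<le> C * \<mu>"
      proof -
        have "\<bar>lagr_z \<phi> g z l \<bullet> v\<bar> \<le> (C * \<mu>) * d"
          using Lz by (intro order_trans[OF Cauchy_Schwarz_ineq2]) (auto simp: d_def intro: mult_right_mono)
        also have "\<dots> \<le> C * \<mu>" using d C mu by (intro mult_left_le) auto
        finally show ?thesis .
      qed
      have vH: "\<bar>(lagr_zz \<phi> g zs lb *v v) \<bullet> v\<bar> \<le> k1 * M * d\<^sup>2"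
      proof -
        have "\<bar>(lagr_zz \<phi> g zs lb *v v) \<bullet> v\<bar> \<le> (norm (lagr_zz \<phi> g zs lb) * d) * d"
          using norm_matrix_vector_le[of "lagr_zz \<phi> g zs lb" v]
          by (intro order_trans[OF Cauchy_Schwarz_ineq2]) (auto simp: d_def intro: mult_right_mono)
        also have "\<dots> \<le> (k1 * M * d) * d" using Hzs[OF lb] d by (intro mult_right_mono) auto
        finally show ?thesis by (simp add: power2_eq_square mult.assoc)
      qed
      have vR: "\<bar>R lb \<bullet> v\<bar> \<le> k1 * d\<^sup>2"
      proof -
        have "\<bar>R lb \<bullet> v\<bar> \<le> (k1 * \<kappa> * d) * d"
          using R[OF lb] by (intro order_trans[OF Cauchy_Schwarz_ineq2]) (auto simp: d_def intro: mult_right_mono)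
        also have "\<dots> \<le> (k1 * 1 * d) * d" using \<kappa> d p by (intro mult_right_mono mult_left_mono) auto
        finally show ?thesis by (simp add: power2_eq_square mult.assoc)
      qed
      have "lagr_z \<phi> g z l \<bullet> v = (lagr_zz \<phi> g zs lb *v v) \<bullet> v + R lb \<bullet> v + (\<Sum>i\<in>UNIV. q $ i *\<^sub>R ?G i z) \<bullet> v"
        unfolding Lid[OF lb] q_def by (simp only: inner_add_left)
      then have "lb \<bullet> s \<le> C * \<mu> + k1 * M * d\<^sup>2 + k1 * d\<^sup>2 + m * \<mu> + m * (k2 * (C * \<mu> + 2 * M * d\<^sup>2))"
        using vL vH vR qe lg ls ip by linarith
      also have "\<dots> = (C + m + m * k2 * C) * \<mu> + (k1 * M + k1 + m * k2 * 2 * M) * d\<^sup>2"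
        by (simp add: algebra_simps)
      also have "\<dots> \<le> k3 * \<mu> + k3 * d\<^sup>2"
        using p m0 M0 C mu by (intro add_mono mult_right_mono) (auto simp: k3_def algebra_simps)
      finally have lbs: "lb \<bullet> s \<le> k3 * (\<mu> + d\<^sup>2)" by (simp add: algebra_simps)
      \<comment> \<open>All summands of \<open>lb \<bullet> s\<close> are nonnegative, so the bound
        on the sum bounds each active slack.\<close>
      have "\<sigma> * s $ i \<le> lb $ i * s $ i"
        using lb\<sigma>[OF i] spos[of i] by (simp add: mult_right_mono less_imp_le)
      also have "\<dots> \<le> lb \<bullet> s"
        unfolding inner_vec_def inner_real_def using multipliersD(2)[OF lb] spos
        by (intro member_le_sum[of i UNIV "\<lambda>i. lb $ i * s $ i"]) (auto simp: less_imp_le)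
      finally have "\<sigma> * s $ i \<le> k3 * (\<mu> + d\<^sup>2)" using lbs by simp
      then show ?thesis using \<sigma> by (simp add: k4_def field_simps)
    qed

    \<comment> \<open>Active constraints vanish at \<open>zs\<close>, so the slack bound controls
      their linearisations along \<open>v\<close> from both sides, and with them the range component
      of \<open>v\<close>.\<close>
    have A0v: "norm (transpose A\<^sub>0 *v v) \<le> m * (k5 * (\<mu> + d\<^sup>2))"
      unfolding A\<^sub>0_def transpose_cols_mult m_def
    proof (rule norm_restr_bound)
      show "0 \<le> k5 * (\<mu> + d\<^sup>2)" using p5 mu by simp
      fix i assume i: "i \<in> B"
      then have "g zs $ i = 0" by (simp add: B_def active_def)
      then have "\<bar>?G i zs \<bullet> v\<bar> \<le> s $ i + C * \<mu> + M * d\<^sup>2"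
        using eg[of i] gsi[of i] spos[of i] by linarith
      also have "\<dots> \<le> k4 * (\<mu> + d\<^sup>2) + C * (\<mu> + d\<^sup>2) + M * (\<mu> + d\<^sup>2)"
        using sB[OF i] C M0 mu by (intro add_mono mult_left_mono) auto
      finally show "\<bar>(transpose (nabla g zs) *v v) $ i\<bar> \<le> k5 * (\<mu> + d\<^sup>2)"
        by (simp add: transpose_nabla_mult k5_def algebra_simps)
    qed
    obtain y w where vy: "v = A\<^sub>0 *v y + w" and w: "transpose A\<^sub>0 *v w = 0"
      using range_kernel_decomposition[of v A\<^sub>0] by metis
    define r where "r = A\<^sub>0 *v y"
    have vrw: "v = r + w" by (simp add: r_def vy)
    have r: "norm r \<le> k6 * (\<mu> + d\<^sup>2)"
    proof -
      have "transpose A\<^sub>0 *v v = transpose A\<^sub>0 *v r"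
        by (simp only: vrw w matrix_vector_right_distrib add_0_right)
      then have "c0 * norm r \<le> m * (k5 * (\<mu> + d\<^sup>2))" using c0(2)[of y] A0v by (simp add: r_def)
      then show ?thesis using c0 by (simp add: k6_def field_simps)
    qed
    have wG: "w \<bullet> ?G i zs = 0" if "i \<in> B" for i
    proof -
      have "(transpose A\<^sub>0 *v w) $ i = 0" using w by simp
      then show ?thesis using that by (simp add: A\<^sub>0_def transpose_cols_mult transpose_nabla_mult inner_commute)
    qed
    have w\<xi>: "\<xi> * norm w \<le> k8 * (\<mu> + norm r + \<kappa> * d)"
    proof -
      define T where "T = (\<Sum>i\<in>UNIV. (l - ls) $ i *\<^sub>R ?G i z)"
      \<comment> \<open>Since \<open>w\<close> is orthogonal to the active gradients at
        \<open>zs\<close>, an active index contributes a gradient difference times a multiplier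
        deviation, of order \<open>\<kappa> * d\<close>. At an inactive index \<open>ls $ i\<close>
        vanishes and \<open>l $ i\<close> is O(\<mu>).\<close>
      have wT: "\<bar>w \<bullet> T\<bar> \<le> m * (norm w * (\<kappa> * (M * d) + 2 * M * k7 * \<mu>))"
      proof -
        have "\<bar>(l - ls) $ i\<bar> * norm (w \<bullet> ?G i z) \<le> norm w * (\<kappa> * (M * d) + 2 * M * k7 * \<mu>)" for i
        proof (cases "i \<in> B")
          case True
          have "\<bar>w \<bullet> ?G i z\<bar> = \<bar>w \<bullet> (?G i z - ?G i zs)\<bar>" using wG[OF True] by (simp add: inner_diff_right)
          also have "\<dots> \<le> norm w * (M * d)"
            using eg[of i] by (intro order_trans[OF Cauchy_Schwarz_ineq2] mult_left_mono) auto
          finally have "\<bar>(l - ls) $ i\<bar> * norm (w \<bullet> ?G i z) \<le> \<kappa> * (norm w * (M * d))"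
            using pi[of i] \<kappa>0 by (intro mult_mono) auto
          moreover have "0 \<le> norm w * (2 * M * k7 * \<mu>)" using M0 p7 mu by simp
          ultimately show ?thesis by (simp add: algebra_simps)
        next
          case False
          then have "ls $ i = 0" using multipliersD(5)[OF ls, of i] by (simp add: B_def)
          then have a: "\<bar>(l - ls) $ i\<bar> \<le> k7 * \<mu>" using lN[OF False] lpos[of i] by simp
          have "norm (?G i z) \<le> norm (?G i z - ?G i zs) + norm (?G i zs)"
            by (metis diff_add_cancel norm_triangle_ineq)
          also have "\<dots> \<le> M * d + M" using eg[of i] by (intro add_mono) auto
          also have "\<dots> \<le> 2 * M" using d M0 mult_left_le[of d M] by simp
          finally have "norm (w \<bullet> ?G i z) \<le> norm w * (2 * M)"
            unfolding real_norm_def by (intro order_trans[OF Cauchy_Schwarz_ineq2] mult_left_mono) auto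
          then have "\<bar>(l - ls) $ i\<bar> * norm (w \<bullet> ?G i z) \<le> (k7 * \<mu>) * (norm w * (2 * M))"
            using a p7 mu by (intro mult_mono) auto
          moreover have "0 \<le> norm w * (\<kappa> * (M * d))" using M0 \<kappa>0 d by simp
          ultimately show ?thesis by (simp add: algebra_simps)
        qed
        then show ?thesis
          using norm_sum_scaleR_le[of "\<lambda>i. (l - ls) $ i" "\<lambda>i. w \<bullet> ?G i z"]
          by (simp add: T_def inner_sum_right m_def)
      qed
      have "w \<bullet> lagr_z \<phi> g z l = w \<bullet> (lagr_zz \<phi> g zs ls *v r) + w \<bullet> (lagr_zz \<phi> g zs ls *v w) + w \<bullet> R ls + w \<bullet> T"
        unfolding Lid[OF ls] T_def[symmetric]
        by (simp only: vrw matrix_vector_right_distrib inner_add_right)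
      moreover have "\<bar>w \<bullet> lagr_z \<phi> g z l\<bar> \<le> norm w * (C * \<mu>)"
        using Lz by (intro order_trans[OF Cauchy_Schwarz_ineq2] mult_left_mono) auto
      moreover have "\<bar>w \<bullet> (lagr_zz \<phi> g zs ls *v r)\<bar> \<le> norm w * (k1 * M * norm r)"
        using norm_matrix_vector_le[of "lagr_zz \<phi> g zs ls" r] mult_right_mono[OF Hzs[OF ls], of "norm r"]
        by (intro order_trans[OF Cauchy_Schwarz_ineq2] mult_left_mono) auto
      moreover have "\<bar>w \<bullet> R ls\<bar> \<le> norm w * (k1 * \<kappa> * d)"
        using R[OF ls] by (intro order_trans[OF Cauchy_Schwarz_ineq2] mult_left_mono) auto
      ultimately have "w \<bullet> (lagr_zz \<phi> g zs ls *v w) \<le> norm w * (C * \<mu>) + norm w * (k1 * M * norm r)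
          + norm w * (k1 * \<kappa> * d) + m * (norm w * (\<kappa> * (M * d) + 2 * M * k7 * \<mu>))"
        using wT by linarith
      then have "norm w * (\<xi> * norm w) \<le>
          norm w * (C * \<mu> + k1 * M * norm r + k1 * \<kappa> * d + m * (\<kappa> * (M * d) + 2 * M * k7 * \<mu>))"
        using \<xi>(2)[OF ls w] by (simp add: power2_eq_square algebra_simps)
      then have "\<xi> * norm w \<le> \<bar>C * \<mu> + k1 * M * norm r + k1 * \<kappa> * d + m * (\<kappa> * (M * d) + 2 * M * k7 * \<mu>)\<bar>"
        by (cases "norm w = 0") (auto simp: mult_le_cancel_left)
      also have "\<dots> = C * \<mu> + k1 * M * norm r + k1 * \<kappa> * d + m * (\<kappa> * (M * d) + 2 * M * k7 * \<mu>)"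
        using C mu p M0 m0 \<kappa>0 d p7 by (intro abs_of_nonneg) simp
      also have "\<dots> = (C + m * (2 * M * k7)) * \<mu> + (k1 * M) * norm r + (k1 + m * M) * (\<kappa> * d)"
        by (simp add: algebra_simps)
      also have "\<dots> \<le> k8 * \<mu> + k8 * norm r + k8 * (\<kappa> * d)"
        using p m0 M0 C p7 mu \<kappa>0 d by (intro add_mono mult_right_mono) (auto simp: k8_def algebra_simps)
      finally show ?thesis by (simp add: algebra_simps)
    qed
    \<comment> \<open>The quadratic terms are traded for \<open>\<kappa> * d\<close>; altogether
      \<open>d\<close> then has coefficient at most 1/2 on the right and moves to the left, whence
      \<open>k10 = 2 * k9\<close>.\<close>
    have dk: "d \<le> k10 * \<mu>"
    proof -
      have "norm w \<le> (k8 / \<xi>) * (\<mu> + norm r + \<kappa> * d)"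
        using w\<xi> \<xi>(1) by (simp add: field_simps)
      moreover have "d \<le> norm r + norm w" unfolding d_def vrw by (rule norm_triangle_ineq)
      ultimately have "d \<le> (k8 / \<xi>) * (\<mu> + \<kappa> * d) + (k8 / \<xi> + 1) * norm r"
        by (simp add: algebra_simps)
      also have "\<dots> \<le> (k8 / \<xi>) * (\<mu> + \<kappa> * d) + (k8 / \<xi> + 1) * (k6 * (\<mu> + \<kappa> * d))"
      proof -
        have "k6 * (\<mu> + d\<^sup>2) \<le> k6 * (\<mu> + \<kappa> * d)" using d2 p6 by (intro mult_left_mono) auto
        then have "norm r \<le> k6 * (\<mu> + \<kappa> * d)" using r by linarith
        then show ?thesis using p8 \<xi> by (intro add_left_mono mult_left_mono) auto
      qed
      also have "\<dots> = k9 * \<mu> + (k9 * \<kappa>) * d" by (simp add: k9_def algebra_simps)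
      also have "(k9 * \<kappa>) * d \<le> (1 / 2) * d"
        using \<kappa>(4) p9 d by (intro mult_right_mono) (auto simp: field_simps)
      finally show ?thesis by (simp add: k10_def)
    qed
    have "norm (z - zs) \<le> k * \<mu>"
      using order_trans[OF dk mult_right_mono[OF kk(2)]] mu by (simp add: d_def v_def)
    moreover have "s $ i \<le> k * \<mu>" if i: "i \<in> B" for i
    proof -
      have "s $ i \<le> k4 * (\<mu> + k10 * \<mu>)"
        using sB[OF i] d2 dk p4 mult_left_mono[of "\<mu> + d\<^sup>2" "\<mu> + k10 * \<mu>" k4] by linarith
      also have "\<dots> = (k4 * (1 + k10)) * \<mu>" by (simp add: algebra_simps)
      also have "\<dots> \<le> k * \<mu>" using kk mu by (intro mult_right_mono) auto
      finally show ?thesis .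
    qed
    moreover have "l $ i \<le> k * \<mu>" if i: "i \<notin> B" for i
      using order_trans[OF lN[OF i] mult_right_mono[OF kk(4)]] mu by simp
    ultimately show ?thesis using sN by (auto simp: \<mu>_def)
  qed
  show ?thesis
    unfolding B_def[symmetric]
    using kk(1) \<kappa>0 half_gt_zero[OF \<sigma>] main by (intro exI[of _ k] conjI exI[of _ "\<sigma> / 2"] exI[of _ \<kappa>]) auto
qed

text \<open>On active indices \<open>s / l\<close> is \<open>s\<^sup>2 / (l * s)\<close>, with
  numerator O(\<open>\<mu>\<^sup>2\<close>) and denominator at least
  \<open>\<gamma> * \<mu>\<close>. On inactive indices a slack bounded below is divided by a
  multiplier O(\<mu>). The other lower bounds follow from centrality, because \<open>l\<close> and
  \<open>s\<close> are bounded.\<close>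

lemma iterate_estimates:
  fixes g :: "real^'n \<Rightarrow> real^'m"
  assumes reg: "regular_solution \<phi> g zs" and C: "0 < C" and \<gamma>: "0 < \<gamma>"
  shows "\<exists>\<xi>>0. \<exists>c>0. \<exists>M\<ge>1. \<exists>\<epsilon>>0. \<forall>z l s. good_iterate \<phi> g C \<gamma> z l s \<longrightarrow>
    delta_dist \<phi> g zs z l \<le> \<epsilon> \<longrightarrow> dual_gap l s \<le> \<epsilon> \<longrightarrow>
    block_coercive \<xi> c M (active g zs) (nabla g zs) (dual_gap l s)
      (lagr_zz \<phi> g z l) (nabla g z) (\<chi> i. s $ i / l $ i) \<and>
    (\<forall>i. c * dual_gap l s \<le> l $ i) \<and> norm s \<le> M \<and> norm (g z) \<le> M \<and>
    norm (restr (active g zs) (g z)) \<le> M * dual_gap l s"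
proof -
  define B where "B = active g zs"
  define m n where "m = real CARD('m)" and "n = real CARD('n)"
  have m: "1 \<le> m" "0 < m" and n: "1 \<le> n" "0 < n" by (simp_all add: m_def n_def)
  obtain \<Lambda> where \<Lambda>: "1 \<le> \<Lambda>" "\<And>l. l \<in> multipliers \<phi> g zs \<Longrightarrow> norm l \<le> \<Lambda>"
    using multipliers_bounded[OF reg] by blast
  obtain \<xi> where \<xi>: "\<xi> > 0" "\<And>l w. l \<in> multipliers \<phi> g zs \<Longrightarrow> transpose (cols B (nabla g zs)) *v w = 0 \<Longrightarrow>
      \<xi> * (norm w)\<^sup>2 \<le> w \<bullet> (lagr_zz \<phi> g zs l *v w)"
    using regular_coercive[OF reg] unfolding B_def by blast
  obtain M where M: "M \<ge> 1" and near: "\<And>\<kappa>. \<kappa> > 0 \<Longrightarrow> \<exists>\<epsilon>>0. \<forall>z l. delta_dist \<phi> g zs z l \<le> \<epsilon> \<longrightarrow>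
    norm (z - zs) \<le> \<kappa> \<and> (\<exists>ls\<in>multipliers \<phi> g zs. norm (l - ls) \<le> \<kappa>) \<and>
    expansion_bounds \<phi> zs M \<kappa> z \<and> (\<forall>i. expansion_bounds (\<lambda>y. g y $ i) zs M \<kappa> z)"
    using near_solution[OF reg] by blast
  obtain k \<sigma> \<kappa>1 where k: "1 \<le> k" and \<sigma>: "0 < \<sigma>" and \<kappa>1: "0 < \<kappa>1" and
    dist: "\<And>z l s ls. good_iterate \<phi> g C \<gamma> z l s \<Longrightarrow> norm (z - zs) \<le> \<kappa>1 \<Longrightarrow>
    ls \<in> multipliers \<phi> g zs \<Longrightarrow> norm (l - ls) \<le> \<kappa>1 \<Longrightarrow> expansion_bounds \<phi> zs M \<kappa>1 z \<Longrightarrow>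
    (\<And>i. expansion_bounds (\<lambda>y. g y $ i) zs M \<kappa>1 z) \<Longrightarrow> dual_gap l s \<le> \<kappa>1 \<Longrightarrow>
    norm (z - zs) \<le> k * dual_gap l s \<and> (\<forall>i\<in>B. s $ i \<le> k * dual_gap l s) \<and>
    (\<forall>i. i \<notin> B \<longrightarrow> \<sigma> \<le> s $ i \<and> l $ i \<le> k * dual_gap l s)"
    using iterate_distance[OF reg C M, where \<gamma> = \<gamma>] unfolding B_def by blast
  have M0: "0 < M" and L0: "0 < \<Lambda>" and k0: "0 < k" using M \<Lambda> k by auto
  \<comment> \<open>\<open>K * \<kappa>\<close> will bound the change of the Hessian from
    \<open>(zs, ls)\<close> to \<open>(z, l)\<close>; the choice of \<open>\<kappa>\<close> keeps it
    below \<open>\<xi> / 2\<close>, which leaves half of the coercivity constant.\<close>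
  define K where "K = 1 + m * (\<Lambda> + 1) + m * M"
  have K0: "1 \<le> K" using m M0 L0 by (simp add: K_def)
  define \<kappa> where "\<kappa> = Min {1, \<kappa>1, \<xi> / (2 * K)}"
  have \<kappa>0: "0 < \<kappa>" using \<kappa>1 \<xi> K0 by (simp add: \<kappa>_def)
  have \<kappa>: "\<kappa> \<le> 1" "\<kappa> \<le> \<kappa>1" "\<kappa> \<le> \<xi> / (2 * K)" by (simp_all add: \<kappa>_def)
  obtain \<epsilon> where \<epsilon>: "\<epsilon> > 0" and nr: "\<And>z l. delta_dist \<phi> g zs z l \<le> \<epsilon> \<Longrightarrow>
    norm (z - zs) \<le> \<kappa> \<and> (\<exists>ls\<in>multipliers \<phi> g zs. norm (l - ls) \<le> \<kappa>) \<and>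
    expansion_bounds \<phi> zs M \<kappa> z \<and> (\<forall>i. expansion_bounds (\<lambda>y. g y $ i) zs M \<kappa> z)"
    using near[OF \<kappa>0] by blast
  define G where "G = norm (g zs) + m * (2 * M)"
  define k12 where "k12 = G + C"
  define k13 where "k13 = \<Lambda> + 1 + k + k12"
  define k14 where "k14 = n * m * (M * k)"
  \<comment> \<open>The entries are for the bound of \<open>s / l\<close> from below by a multiple
    of \<open>\<mu>\<close>, for that of \<open>l\<close>, and for the inactive
    \<open>s / l\<close>, in this order.\<close>
  define c where "c = Min {\<gamma> / k13\<^sup>2, \<gamma> / k13, \<sigma> / k}"
  define M' where "M' = 1 + (M + m * (\<Lambda> * M) + \<xi>) + (norm (nabla g zs) + k14) + k\<^sup>2 / \<gamma> + k12 + m * (k + C)"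
  have G0: "0 \<le> G" using m M0 by (simp add: G_def)
  have k12: "0 < k12" using C G0 by (simp add: k12_def)
  have k13: "1 \<le> k13" "0 < k13" using L0 k0 k12 \<Lambda> by (simp_all add: k13_def)
  have k14: "0 < k14" using n m M0 k0 by (simp add: k14_def)
  have c0: "0 < c" using \<gamma> k13 \<sigma> k0 by (simp add: c_def)
  have c: "c \<le> \<gamma> / k13\<^sup>2" "c \<le> \<gamma> / k13" "c \<le> \<sigma> / k" by (simp_all add: c_def)
  have "0 \<le> M + m * (\<Lambda> * M) + \<xi>" "0 \<le> norm (nabla g zs) + k14" "0 \<le> k\<^sup>2 / \<gamma>" "0 \<le> k12" "0 \<le> m * (k + C)"
    using M0 m L0 \<xi> k14 \<gamma> k12 k0 C by simp_all
  then have M': "1 \<le> M'" "M + m * (\<Lambda> * M) + \<xi> \<le> M'" "norm (nabla g zs) + k14 \<le> M'" "k14 \<le> M'"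
      "k\<^sup>2 / \<gamma> \<le> M'" "k12 \<le> M'" "m * (k + C) \<le> M'"
    using k14 norm_ge_zero[of "nabla g zs"] unfolding M'_def by linarith+
  have main: "block_coercive (\<xi> / 2) c M' B (nabla g zs) (dual_gap l s)
      (lagr_zz \<phi> g z l) (nabla g z) (\<chi> i. s $ i / l $ i) \<and>
    (\<forall>i. c * dual_gap l s \<le> l $ i) \<and> norm s \<le> M' \<and> norm (g z) \<le> M' \<and>
    norm (restr B (g z)) \<le> M' * dual_gap l s"
    if gi: "good_iterate \<phi> g C \<gamma> z l s" and de: "delta_dist \<phi> g zs z l \<le> \<epsilon>" and mue: "dual_gap l s \<le> \<kappa>"
    for z l s
  proof -
    define \<mu> where "\<mu> = dual_gap l s"
    define v where "v = z - zs"
    define d where "d = norm v"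
    obtain ls where ls: "ls \<in> multipliers \<phi> g zs" "norm (l - ls) \<le> \<kappa>" and dk: "norm (z - zs) \<le> \<kappa>"
      and ex\<phi>: "expansion_bounds \<phi> zs M \<kappa> z" and exg: "\<And>i. expansion_bounds (\<lambda>y. g y $ i) zs M \<kappa> z"
      using nr[OF de] by blast
    have mu: "0 < \<mu>" "\<mu> \<le> 1" using good_iterate_pos(1)[OF gi] mue \<kappa> by (auto simp: \<mu>_def)
    have lpos: "0 < l $ i" and spos: "0 < s $ i" for i
      using good_iterate_pos[OF gi] by auto
    have gs: "norm (g z + s) \<le> C * \<mu>" and ls\<gamma>: "\<gamma> * \<mu> \<le> l $ i * s $ i" for i
      using gi by (auto simp: good_iterate_def \<mu>_def)
    have "norm (z - zs) \<le> k * \<mu> \<and> (\<forall>i\<in>B. s $ i \<le> k * \<mu>) \<and>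
        (\<forall>i. i \<notin> B \<longrightarrow> \<sigma> \<le> s $ i \<and> l $ i \<le> k * \<mu>)"
      unfolding \<mu>_def
      by (rule dist[OF gi _ ls(1)])
        (use ls dk mue \<kappa> ex\<phi> exg in \<open>auto intro: expansion_bounds_mono[OF _ order_refl \<kappa>(2)]\<close>)
    then have dm: "d \<le> k * \<mu>" and sB: "\<And>i. i \<in> B \<Longrightarrow> s $ i \<le> k * \<mu>"
      and sN: "\<And>i. i \<notin> B \<Longrightarrow> \<sigma> \<le> s $ i" and lN: "\<And>i. i \<notin> B \<Longrightarrow> l $ i \<le> k * \<mu>"
      by (auto simp: d_def v_def)
    have d: "0 \<le> d" "d \<le> 1" "d\<^sup>2 \<le> 1" using dk \<kappa> by (auto simp: d_def v_def power_le_one)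
    note e\<phi> = ex\<phi>[unfolded expansion_bounds_def, folded v_def d_def]
    note eg = exg[unfolded expansion_bounds_def, folded v_def d_def]
    let ?G = "\<lambda>i. grad (\<lambda>y. g y $ i)"
    let ?H = "\<lambda>i. hess (\<lambda>y. g y $ i)"
    have pi: "\<bar>(l - ls) $ i\<bar> \<le> \<kappa>" for i using component_le_norm_cart[of "l - ls" i] ls by simp
    have lsi: "\<bar>ls $ i\<bar> \<le> \<Lambda>" for i
      using component_le_norm_cart[of ls i] \<Lambda>(2)[OF ls(1)] by simp
    have li: "l $ i \<le> \<Lambda> + 1" for i using pi[of i] lsi[of i] \<kappa> by simp
    have Hd: "norm (lagr_zz \<phi> g z l - lagr_zz \<phi> g zs ls) \<le> \<xi> / 2"
    proof -
      have "lagr_zz \<phi> g z l - lagr_zz \<phi> g zs ls = (hess \<phi> z - hess \<phi> zs)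
          + (\<Sum>i\<in>UNIV. l $ i *\<^sub>R (?H i z - ?H i zs)) + (\<Sum>i\<in>UNIV. (l - ls) $ i *\<^sub>R ?H i zs)"
        unfolding regular_lagr_zz[OF reg]
        by (simp add: scaleR_diff_right scaleR_diff_left sum_subtractf)
      moreover have "norm (\<Sum>i\<in>UNIV. l $ i *\<^sub>R (?H i z - ?H i zs)) \<le> m * ((\<Lambda> + 1) * \<kappa>)"
        unfolding m_def using li lpos eg L0
        by (intro norm_sum_scaleR_le mult_mono) (auto simp: less_imp_le abs_of_pos)
      moreover have "norm (\<Sum>i\<in>UNIV. (l - ls) $ i *\<^sub>R ?H i zs) \<le> m * (\<kappa> * M)"
        unfolding m_def using pi eg \<kappa>0 by (intro norm_sum_scaleR_le mult_mono) auto
      moreover have "norm (hess \<phi> z - hess \<phi> zs) \<le> \<kappa>" using e\<phi> by simp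
      ultimately have "norm (lagr_zz \<phi> g z l - lagr_zz \<phi> g zs ls) \<le> \<kappa> + m * ((\<Lambda> + 1) * \<kappa>) + m * (\<kappa> * M)"
        by (smt (verit) norm_triangle_ineq)
      also have "\<dots> = K * \<kappa>" by (simp add: K_def algebra_simps)
      also have "\<dots> \<le> \<xi> / 2" using mult_left_mono[OF \<kappa>(3), of K] K0 by simp
      finally show ?thesis .
    qed
    have H: "norm (lagr_zz \<phi> g z l) \<le> M'"
    proof -
      have "norm (\<Sum>i\<in>UNIV. ls $ i *\<^sub>R ?H i zs) \<le> m * (\<Lambda> * M)"
        unfolding m_def using lsi eg L0 by (intro norm_sum_scaleR_le mult_mono) auto
      then have "norm (lagr_zz \<phi> g zs ls) \<le> M + m * (\<Lambda> * M)"
        unfolding regular_lagr_zz[OF reg] using e\<phi> by (intro order_trans[OF norm_triangle_ineq]) auto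
      then show ?thesis
        using Hd norm_triangle_sub[of "lagr_zz \<phi> g z l" "lagr_zz \<phi> g zs ls"] M'(2) \<xi>(1) by linarith
    qed
    have coer: "\<xi> / 2 * (norm w)\<^sup>2 \<le> w \<bullet> (lagr_zz \<phi> g z l *v w)"
      if "transpose (cols B (nabla g zs)) *v w = 0" for w
    proof -
      have "\<bar>w \<bullet> ((lagr_zz \<phi> g z l - lagr_zz \<phi> g zs ls) *v w)\<bar> \<le> norm w * (\<xi> / 2 * norm w)"
        using norm_matrix_vector_le[of "lagr_zz \<phi> g z l - lagr_zz \<phi> g zs ls" w] mult_right_mono[OF Hd, of "norm w"]
        by (intro order_trans[OF Cauchy_Schwarz_ineq2] mult_left_mono) auto
      moreover have "norm w * (\<xi> / 2 * norm w) = \<xi> / 2 * (norm w)\<^sup>2"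
        by (simp add: power2_eq_square)
      ultimately show ?thesis
        using \<xi>(2)[OF ls(1) that]
        unfolding matrix_vector_mult_diff_rdistrib inner_diff_right by linarith
    qed
    have Ad: "norm (nabla g z - nabla g zs) \<le> k14 * \<mu>"
    proof -
      have "\<bar>(nabla g z - nabla g zs) $ i $ j\<bar> \<le> M * (k * \<mu>)" for i j
      proof -
        have "\<bar>(nabla g z - nabla g zs) $ i $ j\<bar> = \<bar>(?G j z - ?G j zs) $ i\<bar>" by (simp add: nabla_def)
        also have "\<dots> \<le> M * d" using component_le_norm_cart[of "?G j z - ?G j zs" i] eg[of j] by linarith
        also have "\<dots> \<le> M * (k * \<mu>)" using dm M0 by simp
        finally show ?thesis .
      qed
      from norm_matrix_le_entries[OF this] show ?thesis by (simp add: k14_def n_def m_def mult_ac)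
    qed
    have A: "norm (nabla g z) \<le> M'"
    proof -
      have "k14 * \<mu> \<le> k14" using k14 mu by simp
      then show ?thesis
        using Ad norm_triangle_sub[of "nabla g z" "nabla g zs"] M'(3) by linarith
    qed
    have gz: "norm (g z) \<le> G"
    proof -
      have "\<bar>(g z - g zs) $ i\<bar> \<le> 2 * M" for i
      proof -
        have "\<bar>?G i zs \<bullet> v\<bar> \<le> M * d"
          using Cauchy_Schwarz_ineq2[of "?G i zs" v] eg[of i] mult_right_mono[of "norm (?G i zs)" M d] d
          by (auto simp: d_def)
        moreover have "M * d \<le> M" "M * d\<^sup>2 \<le> M" using d M0 by simp_all
        ultimately show ?thesis using eg[of i] by simp linarith
      qed
      then have "norm (g z - g zs) \<le> m * (2 * M)"
        using norm_restr_bound[of "2 * M" UNIV "g z - g zs"] M0 by (simp add: m_def)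
      then show ?thesis using norm_triangle_sub[of "g z" "g zs"] by (simp add: G_def)
    qed
    have s: "norm s \<le> k12"
    proof -
      have "norm s \<le> norm (g z + s) + norm (g z)"
        using norm_triangle_ineq4[of "g z + s" "g z"] by simp
      moreover have "C * \<mu> \<le> C" using C mu by simp
      ultimately show ?thesis using gs gz by (simp add: k12_def)
    qed
    have si: "s $ i \<le> k13" and li13: "l $ i \<le> k13" for i
      using component_le_norm_cart[of s i] s li[of i] L0 k0 k12 by (auto simp: k13_def)
    have lc: "c * \<mu> \<le> l $ i" for i
    proof -
      have "\<gamma> * \<mu> \<le> l $ i * k13"
        using order_trans[OF ls\<gamma>[of i] mult_left_mono[OF si[of i]]] lpos[of i] by simp
      then have "\<gamma> / k13 * \<mu> \<le> l $ i" using k13 by (simp add: field_simps)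
      then show ?thesis using mult_right_mono[OF c(2), of \<mu>] mu by simp
    qed
    have D1: "c * \<mu> \<le> s $ i / l $ i" for i
    proof -
      have "c * \<mu> * (l $ i * l $ i) \<le> \<gamma> / k13\<^sup>2 * \<mu> * (k13 * k13)"
        using c(1) li13[of i] lpos[of i] mu \<gamma> k13 c0 by (intro mult_mono) auto
      also have "\<dots> = \<gamma> * \<mu>" using k13 by (simp add: power2_eq_square)
      also have "\<dots> \<le> s $ i * l $ i" using ls\<gamma>[of i] by (simp add: mult.commute)
      finally have "(c * \<mu> * l $ i) * l $ i \<le> s $ i * l $ i" by (simp add: mult_ac)
      then have "c * \<mu> * l $ i \<le> s $ i" using lpos[of i] by simp
      then show ?thesis using lpos[of i] by (simp add: field_simps)
    qed
    have D2: "s $ i / l $ i \<le> M' * \<mu>" if i: "i \<in> B" for i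
    proof -
      have "\<gamma> * (s $ i * \<mu>) \<le> l $ i * s $ i * s $ i"
        using mult_right_mono[OF ls\<gamma>[of i], of "s $ i"] spos[of i] by (simp add: mult_ac)
      also have "\<dots> \<le> l $ i * (k * \<mu>) * (k * \<mu>)"
        using sB[OF i] spos[of i] lpos[of i] k0 mu by (intro mult_mono) (auto simp: less_imp_le)
      finally have "(\<gamma> * s $ i) * \<mu> \<le> (l $ i * k\<^sup>2 * \<mu>) * \<mu>" by (simp add: power2_eq_square mult_ac)
      then have "\<gamma> * s $ i \<le> l $ i * k\<^sup>2 * \<mu>" using mu by simp
      then have "s $ i / l $ i \<le> (k\<^sup>2 / \<gamma>) * \<mu>" using lpos[of i] \<gamma> by (simp add: field_simps)
      then show ?thesis using mult_right_mono[OF M'(5), of \<mu>] mu by simp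
    qed
    have D3: "c / \<mu> \<le> s $ i / l $ i" if i: "i \<notin> B" for i
    proof -
      have "c / \<mu> \<le> (\<sigma> / k) / \<mu>" using c(3) mu by (intro divide_right_mono) auto
      also have "\<dots> = \<sigma> / (k * \<mu>)" by simp
      also have "\<dots> \<le> s $ i / l $ i"
        using sN[OF i] lN[OF i] \<sigma> lpos[of i] by (intro frac_le) auto
      finally show ?thesis .
    qed
    have gB: "norm (restr B (g z)) \<le> M' * \<mu>"
    proof -
      have "\<bar>g z $ i\<bar> \<le> (k + C) * \<mu>" if "i \<in> B" for i
        using component_le_norm_cart[of "g z + s" i] gs sB[OF that] spos[of i] by (simp add: algebra_simps)
      then have "norm (restr B (g z)) \<le> (m * (k + C)) * \<mu>"
        using norm_restr_bound[of "(k + C) * \<mu>" B "g z"] k0 C mu by (simp add: m_def)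
      then show ?thesis using order_trans[OF _ mult_right_mono[OF M'(7)]] mu by simp
    qed
    have "norm (nabla g z - nabla g zs) \<le> M' * \<mu>"
      using order_trans[OF Ad mult_right_mono[OF M'(4)]] mu by simp
    then have "block_coercive (\<xi> / 2) c M' B (nabla g zs) \<mu> (lagr_zz \<phi> g z l) (nabla g z) (\<chi> i. s $ i / l $ i)"
      unfolding block_coercive_def using H A coer D1 D2 D3 by auto
    moreover have "norm s \<le> M'" "norm (g z) \<le> M'" using s gz M'(6) C by (auto simp: k12_def)
    ultimately show ?thesis using lc gB by (simp add: \<mu>_def)
  qed
  show ?thesis
    unfolding B_def[symmetric]
    using \<xi>(1) c0 M'(1) \<epsilon> \<kappa>0 main
    by (intro exI[of _ "\<xi> / 2"] conjI exI[of _ c] exI[of _ M'] exI[of _ "min \<epsilon> \<kappa>"]) auto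
qed

section \<open>Singular value decomposition\<close>

text \<open>The constant must not depend on the decomposition, which the theorem quantifies after
  all constants. Every positive singular value is at least the constant of
  \<open>transpose_bounded_below_on_range\<close>, so the \<open>U\<close> component is controlled
  by the image of \<open>y\<close>; the \<open>V\<close> component is controlled by Parseval's
  identity.\<close>

lemma svd_bounds:
  fixes A :: "real^'m^'n" and B :: "'m set"
  shows "\<exists>k>0. \<forall>r Uh Vh Sg U V y. svd_on B A r Uh Vh Sg U V \<longrightarrow>
    L2_set (tmult_on B U y) {..<r} \<le> k * norm (cols B A *v y) \<and>
    L2_set (tmult_on B V y) {..<card B - r} \<le> norm (restr B y)"
proof -
  define A\<^sub>0 where "A\<^sub>0 = cols B A"
  obtain c where c: "c > 0" "\<And>y. c * norm (A\<^sub>0 *v y) \<le> norm (transpose A\<^sub>0 *v (A\<^sub>0 *v y))"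
    using transpose_bounded_below_on_range[of A\<^sub>0] by blast
  have main: "L2_set (tmult_on B U y) {..<r} \<le> real CARD('n) / c * norm (A\<^sub>0 *v y) \<and>
      L2_set (tmult_on B V y) {..<card B - r} \<le> norm (restr B y)"
    if svd: "svd_on B A r Uh Vh Sg U V" for r Uh Vh Sg U V y
  proof
    have rn: "r \<le> CARD('n)" and rB: "r \<le> card B" and Sg0: "\<And>k. k < r \<Longrightarrow> 0 < Sg k k"
      and Sgd: "\<And>k l. k < r \<Longrightarrow> l < r \<Longrightarrow> k \<noteq> l \<Longrightarrow> Sg k l = 0"
      and AS: "\<And>j i. i \<in> B \<Longrightarrow> A $ j $ i = (\<Sum>k<r. \<Sum>l<r. Uh j k * Sg k l * U i l)"
      and oh: "orthogonal_on UNIV {..<CARD('n)} (hcat r Uh Vh)" and oB: "orthogonal_on B {..<card B} (hcat r U V)"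
      using svd by (auto simp: svd_on_def)
    have ouh: "(\<Sum>j\<in>UNIV. Uh j k * Uh j l) = (if k = l then 1 else 0)" if "k < r" "l < r" for k l
    proof -
      have "(\<Sum>j\<in>UNIV. hcat r Uh Vh j k * hcat r Uh Vh j l) = (if k = l then 1 else 0)"
        using oh that rn unfolding orthogonal_on_def by auto
      then show ?thesis using that by (simp add: hcat_def)
    qed
    have ou: "(\<Sum>i\<in>B. U i k * U i l) = (if k = l then 1 else 0)" if "k < r" "l < r" for k l
    proof -
      have "(\<Sum>i\<in>B. hcat r U V i k * hcat r U V i l) = (if k = l then 1 else 0)"
        using oB that rB unfolding orthogonal_on_def by auto
      then show ?thesis using that by (simp add: hcat_def)
    qed
    have AS': "A $ j $ i = (\<Sum>k<r. Uh j k * Sg k k * U i k)" if "i \<in> B" for i j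
    proof -
      have "(\<Sum>l<r. Uh j k * Sg k l * U i l) = Uh j k * Sg k k * U i k" if "k < r" for k
        using that Sgd by (subst sum.remove[of _ k]) (auto intro!: sum.neutral)
      then show ?thesis using AS[OF that] by simp
    qed
    have A0y: "(A\<^sub>0 *v y) $ j = (\<Sum>k<r. Uh j k * (Sg k k * tmult_on B U y k))" for j and y :: "real^'m"
    proof -
      have "(A\<^sub>0 *v y) $ j = (\<Sum>i\<in>B. A $ j $ i * y $ i)"
        by (simp add: A\<^sub>0_def cols_def matrix_vector_mult_def if_distrib[of "\<lambda>x. x * _"] sum.If_cases cong: if_cong)
      also have "\<dots> = (\<Sum>i\<in>B. \<Sum>k<r. Uh j k * (Sg k k * (U i k * y $ i)))"
        by (simp add: AS' sum_distrib_right mult.assoc)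
      also have "\<dots> = (\<Sum>k<r. Uh j k * (Sg k k * tmult_on B U y k))"
        by (subst sum.swap) (simp add: tmult_on_def sum_distrib_left)
      finally show ?thesis .
    qed
    define uh where "uh k = (\<chi> j. Uh j k)" for k
    have uh_norm: "norm (uh k) = 1" if "k < r" for k
      using ouh[OF that that] by (simp add: norm_eq_sqrt_inner inner_vec_def uh_def)
    have uh_A0: "uh k \<bullet> (A\<^sub>0 *v y) = Sg k k * tmult_on B U y k" if k: "k < r" for k and y :: "real^'m"
    proof -
      have "uh k \<bullet> (A\<^sub>0 *v y) = (\<Sum>j\<in>UNIV. \<Sum>l<r. (Uh j k * Uh j l) * (Sg l l * tmult_on B U y l))"
        by (simp add: inner_vec_def uh_def A0y sum_distrib_left mult.assoc)
      also have "\<dots> = (\<Sum>l<r. (\<Sum>j\<in>UNIV. Uh j k * Uh j l) * (Sg l l * tmult_on B U y l))"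
        by (subst sum.swap) (simp add: sum_distrib_right)
      also have "\<dots> = (\<Sum>l<r. if k = l then Sg l l * tmult_on B U y l else 0)"
        by (intro sum.cong) (auto simp: ouh[OF k])
      finally show ?thesis using k by (simp add: sum.delta)
    qed
    \<comment> \<open>Applied to a right singular vector, the lower bound on the range reads
      \<open>c * Sg k k \<le> Sg k k * Sg k k\<close>.\<close>
    have Sgc: "c \<le> Sg k k" if k: "k < r" for k
    proof -
      define uk where "uk = (\<chi> i. if i \<in> B then U i k else 0)"
      have t: "tmult_on B U uk l = (if l = k then 1 else 0)" if "l < r" for l
        using ou[OF that k] by (simp add: tmult_on_def uk_def)
      have A0u: "A\<^sub>0 *v uk = Sg k k *\<^sub>R uh k"
      proof -
        have "(A\<^sub>0 *v uk) $ j = (\<Sum>l<r. if l = k then Uh j l * Sg l l else 0)" for j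
          unfolding A0y by (intro sum.cong) (auto simp: t)
        then show ?thesis using k by (simp add: vec_eq_iff uh_def mult.commute sum.delta)
      qed
      have "transpose A\<^sub>0 *v uh k = Sg k k *\<^sub>R uk"
      proof -
        have "(transpose A\<^sub>0 *v uh k) \<bullet> y = (Sg k k *\<^sub>R uk) \<bullet> y" for y
        proof -
          have "tmult_on B U y k = uk \<bullet> y"
            by (simp add: tmult_on_def uk_def inner_vec_def if_distrib[of "\<lambda>x. x * _"] sum.If_cases cong: if_cong)
          then show ?thesis by (simp add: inner_transpose_vector uh_A0[OF k])
        qed
        then show ?thesis using vector_eq_rdot by blast
      qed
      moreover have "norm uk = 1"
      proof -
        have "norm uk = norm (restr B uk)" by (simp add: uk_def restr_def cong: if_cong)
        then show ?thesis using ou[OF k k] by (simp add: norm_restr_L2 L2_set_def uk_def power2_eq_square)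
      qed
      ultimately have "norm (transpose A\<^sub>0 *v (A\<^sub>0 *v uk)) = Sg k k * Sg k k"
        using Sg0[OF k] by (simp add: A0u matrix_vector_mult_scaleR)
      moreover have "norm (A\<^sub>0 *v uk) = Sg k k" using Sg0[OF k] by (simp add: A0u uh_norm[OF k])
      ultimately have "c * Sg k k \<le> Sg k k * Sg k k" using c(2)[of uk] by simp
      then show ?thesis using Sg0[OF k] by simp
    qed
    have tk: "\<bar>tmult_on B U y k\<bar> \<le> norm (A\<^sub>0 *v y) / c" if k: "k < r" for k
    proof -
      have "c * \<bar>tmult_on B U y k\<bar> \<le> \<bar>Sg k k * tmult_on B U y k\<bar>"
        using Sgc[OF k] Sg0[OF k] by (simp add: abs_mult mult_right_mono)
      also have "\<dots> \<le> norm (A\<^sub>0 *v y)"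
        using Cauchy_Schwarz_ineq2[of "uh k" "A\<^sub>0 *v y"] by (simp add: uh_A0[OF k] uh_norm[OF k])
      finally show ?thesis using c by (simp add: field_simps)
    qed
    have "L2_set (tmult_on B U y) {..<r} \<le> (\<Sum>k<r. \<bar>tmult_on B U y k\<bar>)" by (rule L2_set_le_sum_abs)
    also have "\<dots> \<le> (\<Sum>k<r. norm (A\<^sub>0 *v y) / c)" using tk by (intro sum_mono) auto
    also have "\<dots> = real r * (norm (A\<^sub>0 *v y) / c)" by simp
    also have "\<dots> \<le> real CARD('n) * (norm (A\<^sub>0 *v y) / c)" using rn c by (intro mult_right_mono) auto
    finally show "L2_set (tmult_on B U y) {..<r} \<le> real CARD('n) / c * norm (A\<^sub>0 *v y)" by simp

    let ?Q = "hcat r U V"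
    define f where "f k = (\<Sum>i\<in>B. ?Q i k * y $ i)" for k
    \<comment> \<open>\<open>hcat\<close> stores the columns of \<open>V\<close> from position
      \<open>r\<close> on, hence the shift. The sum is then extended to all columns of the square
      orthogonal matrix.\<close>
    have "(\<Sum>k<card B - r. (tmult_on B V y k)\<^sup>2) = (\<Sum>k<card B - r. (f (k + r))\<^sup>2)"
      by (simp add: f_def tmult_on_def hcat_def)
    also have "\<dots> = (\<Sum>k\<in>{r..<card B}. (f k)\<^sup>2)"
      using rB by (intro sum.reindex_bij_witness[of _ "\<lambda>k. k - r" "\<lambda>k. k + r"]) auto
    also have "\<dots> \<le> (\<Sum>k<card B. (f k)\<^sup>2)" by (intro sum_mono2) auto
    also have "\<dots> = (\<Sum>k<card B. \<Sum>i\<in>B. \<Sum>j\<in>B. (?Q i k * ?Q j k) * (y $ i * y $ j))"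
      by (simp add: f_def power2_eq_square sum_product mult_ac)
    also have "\<dots> = (\<Sum>i\<in>B. \<Sum>k<card B. \<Sum>j\<in>B. (?Q i k * ?Q j k) * (y $ i * y $ j))"
      by (rule sum.swap)
    also have "\<dots> = (\<Sum>i\<in>B. \<Sum>j\<in>B. (\<Sum>k<card B. ?Q i k * ?Q j k) * (y $ i * y $ j))"
      by (subst sum.swap) (simp add: sum_distrib_right)
    also have "\<dots> = (\<Sum>i\<in>B. \<Sum>j\<in>B. if i = j then y $ i * y $ j else 0)"
      using oB by (intro sum.cong refl) (auto simp: orthogonal_on_def)
    also have "\<dots> = (\<Sum>i\<in>B. (y $ i)\<^sup>2)" by (simp add: sum.delta power2_eq_square)
    finally show "L2_set (tmult_on B V y) {..<card B - r} \<le> norm (restr B y)"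
      by (simp add: L2_set_def norm_restr_L2)
  qed
  show ?thesis
    unfolding A\<^sub>0_def[symmetric]
    using main c by (intro exI[of _ "real CARD('n) / c"]) auto
qed

section \<open>Rounding errors and backward error\<close>

lemma fp_arithE:
  assumes "fp_arith u F fl" "x \<in> F" "y \<in> F" "op = Divide \<Longrightarrow> y \<noteq> 0"
  obtains e where "\<bar>e\<bar> \<le> u" "fl op x y = exact_op op x y * (1 + e)" "fl op x y \<in> F"
  using assms unfolding fp_arith_def by metis

lemma fl_sum_nonempty: "fl_sum fl X w \<Longrightarrow> 1 \<le> size X"
  by (induction rule: fl_sum.induct) auto

lemma sum_mset_abs_nonneg: "0 \<le> (\<Sum>x\<in>#X. \<bar>x::real\<bar>)"
  by (induction X) auto

lemma abs_sum_mset_le: "\<bar>\<Sum>\<^sub># X\<bar> \<le> (\<Sum>x\<in>#X. \<bar>x::real\<bar>)"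
  by (induction X) auto

text \<open>The number of summands serves as exponent for every bracketing: an addition costs each
  operand one factor \<open>1 + u\<close>, and the other operand, being nonempty, raises the
  exponent by at least one.\<close>

lemma fl_sum_error:
  assumes fp: "fp_arith u F fl"
  shows "fl_sum fl X w \<Longrightarrow> set_mset X \<subseteq> F \<Longrightarrow>
    w \<in> F \<and> \<bar>w - \<Sum>\<^sub># X\<bar> \<le> ((1 + u) ^ size X - 1) * (\<Sum>x\<in>#X. \<bar>x\<bar>)"
proof (induction rule: fl_sum.induct)
  case (single x)
  have "0 \<le> u" using fp by (simp add: fp_arith_def)
  then show ?case using single by simp
next
  case (plus X a Y b)
  have u: "0 \<le> u" using fp by (simp add: fp_arith_def)
  let ?p = "(1 + u) ^ size X" and ?q = "(1 + u) ^ size Y" and ?z = "(1 + u) ^ size (X + Y)"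
  let ?S = "\<Sum>x\<in>#X. \<bar>x\<bar>" and ?T = "\<Sum>x\<in>#Y. \<bar>x\<bar>"
  have ST: "0 \<le> ?S" "0 \<le> ?T" by (rule sum_mset_abs_nonneg)+
  have a: "a \<in> F" "\<bar>a - \<Sum>\<^sub># X\<bar> \<le> (?p - 1) * ?S" and b: "b \<in> F" "\<bar>b - \<Sum>\<^sub># Y\<bar> \<le> (?q - 1) * ?T"
    using plus by auto
  obtain e where e: "\<bar>e\<bar> \<le> u" "fl Plus a b = exact_op Plus a b * (1 + e)" and F: "fl Plus a b \<in> F"
    using fp_arithE[OF fp a(1) b(1), of Plus] by auto
  have "(1 + u) * ?p \<le> ?z" "(1 + u) * ?q \<le> ?z"
    using fl_sum_nonempty[OF plus.hyps(1)] fl_sum_nonempty[OF plus.hyps(2)] u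
    by (auto simp flip: power_Suc intro!: power_increasing)
  then have z: "((1 + u) * ?p - 1) * ?S \<le> (?z - 1) * ?S" "((1 + u) * ?q - 1) * ?T \<le> (?z - 1) * ?T"
    using ST by (auto intro!: mult_right_mono)
  have "\<bar>a\<bar> \<le> ?p * ?S" "\<bar>b\<bar> \<le> ?q * ?T"
    using a(2) b(2) abs_sum_mset_le[of X] abs_sum_mset_le[of Y] by (auto simp: algebra_simps)
  then have "\<bar>e * (a + b)\<bar> \<le> u * (?p * ?S + ?q * ?T)"
    unfolding abs_mult using e u by (intro mult_mono) auto
  moreover have "fl Plus a b - \<Sum>\<^sub># (X + Y) = (a - \<Sum>\<^sub># X) + (b - \<Sum>\<^sub># Y) + e * (a + b)"
    using e by (simp add: algebra_simps)
  ultimately have "\<bar>fl Plus a b - \<Sum>\<^sub># (X + Y)\<bar> \<le> (?p - 1) * ?S + (?q - 1) * ?T + u * (?p * ?S + ?q * ?T)"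
    using a(2) b(2) by linarith
  also have "\<dots> = ((1 + u) * ?p - 1) * ?S + ((1 + u) * ?q - 1) * ?T" by (simp add: algebra_simps)
  also have "\<dots> \<le> (?z - 1) * (?S + ?T)" using z by (simp add: algebra_simps)
  finally show ?case using F by simp
qed

text \<open>This is the secant bound of a convex function on the unit interval; it makes the
  accumulated rounding factor linear in \<open>u\<close>, with a constant that depends on the
  dimension only.\<close>

lemma power_one_plus_le:
  fixes u :: real
  assumes "0 \<le> u" "u \<le> 1"
  shows "(1 + u) ^ k \<le> 1 + u * (2 ^ k - 1)"
proof (induction k)
  case (Suc k)
  have "(1 + u) ^ k \<le> 2 ^ k" using assms by (intro power_mono) auto
  then have "u * (1 + u) ^ k \<le> u * 2 ^ k" using assms by (intro mult_left_mono) auto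
  then show ?case using Suc by (simp add: algebra_simps)
qed simp

text \<open>In the constant, 1 counts the rounding of the products, \<open>2 ^ CARD('k)\<close> that
  of the summation, and the factor 2 the growth of the rounded products over the exact ones for
  \<open>u \<le> 1\<close>.\<close>

lemma fl_inner_error:
  fixes x y :: "real^'k"
  assumes fp: "fp_arith u F fl" and u1: "u \<le> 1" and x: "fp_vec F x" and y: "fp_vec F y"
    and w: "fl_inner fl x y w"
  shows "w \<in> F" "\<bar>w - x \<bullet> y\<bar> \<le> (1 + 2 * 2 ^ CARD('k)) * real CARD('k) * u * (norm x * norm y)"
proof -
  have u: "0 \<le> u" using fp by (simp add: fp_arith_def)
  let ?t = "\<lambda>j. fl Times (x $ j) (y $ j)"
  define X where "X = image_mset ?t (mset_set UNIV)"
  define P where "P = (\<Sum>j\<in>UNIV. \<bar>x $ j * y $ j\<bar>)"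
  have t: "?t j \<in> F \<and> \<bar>?t j - x $ j * y $ j\<bar> \<le> u * \<bar>x $ j * y $ j\<bar>" for j
  proof -
    obtain e where "\<bar>e\<bar> \<le> u" "?t j = exact_op Times (x $ j) (y $ j) * (1 + e)" "?t j \<in> F"
      using fp_arithE[OF fp, of "x $ j" "y $ j" Times] x y by (auto simp: fp_vec_def)
    then show ?thesis by (auto simp: algebra_simps abs_mult intro!: mult_right_mono)
  qed
  have size: "size X = CARD('k)" and sumX: "\<Sum>\<^sub># X = (\<Sum>j\<in>UNIV. ?t j)"
      and absX: "(\<Sum>x\<in>#X. \<bar>x\<bar>) = (\<Sum>j\<in>UNIV. \<bar>?t j\<bar>)"
    by (simp_all add: X_def sum_unfold_sum_mset image_mset.compositionality comp_def)
  have "fl_sum fl X w" "set_mset X \<subseteq> F" using w t by (auto simp: fl_inner_def X_def)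
  from fl_sum_error[OF fp this] have wF: "w \<in> F"
    and err: "\<bar>w - (\<Sum>j\<in>UNIV. ?t j)\<bar> \<le> ((1 + u) ^ CARD('k) - 1) * (\<Sum>j\<in>UNIV. \<bar>?t j\<bar>)"
    by (auto simp: size sumX absX)
  show "w \<in> F" by (rule wF)
  have PU: "P \<le> real CARD('k) * (norm x * norm y)"
  proof -
    have "P \<le> (\<Sum>j\<in>(UNIV::'k set). norm x * norm y)"
      unfolding P_def abs_mult by (intro sum_mono mult_mono component_le_norm_cart) auto
    then show ?thesis by simp
  qed
  have s1: "\<bar>(\<Sum>j\<in>UNIV. ?t j) - x \<bullet> y\<bar> \<le> u * P"
  proof -
    have "(\<Sum>j\<in>UNIV. ?t j) - x \<bullet> y = (\<Sum>j\<in>UNIV. ?t j - x $ j * y $ j)"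
      by (simp add: inner_vec_def sum_subtractf)
    also have "\<bar>\<dots>\<bar> \<le> (\<Sum>j\<in>UNIV. u * \<bar>x $ j * y $ j\<bar>)"
      using t by (intro order_trans[OF sum_abs] sum_mono) auto
    finally show ?thesis by (simp add: P_def sum_distrib_left)
  qed
  have s2: "(\<Sum>j\<in>UNIV. \<bar>?t j\<bar>) \<le> 2 * P"
    unfolding P_def sum_distrib_left
  proof (rule sum_mono)
    fix j
    have "u * \<bar>x $ j * y $ j\<bar> \<le> 1 * \<bar>x $ j * y $ j\<bar>" using u1 by (intro mult_right_mono) auto
    then show "\<bar>?t j\<bar> \<le> 2 * \<bar>x $ j * y $ j\<bar>" using t[of j] by linarith
  qed
  have "((1 + u) ^ CARD('k) - 1) * (\<Sum>j\<in>UNIV. \<bar>?t j\<bar>) \<le> (u * 2 ^ CARD('k)) * (2 * P)"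
  proof (rule mult_mono[OF _ s2])
    show "(1 + u) ^ CARD('k) - 1 \<le> u * 2 ^ CARD('k)"
      using power_one_plus_le[OF u u1, of "CARD('k)"] u by (simp add: algebra_simps)
  qed (use u in \<open>auto intro: sum_nonneg\<close>)
  then have "\<bar>w - x \<bullet> y\<bar> \<le> (u * 2 ^ CARD('k)) * (2 * P) + u * P" using err s1 by linarith
  also have "\<dots> = ((1 + 2 * 2 ^ CARD('k)) * u) * P" by (simp add: algebra_simps)
  also have "\<dots> \<le> ((1 + 2 * 2 ^ CARD('k)) * u) * (real CARD('k) * (norm x * norm y))"
    using PU u by (intro mult_left_mono) auto
  finally show "\<bar>w - x \<bullet> y\<bar> \<le> (1 + 2 * 2 ^ CARD('k)) * real CARD('k) * u * (norm x * norm y)"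
    by (simp add: mult_ac)
qed

section \<open>Backward error of the augmented system\<close>

lemma block_norm_entry:
  assumes "block_norm E I J \<le> b" "p \<in> I" "q \<in> J" "finite I" "finite J"
  shows "\<bar>E $ p $ q\<bar> \<le> b"
proof -
  have "\<bar>E $ p $ q\<bar> = L2_set (\<lambda>(p, q). E $ p $ q) {(p, q)}" by (simp add: L2_set_def)
  also have "\<dots> \<le> block_norm E I J"
    unfolding block_norm_def L2_set_def using assms
    by (intro real_sqrt_le_mono sum_mono2) auto
  finally show ?thesis using assms(1) by simp
qed

lemma sum_UNIV_Plus:
  fixes f :: "'a::finite + 'b::finite \<Rightarrow> 'c::comm_monoid_add"
  shows "(\<Sum>p\<in>UNIV. f p) = (\<Sum>i\<in>UNIV. f (Inl i)) + (\<Sum>k\<in>UNIV. f (Inr k))"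
  by (simp add: UNIV_Plus_UNIV[symmetric] sum.Plus del: UNIV_Plus_UNIV)

text \<open>The sum type is split into primal and dual blocks of ordinary types. The active set is
  not a type, so the finer subdivision survives as a case distinction on entries; passing from block
  norms to entries costs only dimension factors afterwards.\<close>

lemma condition_P_rows:
  fixes H :: "real^'n^'n" and A :: "real^'m^'n" and B :: "'m set"
  assumes P: "condition_P K u \<mu> B (-B) (aug_mat H A d) (vcat f h) (vcat x y)"
  obtains E11 :: "real^'n^'n" and E12 :: "real^'m^'n" and E21 :: "real^'n^'m" and E22 :: "real^'m^'m"
  where "H *v x + A *v y + E11 *v x + E12 *v y = f"
    "\<forall>i. (transpose A *v x) $ i - d $ i * y $ i + (E21 *v x) $ i + (E22 *v y) $ i = h $ i"
    "\<forall>i j. \<bar>E11 $ i $ j\<bar> \<le> K * (u / \<mu>)"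
    "\<forall>i j. j \<in> B \<longrightarrow> \<bar>E12 $ i $ j\<bar> \<le> K * u" "\<forall>i j. j \<notin> B \<longrightarrow> \<bar>E12 $ i $ j\<bar> \<le> K * (u / \<mu>)"
    "\<forall>i j. i \<in> B \<longrightarrow> \<bar>E21 $ i $ j\<bar> \<le> K * u" "\<forall>i j. i \<notin> B \<longrightarrow> \<bar>E21 $ i $ j\<bar> \<le> K * (u / \<mu>)"
    "\<forall>i j. i \<in> B \<longrightarrow> j \<in> B \<longrightarrow> \<bar>E22 $ i $ j\<bar> \<le> K * u"
    "\<forall>i j. i \<in> B \<longrightarrow> j \<notin> B \<longrightarrow> \<bar>E22 $ i $ j\<bar> \<le> K * (u / \<mu>)"
    "\<forall>i j. i \<notin> B \<longrightarrow> j \<in> B \<longrightarrow> \<bar>E22 $ i $ j\<bar> \<le> K * (u / \<mu>)"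
    "\<forall>i j. i \<notin> B \<longrightarrow> j \<notin> B \<longrightarrow> \<bar>E22 $ i $ j\<bar> \<le> K * (u / \<mu>\<^sup>2)"
proof -
  obtain E where E: "(aug_mat H A d + E) *v vcat x y = vcat f h"
    and b: "block_norm E (range Inl) (range Inl) \<le> K * (u / \<mu>)"
      "block_norm E (Inr ` (-B)) (Inr ` (-B)) \<le> K * (u / \<mu>\<^sup>2)"
      "block_norm E (range Inl) (Inr ` B) \<le> K * u" "block_norm E (Inr ` B) (range Inl) \<le> K * u"
      "block_norm E (Inr ` B) (Inr ` B) \<le> K * u"
      "block_norm E (range Inl) (Inr ` (-B)) \<le> K * (u / \<mu>)" "block_norm E (Inr ` (-B)) (range Inl) \<le> K * (u / \<mu>)"
      "block_norm E (Inr ` B) (Inr ` (-B)) \<le> K * (u / \<mu>)" "block_norm E (Inr ` (-B)) (Inr ` B) \<le> K * (u / \<mu>)"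
    using P unfolding condition_P_def Let_def by blast
  note be = b[THEN block_norm_entry]
  define E11 :: "real^'n^'n" where "E11 = (\<chi> i j. E $ Inl i $ Inl j)"
  define E12 :: "real^'m^'n" where "E12 = (\<chi> i j. E $ Inl i $ Inr j)"
  define E21 :: "real^'n^'m" where "E21 = (\<chi> i j. E $ Inr i $ Inl j)"
  define E22 :: "real^'m^'m" where "E22 = (\<chi> i j. E $ Inr i $ Inr j)"
  have row: "((aug_mat H A d + E) *v vcat x y) $ p = vcat f h $ p" for p using E by simp
  show ?thesis
  proof (rule that)
    show "H *v x + A *v y + E11 *v x + E12 *v y = f"
      unfolding vec_eq_iff
    proof
      fix i
      show "(H *v x + A *v y + E11 *v x + E12 *v y) $ i = f $ i"
        using row[of "Inl i"]
        by (simp add: matrix_vector_mult_def sum_UNIV_Plus aug_mat_def vcat_def E11_def E12_def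
            distrib_right sum.distrib)
    qed
    have "(transpose A *v x) $ i - d $ i * y $ i + (E21 *v x) $ i + (E22 *v y) $ i = h $ i" for i
      using row[of "Inr i"]
      by (simp add: matrix_vector_mult_def sum_UNIV_Plus aug_mat_def vcat_def E21_def E22_def transpose_def
          distrib_right sum.distrib if_distrib[of "\<lambda>x. x * _"] sum.delta cong: if_cong)
    then show "\<forall>i. (transpose A *v x) $ i - d $ i * y $ i + (E21 *v x) $ i + (E22 *v y) $ i = h $ i" ..
  qed (use be in \<open>auto simp: E11_def E12_def E21_def E22_def\<close>)
qed

lemma abs_matrix_vector_nth_le:
  fixes E :: "real^'k^'j"
  assumes "\<And>j. j \<in> B \<Longrightarrow> \<bar>E $ i $ j\<bar> \<le> b" "\<And>j. j \<notin> B \<Longrightarrow> \<bar>E $ i $ j\<bar> \<le> b'" "0 \<le> b" "0 \<le> b'"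
  shows "\<bar>(E *v y) $ i\<bar> \<le> real CARD('k) * (b * norm (restr B y) + b' * norm (restr (-B) y))"
proof -
  have "\<bar>(E *v y) $ i\<bar> \<le> (\<Sum>j\<in>UNIV. \<bar>E $ i $ j * y $ j\<bar>)"
    unfolding matrix_vector_mult_def by (simp add: sum_abs)
  also have "\<dots> \<le> (\<Sum>j\<in>(UNIV::'k set). b * norm (restr B y) + b' * norm (restr (-B) y))"
  proof (rule sum_mono)
    fix j
    show "\<bar>E $ i $ j * y $ j\<bar> \<le> b * norm (restr B y) + b' * norm (restr (-B) y)"
    proof (cases "j \<in> B")
      case True
      then have "\<bar>E $ i $ j * y $ j\<bar> \<le> b * norm (restr B y)"
        unfolding abs_mult using assms abs_nth_le_restr[OF True, of y] by (intro mult_mono) auto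
      then show ?thesis using assms(4) by (simp add: add_increasing2)
    next
      case False
      then have "\<bar>E $ i $ j * y $ j\<bar> \<le> b' * norm (restr (-B) y)"
        unfolding abs_mult using assms abs_nth_le_restr[of j "-B" y] by (intro mult_mono) auto
      then show ?thesis using assms(3) by (simp add: add_increasing)
    qed
  qed
  finally show ?thesis by simp
qed

definition step_size :: "'m set \<Rightarrow> real \<Rightarrow> real^'n \<Rightarrow> real^'m \<Rightarrow> real" where
  "step_size B \<mu> x y = norm x + \<mu> * norm (restr B y) + norm (restr (-B) y)"

lemma step_size_nonneg: "0 \<le> \<mu> \<Longrightarrow> 0 \<le> step_size B \<mu> x y"
  by (simp add: step_size_def)

lemma step_size_diff_le:
  assumes "0 \<le> \<mu>"
  shows "step_size B \<mu> x y \<le> step_size B \<mu> x' y' + step_size B \<mu> (x - x') (y - y')"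
proof -
  have "norm x \<le> norm x' + norm (x - x')" by (rule norm_triangle_sub)
  moreover have "norm (restr I y) \<le> norm (restr I y') + norm (restr I (y - y'))" for I
    unfolding restr_diff by (rule norm_triangle_sub)
  then have "\<mu> * norm (restr B y) \<le> \<mu> * (norm (restr B y') + norm (restr B (y - y')))"
    "norm (restr (-B) y) \<le> norm (restr (-B) y') + norm (restr (-B) (y - y'))"
    using assms by (auto intro: mult_left_mono)
  ultimately show ?thesis by (simp add: step_size_def algebra_simps)
qed

text \<open>
  The scaling of the perturbation blocks matches the weights in \<^const>\<open>step_size\<close>: every
  perturbation term contributes at most \<open>u / \<mu>\<close> times the weighted size of the computed step.
\<close>

lemma computed_residual_bound:
  fixes H :: "real^'n^'n" and A :: "real^'m^'n" and B :: "'m set"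
  assumes mu: "0 < \<mu>" "\<mu> \<le> 1" and u: "0 \<le> u" and K: "0 < K"
    and P: "condition_P K u \<mu> B (-B) (aug_mat Hc Ac dc) (vcat fc hc) (vcat x y)"
    and Hc: "norm (Hc - H) \<le> K * u" and Ac: "norm (Ac - A) \<le> K * u"
    and dB: "\<And>i. i \<in> B \<Longrightarrow> \<bar>dc $ i - d $ i\<bar> \<le> K * (\<mu> * u)"
    and dN: "\<And>i. i \<notin> B \<Longrightarrow> \<bar>dc $ i - d $ i\<bar> \<le> K * (u / \<mu>)"
    and f: "\<And>i. \<bar>fc $ i - f $ i\<bar> \<le> L * u" and h: "\<And>i. \<bar>hc $ i - h $ i\<bar> \<le> L * u" and L: "0 \<le> L"
  defines "T \<equiv> step_size B \<mu> x y"
    and "rf \<equiv> H *v x + A *v y - f" and "rh \<equiv> (\<chi> i. (transpose A *v x) $ i - d $ i * y $ i - h $ i)"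
    and "Q \<equiv> L + K * (2 + real CARD('n) + real CARD('m))"
  shows "norm rf \<le> real CARD('n) * (Q * (u + u / \<mu> * T))"
    "norm (restr B rh) \<le> real CARD('m) * (Q * (u + u / \<mu> * T))"
    "\<mu> * norm (restr (-B) rh) \<le> real CARD('m) * (Q * (u + u / \<mu> * T))"
proof -
  define n m where "n = real CARD('n)" and "m = real CARD('m)"
  define \<omega> where "\<omega> = u / \<mu>"
  define X Y Z where "X = norm x" and "Y = norm (restr B y)" and "Z = norm (restr (-B) y)"
  have T: "T = X + \<mu> * Y + Z" by (simp add: T_def step_size_def X_def Y_def Z_def)
  have nm: "0 < n" "0 < m" by (simp_all add: n_def m_def)
  have nn: "0 \<le> X" "0 \<le> Y" "0 \<le> Z" by (simp_all add: X_def Y_def Z_def)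
  \<comment> \<open>The identity \<open>u = \<omega> * \<mu>\<close> matches the block scaling with
    the weights: an error \<open>u * Y\<close> is \<open>\<omega>\<close> times the weighted
    quantity \<open>\<mu> * Y\<close>.\<close>
  have \<omega>: "0 \<le> \<omega>" "u = \<omega> * \<mu>" "u \<le> \<omega>" "u / \<mu>\<^sup>2 = \<omega> / \<mu>"
    using mu u by (auto simp: \<omega>_def field_simps power2_eq_square mult_left_le_one_le)
  have muY: "0 \<le> \<mu> * Y" using mu nn by simp
  define a where "a = \<omega> * T"
  have aX: "\<omega> * X + \<omega> * (\<mu> * Y) + \<omega> * Z = a" by (simp add: a_def T algebra_simps)
  have w0: "0 \<le> \<omega> * X" "0 \<le> \<omega> * (\<mu> * Y)" "0 \<le> \<omega> * Z" using \<omega> nn muY by simp_all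
  have uX: "u * X \<le> \<omega> * X" "u * Z \<le> \<omega> * Z" using \<omega> nn by (auto intro: mult_right_mono)
  have uY: "u * Y = \<omega> * (\<mu> * Y)" using \<omega>(2) by simp
  have mE: "K * u * Y + K * \<omega> * Z = K * (\<omega> * (\<mu> * Y) + \<omega> * Z)"
    unfolding mult.assoc uY distrib_left ..
  have a0: "0 \<le> a" using aX w0 by linarith
  obtain E11 :: "real^'n^'n" and E12 :: "real^'m^'n" and E21 :: "real^'n^'m" and E22 :: "real^'m^'m"
    where e1: "Hc *v x + Ac *v y + E11 *v x + E12 *v y = fc"
    and e2': "\<forall>i. (transpose Ac *v x) $ i - dc $ i * y $ i + (E21 *v x) $ i + (E22 *v y) $ i = hc $ i"
    and E11': "\<forall>i j. \<bar>E11 $ i $ j\<bar> \<le> K * (u / \<mu>)"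
    and E12': "\<forall>i j. j \<in> B \<longrightarrow> \<bar>E12 $ i $ j\<bar> \<le> K * u" "\<forall>i j. j \<notin> B \<longrightarrow> \<bar>E12 $ i $ j\<bar> \<le> K * (u / \<mu>)"
    and E21': "\<forall>i j. i \<in> B \<longrightarrow> \<bar>E21 $ i $ j\<bar> \<le> K * u" "\<forall>i j. i \<notin> B \<longrightarrow> \<bar>E21 $ i $ j\<bar> \<le> K * (u / \<mu>)"
    and E22': "\<forall>i j. i \<in> B \<longrightarrow> j \<in> B \<longrightarrow> \<bar>E22 $ i $ j\<bar> \<le> K * u"
    "\<forall>i j. i \<in> B \<longrightarrow> j \<notin> B \<longrightarrow> \<bar>E22 $ i $ j\<bar> \<le> K * (u / \<mu>)"
    "\<forall>i j. i \<notin> B \<longrightarrow> j \<in> B \<longrightarrow> \<bar>E22 $ i $ j\<bar> \<le> K * (u / \<mu>)"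
    "\<forall>i j. i \<notin> B \<longrightarrow> j \<notin> B \<longrightarrow> \<bar>E22 $ i $ j\<bar> \<le> K * (u / \<mu>\<^sup>2)"
    by (rule condition_P_rows[OF P])
  note e2 = e2'[rule_format] and E11 = E11'[rule_format] and E12 = E12'[rule_format]
    and E21 = E21'[rule_format] and E22 = E22'[rule_format]
  have bd: "0 \<le> K * u" "0 \<le> K * (u / \<mu>)" "0 \<le> K * (u / \<mu>\<^sup>2)" using K u mu by simp_all
  \<comment> \<open>In each row the 2 accounts for the errors of two computed matrix blocks, and
    \<open>n\<close> and \<open>m\<close> account for the two backward-error blocks.\<close>
  have QL: "L * u + K * (2 + n + m) * a \<le> Q * (u + a)"
  proof -
    have "0 \<le> K * (2 + n + m) * u" "0 \<le> L * a" using K nm u L a0 by simp_all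
    then show ?thesis unfolding Q_def n_def[symmetric] m_def[symmetric] by (simp add: algebra_simps)
  qed
  have yYZ: "norm y \<le> Y + Z"
    unfolding Y_def Z_def by (metis norm_triangle_ineq restr_split)
  have Q0: "0 \<le> Q * (u + a)"
    using QL L u K nm a0 by (smt (verit) mult_nonneg_nonneg)
  have rfi: "\<bar>rf $ i\<bar> \<le> Q * (u + a)" for i
  proof -
    \<comment> \<open>The residual is the error of the right-hand side minus all matrix errors, each
      applied to the computed step.\<close>
    have "rf = (fc - f) - (Hc - H) *v x - (Ac - A) *v y - E11 *v x - E12 *v y"
      unfolding rf_def e1[symmetric] by (simp add: matrix_vector_mult_diff_rdistrib)
    then have "rf $ i = (fc $ i - f $ i) - ((Hc - H) *v x) $ i - ((Ac - A) *v y) $ i - (E11 *v x) $ i - (E12 *v y) $ i"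
      by simp
    moreover have "\<bar>((Hc - H) *v x) $ i\<bar> \<le> K * (\<omega> * X)"
    proof -
      have "\<bar>((Hc - H) *v x) $ i\<bar> \<le> norm (Hc - H) * norm x"
        using component_le_norm_cart norm_matrix_vector_le order_trans by blast
      also have "\<dots> \<le> (K * u) * X" unfolding X_def using Hc by (intro mult_right_mono) auto
      also have "\<dots> \<le> K * (\<omega> * X)" using K uX by simp
      finally show ?thesis .
    qed
    moreover have "\<bar>((Ac - A) *v y) $ i\<bar> \<le> K * (\<omega> * (\<mu> * Y) + \<omega> * Z)"
    proof -
      have "\<bar>((Ac - A) *v y) $ i\<bar> \<le> norm (Ac - A) * norm y"
        using component_le_norm_cart norm_matrix_vector_le order_trans by blast
      also have "\<dots> \<le> (K * u) * (Y + Z)" using Ac yYZ bd by (intro mult_mono) auto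
      also have "\<dots> = K * (u * Y + u * Z)" by (simp add: algebra_simps)
      also have "\<dots> \<le> K * (\<omega> * (\<mu> * Y) + \<omega> * Z)"
        unfolding uY using K uX by (intro mult_left_mono) auto
      finally show ?thesis .
    qed
    moreover have "\<bar>(E11 *v x) $ i\<bar> \<le> n * (K * (\<omega> * X))"
      using abs_matrix_vector_nth_le[of UNIV E11 i "K * (u / \<mu>)" 0 x] E11[of i] bd
      by (simp add: n_def \<omega>_def X_def mult_ac)
    moreover have "\<bar>(E12 *v y) $ i\<bar> \<le> m * (K * (\<omega> * (\<mu> * Y) + \<omega> * Z))"
      unfolding mE[symmetric] unfolding m_def Y_def Z_def \<omega>_def
      by (rule abs_matrix_vector_nth_le) (use E12[of _ i] bd in auto)
    moreover have "n * (K * (\<omega> * X)) \<le> n * (K * a)" "m * (K * (\<omega> * (\<mu> * Y) + \<omega> * Z)) \<le> m * (K * a)"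
      "K * (\<omega> * X) \<le> K * a" "K * (\<omega> * (\<mu> * Y) + \<omega> * Z) \<le> K * a"
      using nm K aX w0 by (auto intro!: mult_left_mono)
    ultimately have "\<bar>rf $ i\<bar> \<le> L * u + K * a + K * a + n * (K * a) + m * (K * a)"
      using f[of i] by linarith
    also have "\<dots> = L * u + K * (2 + n + m) * a" by (simp add: algebra_simps)
    finally show ?thesis using QL by simp
  qed
  have "norm rf \<le> n * (Q * (u + a))"
    using norm_restr_bound[of "Q * (u + a)" UNIV rf] rfi Q0 by (simp add: n_def)
  then show "norm rf \<le> real CARD('n) * (Q * (u + u / \<mu> * T))"
    by (simp add: n_def a_def \<omega>_def)
  have rhe: "rh $ i = (hc $ i - h $ i) - (transpose (Ac - A) *v x) $ i + (dc $ i - d $ i) * y $ i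
      - (E21 *v x) $ i - (E22 *v y) $ i" for i
  proof -
    have "transpose (Ac - A) *v x = transpose Ac *v x - transpose A *v x"
      by (simp add: vec_eq_iff transpose_def matrix_vector_mult_def left_diff_distrib sum_subtractf)
    then have t: "(transpose (Ac - A) *v x) $ i = (transpose Ac *v x) $ i - (transpose A *v x) $ i"
      by (simp only: vector_minus_component)
    show ?thesis unfolding rh_def e2[of i, symmetric] t by (simp add: algebra_simps)
  qed
  have At: "\<bar>(transpose (Ac - A) *v x) $ i\<bar> \<le> K * (u * X)" for i
  proof -
    have "\<bar>(transpose (Ac - A) *v x) $ i\<bar> \<le> norm (Ac - A) * norm x"
      using component_le_norm_cart norm_transpose_vector_le order_trans by blast
    also have "\<dots> \<le> (K * u) * X" unfolding X_def using Ac by (intro mult_right_mono) auto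
    finally show ?thesis by simp
  qed
  have rhB: "\<bar>rh $ i\<bar> \<le> Q * (u + a)" if i: "i \<in> B" for i
  proof -
    have "\<bar>(transpose (Ac - A) *v x) $ i\<bar> \<le> K * (\<omega> * X)"
      using At[of i] mult_left_mono[OF uX(1), of K] K by linarith
    moreover have "\<bar>(dc $ i - d $ i) * y $ i\<bar> \<le> K * (\<omega> * (\<mu> * Y))"
    proof -
      have "\<bar>(dc $ i - d $ i) * y $ i\<bar> \<le> (K * (\<mu> * u)) * Y"
        unfolding abs_mult Y_def using dB[OF i] abs_nth_le_restr[OF i, of y] K mu u by (intro mult_mono) auto
      also have "\<dots> = (K * \<mu>) * (\<omega> * (\<mu> * Y))" using \<omega>(2) by simp
      also have "\<dots> \<le> (K * 1) * (\<omega> * (\<mu> * Y))" using K mu w0 by (intro mult_right_mono mult_left_mono) auto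
      finally show ?thesis by simp
    qed
    moreover have "\<bar>(E21 *v x) $ i\<bar> \<le> n * (K * (u * X))"
      using abs_matrix_vector_nth_le[of UNIV E21 i "K * u" 0 x] E21(1)[OF i] bd
      by (simp add: n_def X_def mult_ac)
    moreover have "n * (K * (u * X)) \<le> n * (K * (\<omega> * X))"
      using nm K uX by (intro mult_left_mono) auto
    moreover have "\<bar>(E22 *v y) $ i\<bar> \<le> m * (K * (\<omega> * (\<mu> * Y) + \<omega> * Z))"
      unfolding mE[symmetric] unfolding m_def Y_def Z_def \<omega>_def
      by (rule abs_matrix_vector_nth_le) (use E22(1,2)[OF i] bd in auto)
    moreover have "n * (K * (\<omega> * X)) \<le> n * (K * a)" "m * (K * (\<omega> * (\<mu> * Y) + \<omega> * Z)) \<le> m * (K * a)"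
      "K * (\<omega> * X) \<le> K * a" "K * (\<omega> * (\<mu> * Y)) \<le> K * a"
      using nm K aX w0 by (auto intro!: mult_left_mono)
    ultimately have "\<bar>rh $ i\<bar> \<le> L * u + K * a + K * a + n * (K * a) + m * (K * a)"
      using h[of i] unfolding rhe by linarith
    also have "\<dots> = L * u + K * (2 + n + m) * a" by (simp add: algebra_simps)
    finally show ?thesis using QL by simp
  qed
  have "norm (restr B rh) \<le> m * (Q * (u + a))"
    using norm_restr_bound[OF Q0, of B rh] rhB by (simp add: m_def)
  then show "norm (restr B rh) \<le> real CARD('m) * (Q * (u + u / \<mu> * T))"
    by (simp add: m_def a_def \<omega>_def)
  \<comment> \<open>The weight \<open>\<mu>\<close> on the inactive rows brings the
    \<open>E22\<close> errors \<open>\<omega> * Y\<close> and \<open>\<omega> / \<mu> * Z\<close>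
    down to \<open>\<omega> * (\<mu> * Y)\<close> and \<open>\<omega> * Z\<close>.\<close>
  have rhN: "\<bar>(\<mu> *\<^sub>R rh) $ i\<bar> \<le> Q * (u + a)" if i: "i \<notin> B" for i
  proof -
    have "\<bar>(transpose (Ac - A) *v x) $ i\<bar> \<le> K * (\<omega> * X)"
      using At[of i] mult_left_mono[OF uX(1), of K] K by linarith
    moreover have "\<bar>(dc $ i - d $ i) * y $ i\<bar> \<le> K * (\<omega> * Z)"
    proof -
      have "\<bar>(dc $ i - d $ i) * y $ i\<bar> \<le> (K * (u / \<mu>)) * Z"
        unfolding abs_mult Z_def using dN[OF i] abs_nth_le_restr[of i "-B" y] i bd by (intro mult_mono) auto
      then show ?thesis by (simp add: \<omega>_def)
    qed
    moreover have "\<bar>(E21 *v x) $ i\<bar> \<le> n * (K * (\<omega> * X))"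
      using abs_matrix_vector_nth_le[of UNIV E21 i "K * (u / \<mu>)" 0 x] E21(2)[OF i] bd
      by (simp add: n_def \<omega>_def X_def mult_ac)
    moreover have "\<bar>(E22 *v y) $ i\<bar> \<le> m * (K * (\<omega> * Y + \<omega> / \<mu> * Z))"
      using abs_matrix_vector_nth_le[of B E22 i "K * (u / \<mu>)" "K * (u / \<mu>\<^sup>2)" y] E22(3,4)[OF i] bd
      unfolding m_def[symmetric] \<omega>(4) \<omega>_def[symmetric] Y_def[symmetric] Z_def[symmetric]
      by (simp add: algebra_simps)
    ultimately have "\<bar>rh $ i\<bar> \<le> L * u + K * (\<omega> * X) + K * (\<omega> * Z) + n * (K * (\<omega> * X)) + m * (K * (\<omega> * Y + \<omega> / \<mu> * Z))"
      using h[of i] unfolding rhe by linarith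
    then have "\<mu> * \<bar>rh $ i\<bar> \<le> \<mu> * (L * u + K * (\<omega> * X) + K * (\<omega> * Z) + n * (K * (\<omega> * X)) + m * (K * (\<omega> * Y + \<omega> / \<mu> * Z)))"
      using mu by (intro mult_left_mono) auto
    also have "\<dots> = \<mu> * (L * u + K * (\<omega> * X) + K * (\<omega> * Z) + n * (K * (\<omega> * X))) + m * (K * (\<omega> * (\<mu> * Y) + \<omega> * Z))"
      using mu by (simp add: algebra_simps)
    also have "\<dots> \<le> 1 * (L * u + K * (\<omega> * X) + K * (\<omega> * Z) + n * (K * (\<omega> * X))) + m * (K * (\<omega> * (\<mu> * Y) + \<omega> * Z))"
      using mu L u K nm w0 by (intro add_right_mono mult_right_mono) auto
    also have "\<dots> \<le> L * u + K * a + K * a + n * (K * a) + m * (K * a)"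
    proof -
      have "n * (K * (\<omega> * X)) \<le> n * (K * a)" "m * (K * (\<omega> * (\<mu> * Y) + \<omega> * Z)) \<le> m * (K * a)"
        "K * (\<omega> * X) \<le> K * a" "K * (\<omega> * Z) \<le> K * a"
        using nm K aX w0 by (auto intro!: mult_left_mono)
      then show ?thesis unfolding mult_1_left by (intro add_mono order_refl)
    qed
    also have "\<dots> = L * u + K * (2 + n + m) * a" by (simp add: algebra_simps)
    finally show ?thesis using QL mu by (simp add: abs_mult)
  qed
  have "norm (restr (-B) (\<mu> *\<^sub>R rh)) \<le> m * (Q * (u + a))"
    using norm_restr_bound[OF Q0, of "-B" "\<mu> *\<^sub>R rh"] rhN by (simp add: m_def)
  moreover have "restr (-B) (\<mu> *\<^sub>R rh) = \<mu> *\<^sub>R restr (-B) rh" by (simp add: vec_eq_iff)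
  ultimately show "\<mu> * norm (restr (-B) rh) \<le> real CARD('m) * (Q * (u + u / \<mu> * T))"
    using mu by (simp add: m_def a_def \<omega>_def)
qed

section \<open>Rounding errors of the right-hand side and of the slack step\<close>

lemma computed_rhs_error:
  assumes fp: "fp_arith u F fl" and u1: "u \<le> 1" and F: "a \<in> F" "t \<in> F" "l \<in> F" and l: "l \<noteq> 0"
    and a: "\<bar>a - b\<bar> \<le> K * u" and b: "\<bar>b\<bar> \<le> M" and tl: "\<bar>t / l\<bar> \<le> W" and K: "0 \<le> K"
  shows "\<bar>fl Plus (- a) (fl Divide t l) - (- b + t / l)\<bar> \<le> (2 * K + M + 3 * W) * u"
proof -
  define q where "q = t / l"
  have u: "0 \<le> u" using fp by (simp add: fp_arith_def)
  have na: "- a \<in> F" using fp F by (simp add: fp_arith_def)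
  obtain e where e: "\<bar>e\<bar> \<le> u" "fl Divide t l = q * (1 + e)" "fl Divide t l \<in> F"
    using fp_arithE[OF fp F(2,3), of Divide] l by (auto simp: q_def)
  obtain e' where e': "\<bar>e'\<bar> \<le> u" "fl Plus (- a) (fl Divide t l) = (- a + q * (1 + e)) * (1 + e')"
    using fp_arithE[OF fp na e(3), of Plus] e(2) by auto
  have "K * u \<le> K" using K u1 u by (simp add: mult_left_le)
  then have aM: "\<bar>a\<bar> \<le> K + M" using a b by linarith
  have W: "0 \<le> W" using tl by linarith
  have s: "\<bar>q * e\<bar> \<le> W * u" unfolding abs_mult using tl[folded q_def] e W by (intro mult_mono) auto
  moreover have "W * u \<le> W" using W u1 u by (simp add: mult_left_le)
  ultimately have "\<bar>- a + q * (1 + e)\<bar> \<le> K + M + 2 * W"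
    using aM tl[folded q_def] by (simp add: distrib_left)
  then have s': "\<bar>(- a + q * (1 + e)) * e'\<bar> \<le> (K + M + 2 * W) * u"
    unfolding abs_mult using e' by (intro mult_mono) auto
  have "fl Plus (- a) (fl Divide t l) - (- b + q) = - (a - b) + q * e + (- a + q * (1 + e)) * e'"
    unfolding e'(2) by (simp add: algebra_simps)
  then have "\<bar>fl Plus (- a) (fl Divide t l) - (- b + q)\<bar> \<le> K * u + W * u + (K + M + 2 * W) * u"
    using a s s' by linarith
  also have "\<dots> = (2 * K + M + 3 * W) * u" by (simp add: algebra_simps)
  finally show ?thesis by (simp only: q_def)
qed

text \<open>\<open>w\<close> is the computed inner product and \<open>p\<close> the exact quantity
  it approximates, whose difference is assumed to be O(u). The remaining two roundings act on
  bounded numbers, and the sign change is exact.\<close>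

lemma computed_slack_error:
  assumes fp: "fp_arith u F fl" and u1: "u \<le> 1" and F: "a \<in> F" "s \<in> F" "w \<in> F"
    and a: "\<bar>a - b\<bar> \<le> K * u" and b: "\<bar>b\<bar> \<le> M" and s: "\<bar>s\<bar> \<le> M" and K: "0 \<le> K"
    and w: "\<bar>w - p\<bar> \<le> W * u" and p: "\<bar>p\<bar> \<le> W'" and W: "0 \<le> W"
  shows "\<bar>fl Minus (- fl Plus a s) w - (- (b + s) - p)\<bar> \<le> (4 * K + 6 * M + 2 * W + W') * u"
proof -
  have u: "0 \<le> u" using fp by (simp add: fp_arith_def)
  obtain e where e: "\<bar>e\<bar> \<le> u" "fl Plus a s = (a + s) * (1 + e)" "fl Plus a s \<in> F"
    using fp_arithE[OF fp F(1,2), of Plus] by auto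
  have nF: "- fl Plus a s \<in> F" using fp e(3) by (simp add: fp_arith_def)
  obtain e' where e': "\<bar>e'\<bar> \<le> u" "fl Minus (- fl Plus a s) w = (- ((a + s) * (1 + e)) - w) * (1 + e')"
    using fp_arithE[OF fp nF F(3), of Minus] e(2) by auto
  have "K * u \<le> K" "W * u \<le> W" using K W u1 u by (simp_all add: mult_left_le)
  then have as: "\<bar>a + s\<bar> \<le> K + 2 * M" and wW: "\<bar>w\<bar> \<le> W + W'" using a b s w p by linarith+
  have q: "\<bar>(a + s) * e\<bar> \<le> (K + 2 * M) * u" unfolding abs_mult using as e by (intro mult_mono) auto
  moreover have "(K + 2 * M) * u \<le> K + 2 * M" using as u1 u by (intro mult_left_le) auto
  ultimately have "\<bar>- ((a + s) * (1 + e)) - w\<bar> \<le> 2 * (K + 2 * M) + W + W'"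
    using as wW by (simp add: distrib_left)
  then have q': "\<bar>(- ((a + s) * (1 + e)) - w) * e'\<bar> \<le> (2 * (K + 2 * M) + W + W') * u"
    unfolding abs_mult using e' by (intro mult_mono) auto
  have "fl Minus (- fl Plus a s) w - (- (b + s) - p)
      = - (a - b) - (a + s) * e - (w - p) + (- ((a + s) * (1 + e)) - w) * e'"
    unfolding e'(2) by (simp add: algebra_simps)
  then have "\<bar>fl Minus (- fl Plus a s) w - (- (b + s) - p)\<bar>
      \<le> K * u + (K + 2 * M) * u + W * u + (2 * (K + 2 * M) + W + W') * u"
    using a q w q' by linarith
  also have "\<dots> = (4 * K + 6 * M + 2 * W + W') * u" by (simp add: algebra_simps)
  finally show ?thesis .
qed

section \<open>Comparison of the exact and the computed step\<close>

text \<open>Eliminating \<open>ds\<close> from the complementarity row and dividing by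
  \<open>l $ i\<close> brings the exact step into the form treated by
  \<open>block_solution_bound\<close>, with diagonal \<open>s $ i / l $ i\<close>.\<close>

lemma exact_step_augmented:
  assumes "exact_step \<phi> g z l s t dz dl ds" "\<And>i. 0 < l $ i"
  shows "lagr_zz \<phi> g z l *v dz + nabla g z *v dl = - lagr_z \<phi> g z l"
    "(transpose (nabla g z) *v dz) $ i - s $ i / l $ i * dl $ i = - g z $ i + t $ i / l $ i"
    "ds $ i = - (g z $ i + s $ i) - (transpose (nabla g z) *v dz) $ i"
proof -
  have e1: "lagr_zz \<phi> g z l *v dz + nabla g z *v dl = - lagr_z \<phi> g z l"
    and e2: "transpose (nabla g z) *v dz + ds = - (g z + s)"
    and e3: "s $ i * dl $ i + l $ i * ds $ i = - (s $ i * l $ i + t $ i)"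
    using assms(1) by (auto simp: exact_step_def)
  show "lagr_zz \<phi> g z l *v dz + nabla g z *v dl = - lagr_z \<phi> g z l" by (rule e1)
  have "(transpose (nabla g z) *v dz + ds) $ i = (- (g z + s)) $ i" using e2 by simp
  then show ds: "ds $ i = - (g z $ i + s $ i) - (transpose (nabla g z) *v dz) $ i"
    by (simp add: algebra_simps)
  have l: "l $ i \<noteq> 0" using assms(2)[of i] by simp
  have "l $ i * ((transpose (nabla g z) *v dz) $ i - s $ i / l $ i * dl $ i) = l $ i * (- g z $ i + t $ i / l $ i)"
    using e3 l unfolding ds by (simp add: algebra_simps)
  then show "(transpose (nabla g z) *v dz) $ i - s $ i / l $ i * dl $ i = - g z $ i + t $ i / l $ i"
    using l by simp
qed

lemma sqrt_sum3_le:
  assumes "0 \<le> a" "0 \<le> b" "0 \<le> (c::real)"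
  shows "sqrt (a\<^sup>2 + b\<^sup>2 + c\<^sup>2) \<le> a + b + c"
proof (rule real_le_lsqrt)
  have "0 \<le> a * b" "0 \<le> a * c" "0 \<le> b * c" using assms by simp_all
  then show "a\<^sup>2 + b\<^sup>2 + c\<^sup>2 \<le> (a + b + c)\<^sup>2" by (simp add: power2_eq_square algebra_simps)
qed (use assms in auto)

theorem theorem6p2:
  fixes \<phi> :: "real^'n \<Rightarrow> real" and g :: "real^'n \<Rightarrow> real^'m" and zs :: "real^'n"
    and C \<gamma> K :: real
  assumes "regular_solution \<phi> g zs" and "C > 0" and "0 < \<gamma>" and "\<gamma> < 1" and "K > 0"
  shows "\<exists>\<epsilon>>0. \<exists>\<eta>>0. \<exists>\<beta>\<^sub>0>0. \<exists>K'>0.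
    \<forall>(\<beta>::real) u F fl r Uh Vh Sg U V z l s t dz dl ds dzh dlh dsh.
      \<beta> \<ge> \<beta>\<^sub>0 \<longrightarrow>
      fp_arith u F fl \<longrightarrow>
      good_iterate \<phi> g C \<gamma> z l s \<longrightarrow>
      (let \<mu> = dual_gap l s; B = active g zs; N = inactive g zs;
           th = ereal (\<beta> * max (\<mu> powr (1/3)) (u / \<mu>)) in
        norm t \<le> K * \<mu>\<^sup>2 \<longrightarrow>
        delta_dist \<phi> g zs z l \<le> \<epsilon> \<longrightarrow> \<mu> \<le> \<epsilon> \<longrightarrow> u / \<mu> \<le> \<eta> \<longrightarrow> u \<le> \<eta> \<longrightarrow>
        svd_on B (nabla g zs) r Uh Vh Sg U V \<longrightarrow>
        th \<le> sigma_min {..<r} Sg \<longrightarrow>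
        (\<forall>ls \<in> multipliers \<phi> g zs.
           th \<le> sigma_min {..<CARD('n) - r} (congr_mat Vh (lagr_zz \<phi> g zs ls))) \<longrightarrow>
        exact_step \<phi> g z l s t dz dl ds \<longrightarrow>
        computed_step \<phi> g zs K u F fl z l s t dzh dlh dsh \<longrightarrow>
          sqrt ((norm (dz - dzh))\<^sup>2 + (L2_set (tmult_on B U (dl - dlh)) {..<r})\<^sup>2
                + (norm (ds - dsh))\<^sup>2) \<le> K' * u \<and>
          L2_set (tmult_on B V (dl - dlh)) {..<card B - r} \<le> K' * (u / \<mu>) \<and>
          L2_set (\<lambda>i. dl $ i - dlh $ i) N \<le> K' * u)"
proof -
  define B where "B = active g zs"
  have N: "inactive g zs = -B" by (simp add: inactive_def B_def)
  define n m where "n = real CARD('n)" and "m = real CARD('m)"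
  have nm: "0 < n" "0 < m" by (simp_all add: n_def m_def)
  obtain \<xi> c M \<epsilon>1 where \<xi>: "0 < \<xi>" and c: "0 < c" and M: "1 \<le> M" and \<epsilon>1: "0 < \<epsilon>1"
    and est: "\<And>z l s. good_iterate \<phi> g C \<gamma> z l s \<Longrightarrow> delta_dist \<phi> g zs z l \<le> \<epsilon>1 \<Longrightarrow> dual_gap l s \<le> \<epsilon>1 \<Longrightarrow>
      block_coercive \<xi> c M B (nabla g zs) (dual_gap l s) (lagr_zz \<phi> g z l) (nabla g z) (\<chi> i. s $ i / l $ i) \<and>
      (\<forall>i. c * dual_gap l s \<le> l $ i) \<and> norm s \<le> M \<and> norm (g z) \<le> M \<and>
      norm (restr B (g z)) \<le> M * dual_gap l s"
    using iterate_estimates[OF assms(1-3)] unfolding B_def by blast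
  obtain K1 \<epsilon>2 where K1: "0 < K1" and \<epsilon>2: "0 < \<epsilon>2"
    and block: "\<And>\<mu> H A d x y f h. 0 < \<mu> \<Longrightarrow> \<mu> \<le> \<epsilon>2 \<Longrightarrow> block_coercive \<xi> c M B (nabla g zs) \<mu> H A d \<Longrightarrow>
      H *v x + A *v y = f \<Longrightarrow> (\<And>i. (transpose A *v x) $ i - d $ i * y $ i = h $ i) \<Longrightarrow>
      step_size B \<mu> x y + norm (cols B (nabla g zs) *v y)
      \<le> K1 * (norm f + norm (restr B h) + \<mu> * norm (restr (-B) h))"
    using block_solution_bound[OF \<xi> c M, where B = B and A\<^sub>1 = "nabla g zs"] unfolding step_size_def by blast
  obtain k where k: "0 < k" and svd: "\<And>r Uh Vh Sg U V y. svd_on B (nabla g zs) r Uh Vh Sg U V \<Longrightarrow>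
      L2_set (tmult_on B U y) {..<r} \<le> k * norm (cols B (nabla g zs) *v y) \<and>
      L2_set (tmult_on B V y) {..<card B - r} \<le> norm (restr B y)"
    using svd_bounds[of B "nabla g zs"] by blast
  define W where "W = K / c"
  define K3 where "K3 = K1 * (C + (M + m * W) + (M + m * W))"
  define L where "L = 2 * K + M + 3 * W"
  define Q where "Q = L + K * (2 + n + m)"
  define K4 where "K4 = K1 * ((n + m + m) * Q)"
  define K5 where "K5 = K4 * (1 + K3)"
  \<comment> \<open>The factor 2 comes from absorbing half of the weighted norm of the error, which
    the entry \<open>1 / (2 * K4)\<close> of \<open>\<eta>\<close> makes possible.\<close>
  define K6 where "K6 = 2 * K5"
  define W1 where "W1 = (1 + 2 * 2 ^ CARD('n)) * n * ((M + K) * (K3 + K6)) + K * (K3 + K6) + M * K6"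
  define K7 where "K7 = m * (4 * K + 6 * M + 2 * W1 + M * K3)"
  define K' where "K' = K6 + k * K6 + K7"
  define \<epsilon> where "\<epsilon> = Min {1, \<epsilon>1, \<epsilon>2}"
  define \<eta> where "\<eta> = Min {1, 1 / (2 * K4)}"
  have K0: "0 < K" using assms by simp
  have C0: "0 < C" using assms by simp
  have M0: "0 < M" using M by simp
  have W0: "0 < W" using K0 c by (simp add: W_def)
  have L0: "0 < L" using K0 M0 W0 by (simp add: L_def)
  have Q0: "0 < Q" using L0 K0 nm by (simp add: Q_def add_pos_pos)
  have K30: "0 < K3" using K1 C0 M0 nm W0 by (simp add: K3_def add_pos_pos)
  have K40: "0 < K4" using K1 nm Q0 by (simp add: K4_def add_pos_pos)
  have K50: "0 < K5" using K40 K30 by (simp add: K5_def add_pos_pos)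
  have K60: "0 < K6" using K50 by (simp add: K6_def)
  have W10: "0 < W1" using K0 K30 K60 M0 nm by (simp add: W1_def add_pos_pos)
  have K70: "0 < K7" using K0 M0 W10 K30 nm by (simp add: K7_def add_pos_pos)
  have K'0: "0 < K'" using K60 k K70 by (simp add: K'_def add_pos_pos)
  have \<epsilon>: "0 < \<epsilon>" "\<epsilon> \<le> 1" "\<epsilon> \<le> \<epsilon>1" "\<epsilon> \<le> \<epsilon>2" using \<epsilon>1 \<epsilon>2 by (auto simp: \<epsilon>_def)
  have \<eta>: "0 < \<eta>" "\<eta> \<le> 1" "\<eta> \<le> 1 / (2 * K4)" using K40 by (auto simp: \<eta>_def)

  have main: "sqrt ((norm (dz - dzh))\<^sup>2 + (L2_set (tmult_on B U (dl - dlh)) {..<r})\<^sup>2 + (norm (ds - dsh))\<^sup>2) \<le> K' * u \<and>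
      L2_set (tmult_on B V (dl - dlh)) {..<card B - r} \<le> K' * (u / \<mu>) \<and>
      L2_set (\<lambda>i. dl $ i - dlh $ i) (-B) \<le> K' * u"
    if fp: "fp_arith u F fl" and gi: "good_iterate \<phi> g C \<gamma> z l s" and \<mu>_def: "\<mu> = dual_gap l s"
      and t: "norm t \<le> K * \<mu>\<^sup>2" and de: "delta_dist \<phi> g zs z l \<le> \<epsilon>" and mue: "\<mu> \<le> \<epsilon>"
      and um: "u / \<mu> \<le> \<eta>" and u\<eta>: "u \<le> \<eta>" and sv: "svd_on B (nabla g zs) r Uh Vh Sg U V"
      and ex: "exact_step \<phi> g z l s t dz dl ds"
      and comp: "computed_step \<phi> g zs K u F fl z l s t dzh dlh dsh"
    for u F fl and r Uh Vh Sg U V z l s t dz dl ds dzh dlh dsh \<mu>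
  proof -
    have u: "0 \<le> u" "u \<le> 1" using fp u\<eta> \<eta> by (auto simp: fp_arith_def)
    have mu: "0 < \<mu>" "\<mu> \<le> 1" "\<mu> \<le> \<epsilon>1" "\<mu> \<le> \<epsilon>2"
      using good_iterate_pos(1)[OF gi] mue \<epsilon> by (auto simp: \<mu>_def)
    have lpos: "0 < l $ i" for i using good_iterate_pos(2)[OF gi] .
    define H A d where "H = lagr_zz \<phi> g z l" and "A = nabla g z" and "d = (\<chi> i. s $ i / l $ i)"
    have bc: "block_coercive \<xi> c M B (nabla g zs) \<mu> H A d"
      and lc: "\<And>i. c * \<mu> \<le> l $ i" and sM: "norm s \<le> M" and gM: "norm (g z) \<le> M"
      and gB: "norm (restr B (g z)) \<le> M * \<mu>"
      using est[OF gi] de mu(3) \<epsilon> unfolding \<mu>_def H_def A_def d_def by auto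
    have AM: "norm A \<le> M" using bc by (simp add: block_coercive_def)
    define f h where "f = - lagr_z \<phi> g z l" and "h = (\<chi> i. - g z $ i + t $ i / l $ i)"
    have Lz: "norm f \<le> C * \<mu>" using gi by (simp add: good_iterate_def \<mu>_def f_def)
    \<comment> \<open>Here \<open>t\<close> is O(\<open>\<mu>\<^sup>2\<close>) while every
      multiplier is at least \<open>c * \<mu>\<close>.\<close>
    have tl: "\<bar>t $ i / l $ i\<bar> \<le> W * \<mu>" for i
    proof -
      have "\<bar>t $ i\<bar> \<le> K * \<mu>\<^sup>2" using component_le_norm_cart[of t i] t by linarith
      then have "\<bar>t $ i\<bar> / l $ i \<le> (K * \<mu>\<^sup>2) / (c * \<mu>)"
        using lc[of i] c mu lpos[of i] by (intro frac_le) auto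
      also have "\<dots> = W * \<mu>" using mu c by (simp add: W_def power2_eq_square)
      finally show ?thesis using lpos[of i] by (simp add: abs_divide)
    qed
    have tl1: "\<bar>t $ i / l $ i\<bar> \<le> W" for i
      using tl[of i] mult_left_le[of \<mu> W] mu W0 by linarith
    define q where "q = (\<chi> i. t $ i / l $ i)"
    have hq: "h = q - g z" by (simp add: h_def q_def vec_eq_iff)
    have qn: "norm (restr I q) \<le> m * (W * \<mu>)" for I
      using norm_restr_bound[of "W * \<mu>" I q] tl mu W0 by (simp add: q_def m_def)
    have hB: "norm (restr B h) \<le> (M + m * W) * \<mu>"
    proof -
      have "norm (restr B h) \<le> norm (restr B q) + norm (restr B (g z))"
        unfolding hq restr_diff by (rule norm_triangle_ineq4)
      then show ?thesis using qn[of B] gB by (simp add: algebra_simps)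
    qed
    \<comment> \<open>Inactive entries of \<open>h\<close> are merely bounded; the weight supplies
      the factor \<open>\<mu>\<close>.\<close>
    have hN: "\<mu> * norm (restr (-B) h) \<le> (M + m * W) * \<mu>"
    proof -
      have "norm (restr (-B) h) \<le> norm (restr (-B) q) + norm (restr (-B) (g z))"
        unfolding hq restr_diff by (rule norm_triangle_ineq4)
      also have "\<dots> \<le> m * (W * 1) + M"
      proof (rule add_mono)
        have "m * (W * \<mu>) \<le> m * (W * 1)" using nm W0 mu by (intro mult_left_mono) auto
        then show "norm (restr (-B) q) \<le> m * (W * 1)" using qn[of "-B"] by linarith
        show "norm (restr (-B) (g z)) \<le> M" using norm_restr_le[of "-B" "g z"] gM by linarith
      qed
      finally have "\<mu> * norm (restr (-B) h) \<le> \<mu> * (m * (W * 1) + M)" using mu by (intro mult_left_mono) auto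
      then show ?thesis by (simp add: algebra_simps)
    qed
    note exact = exact_step_augmented[OF ex lpos]
    have ex1: "H *v dz + A *v dl = f" using exact(1) by (simp add: H_def A_def f_def)
    have ex2: "(transpose A *v dz) $ i - d $ i * dl $ i = h $ i" for i
      using exact(2)[of i] by (simp add: A_def d_def h_def)
    have Te: "step_size B \<mu> dz dl \<le> K3 * \<mu>"
    proof -
      have "step_size B \<mu> dz dl \<le> K1 * (norm f + norm (restr B h) + \<mu> * norm (restr (-B) h))"
        using block[OF mu(1) mu(4) bc ex1 ex2] norm_ge_zero[of "cols B (nabla g zs) *v dl"] by linarith
      also have "\<dots> \<le> K1 * (C * \<mu> + (M + m * W) * \<mu> + (M + m * W) * \<mu>)"
        using K1 Lz hB hN by (intro mult_left_mono add_mono) auto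
      finally show ?thesis by (simp add: K3_def algebra_simps)
    qed

    obtain Hc Lc Ac gh dc where FH: "norm (Hc - H) \<le> K * u"
      and Lc: "norm (Lc - lagr_z \<phi> g z l) \<le> K * u"
      and Ac: "fp_mat F Ac" "norm (Ac - A) \<le> K * u" and gh: "fp_vec F gh" "norm (gh - g z) \<le> K * u"
      and dB: "L2_set (\<lambda>i. dc $ i - s $ i / l $ i) B \<le> K * (\<mu> * u)"
      and dN: "L2_set (\<lambda>i. dc $ i - s $ i / l $ i) (-B) \<le> K * (u / \<mu>)"
      and P: "condition_P K u \<mu> B (-B) (aug_mat Hc Ac dc)
          (vcat (- Lc) (\<chi> i. fl Plus (- gh $ i) (fl Divide (t $ i) (l $ i)))) (vcat dzh dlh)"
      and slack: "\<forall>i. \<exists>w. fl_inner fl (column i Ac) dzh w \<and> dsh $ i = fl Minus (- fl Plus (gh $ i) (s $ i)) w"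
      using comp unfolding computed_step_def N B_def[symmetric] \<mu>_def[symmetric] H_def[symmetric] A_def[symmetric]
      by blast
    have F: "fp_vec F l" "fp_vec F s" "fp_vec F t" "fp_vec F dzh"
      using comp by (auto simp: computed_step_def)
    define fc hc where "fc = - Lc" and "hc = (\<chi> i. fl Plus (- gh $ i) (fl Divide (t $ i) (l $ i)))"
    have ghi: "\<bar>gh $ i - g z $ i\<bar> \<le> K * u" for i
      using component_le_norm_cart[of "gh - g z" i] gh by simp
    have gi': "\<bar>g z $ i\<bar> \<le> M" and si': "\<bar>s $ i\<bar> \<le> M" for i
      using component_le_norm_cart[of "g z" i] gM component_le_norm_cart[of s i] sM by linarith+
    have KL: "K \<le> L" using K0 M0 W0 by (simp add: L_def)
    have fcf: "\<bar>fc $ i - f $ i\<bar> \<le> L * u" for i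
    proof -
      have "\<bar>fc $ i - f $ i\<bar> \<le> K * u"
        using component_le_norm_cart[of "Lc - lagr_z \<phi> g z l" i] Lc by (simp add: fc_def f_def)
      then show ?thesis using mult_right_mono[OF KL u(1)] by linarith
    qed
    have hch: "\<bar>hc $ i - h $ i\<bar> \<le> L * u" for i
      using computed_rhs_error[OF fp u(2), of "gh $ i" "t $ i" "l $ i" "g z $ i" K M W]
        gh(1) F lpos[of i] ghi[of i] gi'[of i] tl1[of i] K0
      by (simp add: hc_def h_def L_def fp_vec_def)
    define Th where "Th = step_size B \<mu> dzh dlh"
    define x y where "x = dzh - dz" and "y = dlh - dl"
    define rf where "rf = H *v dzh + A *v dlh - f"
    define rh where "rh = (\<chi> i. (transpose A *v dzh) $ i - d $ i * dlh $ i - h $ i)"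
    have dB': "\<bar>dc $ i - d $ i\<bar> \<le> K * (\<mu> * u)" if "i \<in> B" for i
      using abs_nth_le_restr[OF that, of "dc - d"] dB by (simp add: norm_restr_L2 d_def)
    have dN': "\<bar>dc $ i - d $ i\<bar> \<le> K * (u / \<mu>)" if "i \<notin> B" for i
      using abs_nth_le_restr[of i "-B" "dc - d"] dN that by (simp add: norm_restr_L2 d_def)
    note res = computed_residual_bound[OF mu(1,2) u(1) K0 P[folded fc_def hc_def] FH Ac(2) dB' dN' fcf hch less_imp_le[OF L0],
      folded rf_def rh_def n_def m_def Th_def, folded Q_def]
    \<comment> \<open>By linearity the error solves the exact system with the residuals as
      data.\<close>
    have T: "step_size B \<mu> x y + norm (cols B (nabla g zs) *v y) \<le> K4 * (u + u / \<mu> * Th)"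
    proof -
      have "H *v x + A *v y = rf"
        using ex1 by (simp add: x_def y_def rf_def matrix_vector_mult_diff_distrib algebra_simps)
      moreover have "(transpose A *v x) $ i - d $ i * y $ i = rh $ i" for i
        using ex2[of i] by (simp add: x_def y_def rh_def matrix_vector_mult_diff_distrib algebra_simps)
      ultimately have "step_size B \<mu> x y + norm (cols B (nabla g zs) *v y)
          \<le> K1 * (norm rf + norm (restr B rh) + \<mu> * norm (restr (-B) rh))"
        by (rule block[OF mu(1) mu(4) bc])
      also have "\<dots> \<le> K1 * (n * (Q * (u + u / \<mu> * Th)) + m * (Q * (u + u / \<mu> * Th)) + m * (Q * (u + u / \<mu> * Th)))"
        using K1 res by (intro mult_left_mono add_mono) auto
      finally show ?thesis by (simp add: K4_def algebra_simps)
    qed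
    have T': "step_size B \<mu> x y + norm (cols B (nabla g zs) *v y) \<le> K6 * u"
    proof -
      have um0: "0 \<le> u / \<mu>" using u mu by simp
      \<comment> \<open>The computed step is split into the exact step and the error: the first
        contributes \<open>K3 * u\<close>, the second is absorbed.\<close>
      have "Th \<le> K3 * \<mu> + step_size B \<mu> x y"
        unfolding Th_def x_def y_def using step_size_diff_le[of \<mu> B dzh dlh dz dl] Te mu by simp
      then have "u / \<mu> * Th \<le> u / \<mu> * (K3 * \<mu> + step_size B \<mu> x y)" using um0 by (rule mult_left_mono)
      also have "\<dots> = K3 * u + u / \<mu> * step_size B \<mu> x y" using mu by (simp add: field_simps)
      also have "\<dots> \<le> K3 * u + 1 / (2 * K4) * step_size B \<mu> x y"
        using um \<eta>(3) step_size_nonneg[of \<mu> B x y] mu by (intro add_left_mono mult_right_mono) auto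
      finally have "K4 * (u + u / \<mu> * Th) \<le> K4 * (u + (K3 * u + 1 / (2 * K4) * step_size B \<mu> x y))"
        using K40 by (intro mult_left_mono) auto
      also have "\<dots> = K5 * u + step_size B \<mu> x y / 2" using K40 by (simp add: K5_def algebra_simps)
      finally show ?thesis
        using T norm_ge_zero[of "cols B (nabla g zs) *v y"] unfolding K6_def mult.assoc by linarith
    qed
    have xyb: "norm x \<le> K6 * u" "\<mu> * norm (restr B y) \<le> K6 * u" "norm (restr (-B) y) \<le> K6 * u"
      "norm (cols B (nabla g zs) *v y) \<le> K6 * u"
    proof -
      have "0 \<le> norm x" "0 \<le> \<mu> * norm (restr B y)" "0 \<le> norm (restr (-B) y)" "0 \<le> norm (cols B (nabla g zs) *v y)"
        using mu by simp_all
      then show "norm x \<le> K6 * u" "\<mu> * norm (restr B y) \<le> K6 * u" "norm (restr (-B) y) \<le> K6 * u"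
        "norm (cols B (nabla g zs) *v y) \<le> K6 * u"
        using T' unfolding step_size_def by linarith+
    qed
    have dzn: "norm dz \<le> K3"
    proof -
      have "0 \<le> \<mu> * norm (restr B dl)" "0 \<le> norm (restr (-B) dl)" using mu by simp_all
      then have "norm dz \<le> K3 * \<mu>" using Te unfolding step_size_def by linarith
      also have "\<dots> \<le> K3" using K30 mu by (simp add: mult_left_le)
      finally show ?thesis .
    qed
    have dzhn: "norm dzh \<le> K3 + K6"
    proof -
      have "K6 * u \<le> K6" using K60 u by (simp add: mult_left_le)
      then show ?thesis using norm_triangle_sub[of dzh dz] dzn xyb(1) by (simp add: x_def)
    qed
    \<comment> \<open>Three sources are collected in \<open>W1\<close>: the rounded inner product,
      the error in the computed gradients, and the error in \<open>dz\<close>.\<close>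
    have dsi: "\<bar>(ds - dsh) $ i\<bar> \<le> (4 * K + 6 * M + 2 * W1 + M * K3) * u" for i
    proof -
      obtain w where w: "fl_inner fl (column i Ac) dzh w" and dsh: "dsh $ i = fl Minus (- fl Plus (gh $ i) (s $ i)) w"
        using slack by blast
      have cF: "fp_vec F (column i Ac)" using Ac(1) by (simp add: fp_vec_def fp_mat_def column_def)
      have tc: "column i Ac \<bullet> v = (transpose Ac *v v) $ i" for v
        by (simp add: inner_vec_def matrix_vector_mult_def column_def transpose_def)
      have cn: "norm (column i Ac) \<le> M + K"
      proof -
        have "norm (column i Ac) \<le> norm Ac"
        proof -
          have "column i Ac = Ac *v axis i 1" by (simp add: matrix_vector_mul_component matrix_vector_mult_basis)
          then show ?thesis using norm_matrix_vector_le[of Ac "axis i 1"] by (simp add: norm_axis_1)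
        qed
        also have "norm Ac \<le> norm A + norm (Ac - A)" by (rule norm_triangle_sub)
        also have "\<dots> \<le> M + K" using AM Ac(2) mult_left_le[of u K] K0 u by linarith
        finally show ?thesis .
      qed
      have wF: "w \<in> F" and we: "\<bar>w - column i Ac \<bullet> dzh\<bar> \<le> (1 + 2 * 2 ^ CARD('n)) * n * ((M + K) * (K3 + K6)) * u"
      proof -
        note e = fl_inner_error[OF fp u(2) cF F(4) w]
        show "w \<in> F" by (rule e(1))
        have "norm (column i Ac) * norm dzh \<le> (M + K) * (K3 + K6)"
          using cn dzhn M0 K0 by (intro mult_mono) auto
        then have "(1 + 2 * 2 ^ CARD('n)) * n * u * (norm (column i Ac) * norm dzh)
            \<le> (1 + 2 * 2 ^ CARD('n)) * n * u * ((M + K) * (K3 + K6))"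
          using nm u by (intro mult_left_mono) auto
        then show "\<bar>w - column i Ac \<bullet> dzh\<bar> \<le> (1 + 2 * 2 ^ CARD('n)) * n * ((M + K) * (K3 + K6)) * u"
          using e(2) unfolding n_def[symmetric] by (simp add: mult_ac)
      qed
      define p where "p = (transpose A *v dz) $ i"
      have "column i Ac \<bullet> dzh - p = (transpose (Ac - A) *v dzh) $ i + (transpose A *v x) $ i"
        unfolding tc p_def x_def
        by (simp add: matrix_vector_mult_def transpose_def left_diff_distrib right_diff_distrib sum_subtractf)
      moreover have "\<bar>(transpose (Ac - A) *v dzh) $ i\<bar> \<le> K * (K3 + K6) * u"
      proof -
        have "\<bar>(transpose (Ac - A) *v dzh) $ i\<bar> \<le> norm (Ac - A) * norm dzh"
          using component_le_norm_cart norm_transpose_vector_le order_trans by blast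
        also have "\<dots> \<le> (K * u) * (K3 + K6)" using Ac(2) dzhn K0 u by (intro mult_mono) auto
        finally show ?thesis by (simp add: mult_ac)
      qed
      moreover have "\<bar>(transpose A *v x) $ i\<bar> \<le> M * K6 * u"
      proof -
        have "\<bar>(transpose A *v x) $ i\<bar> \<le> norm A * norm x"
          using component_le_norm_cart norm_transpose_vector_le order_trans by blast
        also have "\<dots> \<le> M * (K6 * u)" using AM xyb(1) M0 by (intro mult_mono) auto
        finally show ?thesis by (simp add: mult_ac)
      qed
      ultimately have "\<bar>w - p\<bar> \<le> (1 + 2 * 2 ^ CARD('n)) * n * ((M + K) * (K3 + K6)) * u + K * (K3 + K6) * u + M * K6 * u"
        using we by linarith
      then have wp: "\<bar>w - p\<bar> \<le> W1 * u" by (simp add: W1_def algebra_simps)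
      have pM: "\<bar>p\<bar> \<le> M * K3"
      proof -
        have "\<bar>p\<bar> \<le> norm A * norm dz"
          unfolding p_def using component_le_norm_cart norm_transpose_vector_le order_trans by blast
        also have "\<dots> \<le> M * K3" using AM dzn M0 by (intro mult_mono) auto
        finally show ?thesis .
      qed
      have "\<bar>dsh $ i - ds $ i\<bar> \<le> (4 * K + 6 * M + 2 * W1 + M * K3) * u"
        unfolding dsh exact(3) A_def[symmetric] p_def[symmetric]
        by (rule computed_slack_error[OF fp u(2) _ _ wF ghi gi' si' less_imp_le[OF K0] wp pM less_imp_le[OF W10]])
          (use gh(1) F in \<open>auto simp: fp_vec_def\<close>)
      then show ?thesis by (simp add: abs_minus_commute)
    qed
    have dsn: "norm (ds - dsh) \<le> K7 * u"
    proof -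
      have "norm (restr UNIV (ds - dsh)) \<le> m * ((4 * K + 6 * M + 2 * W1 + M * K3) * u)"
        unfolding m_def using dsi K0 M0 W10 K30 u by (intro norm_restr_bound) auto
      then show ?thesis by (simp add: K7_def mult_ac)
    qed
    have xd: "dz - dzh = - x" by (simp add: x_def)
    have cy: "norm (cols B (nabla g zs) *v (dl - dlh)) \<le> K6 * u"
    proof -
      have "cols B (nabla g zs) *v (dl - dlh) = - (cols B (nabla g zs) *v y)"
        by (simp add: y_def matrix_vector_mult_diff_distrib)
      then show ?thesis using xyb(4) by simp
    qed
    have ry: "norm (restr I (dl - dlh)) = norm (restr I y)" for I
      unfolding y_def restr_diff by (rule norm_minus_commute)
    have "L2_set (tmult_on B U (dl - dlh)) {..<r} \<le> k * (K6 * u)"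
      using svd[OF sv, of "dl - dlh"] mult_left_mono[OF cy less_imp_le[OF k]] by linarith
    then have "norm (dz - dzh) + L2_set (tmult_on B U (dl - dlh)) {..<r} + norm (ds - dsh) \<le> K' * u"
      using xyb(1) dsn unfolding xd by (simp add: K'_def algebra_simps)
    then have 1: "sqrt ((norm (dz - dzh))\<^sup>2 + (L2_set (tmult_on B U (dl - dlh)) {..<r})\<^sup>2 + (norm (ds - dsh))\<^sup>2) \<le> K' * u"
      using sqrt_sum3_le[of "norm (dz - dzh)" "L2_set (tmult_on B U (dl - dlh)) {..<r}" "norm (ds - dsh)"]
      by (simp add: L2_set_nonneg)
    have KK: "K6 \<le> K'" using k K60 K70 by (simp add: K'_def)
    \<comment> \<open>Dividing out the weight of the active duals produces the order
      \<open>u / \<mu>\<close> of the \<open>V\<close> component.\<close>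
    have "norm (restr B y) \<le> K6 * u / \<mu>" using xyb(2) mu by (simp add: field_simps)
    also have "\<dots> = K6 * (u / \<mu>)" by simp
    also have "\<dots> \<le> K' * (u / \<mu>)" using KK u mu by (intro mult_right_mono) auto
    finally have 2: "L2_set (tmult_on B V (dl - dlh)) {..<card B - r} \<le> K' * (u / \<mu>)"
      using svd[OF sv, of "dl - dlh"] ry[of B] by simp
    have "norm (restr (-B) (dl - dlh)) \<le> K' * u"
      using xyb(3) ry[of "-B"] mult_right_mono[OF KK u(1)] by linarith
    then have 3: "L2_set (\<lambda>i. dl $ i - dlh $ i) (-B) \<le> K' * u" by (simp add: norm_restr_L2)
    show ?thesis using 1 2 3 by blast
  qed
  show ?thesis
    unfolding Let_def N B_def[symmetric]
    by (intro exI[of _ \<epsilon>] exI[of _ \<eta>] exI[of _ "1::real"] exI[of _ K'] conjI[OF \<epsilon>(1)] conjI[OF \<eta>(1)] conjI[OF K'0]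
        conjI[OF zero_less_one] allI impI) (rule main[OF _ _ refl])
qed

end
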